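(* Let $G$, $H$, $\mathcal{H}$, $U$, $\phi$, $\Phi=\{\varphi_1,\dots,\varphi_N\}$, $\mathcal{H}_\Phi$ and $\mathcal{H}_{U,\phi,\Phi}$ be as described in the context, and let $\boldsymbol{\mathcal{L}}_A=(\mathcal{L}_1,\dots,\mathcal{L}_M)^\top$ be a generalized stable sampling procedure at $H$ in $\mathcal{H}_{U,\phi,\Phi}$ associated with a matrix $A=[a_{m,n}]\in\mathcal{M}_{M\times N}(\ell^2(H))$; that is, $\widehat{A}\in\mathcal{M}_{M\times N}(L^\infty(\widehat{H}))$, $\delta_A:=\operatorname{ess\,inf}_{\xi\in\widehat{H}}\det[\widehat{A}(\xi)^*\widehat{A}(\xi)]>0$, and $\mathcal{L}_mF(t)=\sum_{n=1}^N(a_{m,n}\ast_H x_n)(t)$ for $t\in H$, $m=1,\dots,M$, where $F=F_f$ with $f=\sum_{n=1}^N\sum_{h\in H}x_n(h)U(h)\varphi_n$. Then there exist $M$ functions $S_1,\dots,S_M\in\mathcal{H}_{U,\phi,\Phi}$ such that the sequence $\{S_m(\cdot-t)\}_{t\in H;\,m=1,\dots,M}$ is a frame for $\mathcal{H}_{U,\phi,\Phi}$, and the sampling expansion $$F(s)=\sum_{m=1}^M\sum_{t\in H}\mathcal{L}_mF(t)\,S_m(s-t),\qquad s\in G,$$ holds for every $F\in\mathcal{H}_{U,\phi,\Phi}$. The pointwise convergence of this series is absolute at every $s\in G$ and uniform on $G$, and the series also converges to $F$ in the $L^2(G)$-norm.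
   Context: Setting. $(G,+)$ is a locally compact abelian (LCA) group with Haar measure $\mu_G$, and $L^2(G)=L^2(G,\mu_G)$. $\mathcal{H}$ is a separable complex Hilbert space, with inner product linear in the first variable. $t\mapsto U(t)$ is a unitary representation of $G$ on $\mathcal{H}$: each $U(t)$ is unitary, $U(t)U(t')=U(t+t')$, $U(0)=I_{\mathcal{H}}$, and $t\mapsto\langle U(t)\varphi,\psi\rangle_{\mathcal{H}}$ is continuous for all $\varphi,\psi\in\mathcal{H}$. A vector $\phi\in\mathcal{H}$ is fixed such that $\{U(t)\phi\}_{t\in G}$ is a continuous frame for $\mathcal{H}$ with respect to $(G,\mu_G)$: there are constants $0<c_1\le c_2$ with $c_1\|x\|^2\le\int_G|\langle x,U(t)\phi\rangle|^2\,d\mu_G(t)\le c_2\|x\|^2$ for all $x\in\mathcal{H}$. $H$ is a countable discrete subgroup of $G$. $\Phi=\{\varphi_1,\dots,\varphi_N\}\subset\mathcal{H}$ is such that $\{U(h)\varphi_n\}_{h\in H;\,n=1,\dots,N}$ is a Riesz sequence in $\mathcal{H}$, i.e. a Riesz basis for the closed subspace $$\mathcal{H}_\Phi=\Big\{\sum_{n=1}^N\sum_{h\in H}x_n(h)U(h)\varphi_n:\ x_n\in\ell^2(H),\ n=1,\dots,N\Big\}.$$ Thus each $f\in\mathcal{H}_\Phi$ has unique coefficients $\mathbf{x}=(x_1,\dots,x_N)^\top\in\ell^2(H)^N$. For $f\in\mathcal{H}_\Phi$ put $F_f(t)=\langle f,U(t)\phi\rangle_{\mathcal{H}}$, $t\in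 G$, and $\mathcal{H}_{U,\phi,\Phi}:=\{F_f: f\in\mathcal{H}_\Phi\}$. This is a closed subspace of $L^2(G)$ (with the $L^2(G)$-norm) consisting of continuous bounded functions; it is a reproducing kernel Hilbert space, $f\mapsto F_f$ is a Hilbert space isomorphism (bounded with bounded inverse) from $\mathcal{H}_\Phi$ onto it, and it is invariant under translations by elements of $H$. Notation. $\widehat{H}$ is the (compact) dual group of $H$, with its Haar measure. For $x\in\ell^1(H)$, $\widehat{x}(\xi)=\sum_{h\in H}x(h)\overline{(h,\xi)}$, $\xi\in\widehat{H}$, where $(h,\xi)=\xi(h)$; this extends to a unitary map $\ell^2(H)\to L^2(\widehat{H})$. For sequences on $H$, $(a\ast_H x)(t)=\sum_{h\in H}a(t-h)x(h)$. $\mathcal{M}_{M\times N}(X)$ denotes $M\times N$ matrices with entries in $X$. For $A=[a_{m,n}]\in\mathcal{M}_{M\times N}(\ell^2(H))$, the transfer matrix is $\widehat{A}(\xi)=[\widehat{a}_{m,n}(\xi)]$, and $\widehat{A}(\xi)^*$ is its conjugate transpose. A sequence $\{y_k\}$ in a Hilbert space $\mathcal{K}$ is a frame for $\mathcal{K}$ if there are $0<c\le C$ with $c\|y\|^2\le\sum_k|\langle y,y_k\rangle|^2\le C\|y\|^2$ for all $y\in\mathcal{K}$. *)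

theory Defs
  imports "HOL-Analysis.Analysis" "HOL-Probability.Essential_Supremum"
begin

section \<open>Complex Hilbert spaces\<close>

text \<open>The inner product is linear in its first argument. Completeness is part of \<open>banach\<close>.\<close>

class complex_hilbert = banach +
  fixes scaleC :: "complex \<Rightarrow> 'a \<Rightarrow> 'a" (infixr \<open>*\<^sub>C\<close> 75)
    and cinner :: "'a \<Rightarrow> 'a \<Rightarrow> complex"
  assumes scaleC_add_right: "c *\<^sub>C (x + y) = c *\<^sub>C x + c *\<^sub>C y"
    and scaleC_add_left: "(c + d) *\<^sub>C x = c *\<^sub>C x + d *\<^sub>C x"
    and scaleC_scaleC: "c *\<^sub>C d *\<^sub>C x = (c * d) *\<^sub>C x"
    and scaleR_eq_scaleC: "r *\<^sub>R x = complex_of_real r *\<^sub>C x"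
    and cinner_commute: "cinner x y = cnj (cinner y x)"
    and cinner_add_left: "cinner (x + y) z = cinner x z + cinner y z"
    and cinner_scaleC_left: "cinner (c *\<^sub>C x) y = c * cinner x y"
    and cinner_self: "cinner x x = complex_of_real ((norm x)\<^sup>2)"

interpretation complex_vec: vector_space "scaleC :: complex \<Rightarrow> 'a \<Rightarrow> 'a::complex_hilbert"
proof
  show "1 *\<^sub>C x = x" for x :: 'a
    using scaleR_eq_scaleC[of 1 x] by simp
qed (simp_all add: scaleC_add_right scaleC_add_left scaleC_scaleC)

definition unitary_operator :: "('h::complex_hilbert \<Rightarrow> 'h) \<Rightarrow> bool" where
  "unitary_operator T \<longleftrightarrow>
     Vector_Spaces.linear scaleC scaleC T \<and> surj T \<and>
     (\<forall>x y. cinner (T x) (T y) = cinner x y)"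

definition orthonormal_basis :: "'i set \<Rightarrow> ('i \<Rightarrow> 'h::complex_hilbert) \<Rightarrow> 'h set \<Rightarrow> bool" where
  "orthonormal_basis I e V \<longleftrightarrow>
     (\<forall>i\<in>I. \<forall>j\<in>I. cinner (e i) (e j) = (if i = j then 1 else 0)) \<and>
     closure (complex_vec.span (e ` I)) = V"

text \<open>A Riesz basis of a closed subspace is the image of an orthonormal basis under a bounded
  linear bijection of the subspace with bounded inverse.\<close>

definition riesz_basis :: "'i set \<Rightarrow> ('i \<Rightarrow> 'h::complex_hilbert) \<Rightarrow> 'h set \<Rightarrow> bool" where
  "riesz_basis I v V \<longleftrightarrow>
     closed V \<and> complex_vec.subspace V \<and>
     (\<exists>e T. orthonormal_basis I e V \<and>
        (\<forall>x\<in>V. \<forall>y\<in>V. T (x + y) = T x + T y) \<and>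
        (\<forall>c. \<forall>x\<in>V. T (c *\<^sub>C x) = c *\<^sub>C T x) \<and>
        bij_betw T V V \<and>
        (\<exists>c C. 0 < c \<and> (\<forall>x\<in>V. c * norm x \<le> norm (T x) \<and> norm (T x) \<le> C * norm x)) \<and>
        (\<forall>i\<in>I. v i = T (e i)))"

text \<open>Frames for a space \<open>K\<close> whose inner product is \<open>ip\<close>; this covers spaces of functions
  with the \<open>L\<^sup>2\<close> inner product, which do not form a type.\<close>

definition is_frame ::
    "('k \<Rightarrow> 'k \<Rightarrow> complex) \<Rightarrow> 'k set \<Rightarrow> 'i set \<Rightarrow> ('i \<Rightarrow> 'k) \<Rightarrow> bool" where
  "is_frame ip K I v \<longleftrightarrow>
     (\<forall>i\<in>I. v i \<in> K) \<and>
     (\<exists>c C. 0 < c \<and> c \<le> C \<and>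
        (\<forall>y\<in>K. (\<lambda>i. (cmod (ip y (v i)))\<^sup>2) summable_on I \<and>
           c * Re (ip y y) \<le> (\<Sum>\<^sub>\<infinity>i\<in>I. (cmod (ip y (v i)))\<^sup>2) \<and>
           (\<Sum>\<^sub>\<infinity>i\<in>I. (cmod (ip y (v i)))\<^sup>2) \<le> C * Re (ip y y)))"

definition L2_inner :: "'a measure \<Rightarrow> ('a \<Rightarrow> complex) \<Rightarrow> ('a \<Rightarrow> complex) \<Rightarrow> complex" where
  "L2_inner M F K = (LINT t|M. F t * cnj (K t))"

text \<open>The squared \<open>L\<^sup>2\<close> distance as an extended real, so that it is meaningful (possibly
  infinite) without any integrability assumption.\<close>

definition L2_dist_sq :: "'a measure \<Rightarrow> ('a \<Rightarrow> complex) \<Rightarrow> ('a \<Rightarrow> complex) \<Rightarrow> ennreal" where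
  "L2_dist_sq M F K = (\<integral>\<^sup>+ t. ennreal ((cmod (F t - K t))\<^sup>2) \<partial>M)"


section \<open>Haar measure, discrete subgroups and their duals\<close>

text \<open>Haar measure of a locally compact abelian group given by a topology \<open>X\<close> and an
  operation \<open>f\<close> on \<open>topspace X\<close>: a nonzero invariant Radon measure on the Borel sets. It is
  stated for abstract topologies because the dual group below is not a type.\<close>

definition haar_measure :: "'a topology \<Rightarrow> ('a \<Rightarrow> 'a \<Rightarrow> 'a) \<Rightarrow> 'a measure \<Rightarrow> bool" where
  "haar_measure X f M \<longleftrightarrow>
     space M = topspace X \<and>
     sets M = sigma_sets (topspace X) {U. openin X U} \<and>
     emeasure M (space M) \<noteq> 0 \<and>
     (\<forall>K. compactin X K \<and> K \<in> sets M \<longrightarrow> emeasure M K < \<infinity>) \<and>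
     (\<forall>g\<in>topspace X. \<forall>B\<in>sets M. emeasure M (f g ` B) = emeasure M B) \<and>
     (\<forall>B\<in>sets M. emeasure M B = (INF U\<in>{U. openin X U \<and> B \<subseteq> U}. emeasure M U)) \<and>
     (\<forall>U. openin X U \<longrightarrow>
        emeasure M U = (SUP K\<in>{K. compactin X K \<and> K \<in> sets M \<and> K \<subseteq> U}. emeasure M K))"

definition add_subgroup :: "'g::group_add set \<Rightarrow> bool" where
  "add_subgroup H \<longleftrightarrow> 0 \<in> H \<and> (\<forall>x\<in>H. \<forall>y\<in>H. x + y \<in> H) \<and> (\<forall>x\<in>H. - x \<in> H)"

text \<open>Characters of \<open>H\<close> are represented as functions that are \<open>undefined\<close> outside \<open>H\<close>.\<close>

definition dual_group :: "'g::topological_ab_group_add set \<Rightarrow> ('g \<Rightarrow> complex) set" where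
  "dual_group H = {\<xi> \<in> extensional H. continuous_on H \<xi> \<and>
     (\<forall>h\<in>H. cmod (\<xi> h) = 1) \<and> (\<forall>h\<in>H. \<forall>k\<in>H. \<xi> (h + k) = \<xi> h * \<xi> k)}"

text \<open>For discrete \<open>H\<close> the compact-open topology is the topology of pointwise convergence.\<close>

definition dual_topology :: "'g::topological_ab_group_add set \<Rightarrow> ('g \<Rightarrow> complex) topology" where
  "dual_topology H = subtopology (product_topology (\<lambda>_. euclidean) H) (dual_group H)"

definition dual_mult ::
    "'g set \<Rightarrow> ('g \<Rightarrow> complex) \<Rightarrow> ('g \<Rightarrow> complex) \<Rightarrow> ('g \<Rightarrow> complex)" where
  "dual_mult H \<xi> \<eta> = (\<lambda>h\<in>H. \<xi> h * \<eta> h)"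

text \<open>The total mass is normalized to \<open>1\<close>, which makes the Fourier transform unitary.\<close>

definition dual_haar_measure ::
    "'g::topological_ab_group_add set \<Rightarrow> ('g \<Rightarrow> complex) measure \<Rightarrow> bool" where
  "dual_haar_measure H \<nu> \<longleftrightarrow>
     haar_measure (dual_topology H) (dual_mult H) \<nu> \<and> emeasure \<nu> (space \<nu>) = 1"


section \<open>Sequences on \<open>H\<close> and the Fourier transform\<close>

text \<open>Only the values on \<open>H\<close> of a sequence \<open>x\<close> matter.\<close>

definition l1 :: "'g set \<Rightarrow> ('g \<Rightarrow> complex) set" where
  "l1 H = {x. (\<lambda>h. cmod (x h)) summable_on H}"

definition l2 :: "'g set \<Rightarrow> ('g \<Rightarrow> complex) set" where
  "l2 H = {x. (\<lambda>h. (cmod (x h))\<^sup>2) summable_on H}"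

definition convolution ::
    "'g::ab_group_add set \<Rightarrow> ('g \<Rightarrow> complex) \<Rightarrow> ('g \<Rightarrow> complex) \<Rightarrow> 'g \<Rightarrow> complex" where
  "convolution H a x t = (\<Sum>\<^sub>\<infinity>h\<in>H. a (t - h) * x h)"

definition fourier_l1 :: "'g set \<Rightarrow> ('g \<Rightarrow> complex) \<Rightarrow> ('g \<Rightarrow> complex) \<Rightarrow> complex" where
  "fourier_l1 H x \<xi> = (\<Sum>\<^sub>\<infinity>h\<in>H. x h * cnj (\<xi> h))"

text \<open>\<open>g\<close> represents the class in \<open>L\<^sup>2\<close> of the Fourier transform of \<open>x \<in> \<ell>\<^sup>2(H)\<close>, which is
  the extension by continuity of the transform on \<open>\<ell>\<^sup>1(H)\<close>.\<close>

definition is_fourier_l2 ::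
    "'g set \<Rightarrow> ('g \<Rightarrow> complex) measure \<Rightarrow> ('g \<Rightarrow> complex) \<Rightarrow> (('g \<Rightarrow> complex) \<Rightarrow> complex) \<Rightarrow> bool"
  where
  "is_fourier_l2 H \<nu> x g \<longleftrightarrow>
     x \<in> l2 H \<and> g \<in> borel_measurable \<nu> \<and>
     (\<exists>y :: nat \<Rightarrow> 'g \<Rightarrow> complex. (\<forall>k. y k \<in> l1 H) \<and>
        (\<lambda>k. \<Sum>\<^sub>\<infinity>h\<in>H. (cmod (y k h - x h))\<^sup>2) \<longlonglongrightarrow> 0 \<and>
        (\<lambda>k. L2_dist_sq \<nu> (fourier_l1 H (y k)) g) \<longlonglongrightarrow> 0)"

definition in_Linfty :: "'a measure \<Rightarrow> ('a \<Rightarrow> complex) \<Rightarrow> bool" where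
  "in_Linfty M g \<longleftrightarrow> g \<in> borel_measurable M \<and> esssup M (\<lambda>\<xi>. ereal (cmod (g \<xi>))) < \<infinity>"

definition essinf :: "'a measure \<Rightarrow> ('a \<Rightarrow> ereal) \<Rightarrow> ereal" where
  "essinf M f = - esssup M (\<lambda>\<xi>. - f \<xi>)"

definition conj_transpose :: "complex^'n^'m \<Rightarrow> complex^'m^'n" where
  "conj_transpose B = map_matrix cnj (transpose B)"


section \<open>The sampling setting\<close>

definition unitary_representation ::
    "('g::topological_ab_group_add \<Rightarrow> 'h::complex_hilbert \<Rightarrow> 'h) \<Rightarrow> bool" where
  "unitary_representation U \<longleftrightarrow>
     (\<forall>t. unitary_operator (U t)) \<and>
     (\<forall>t t'. U (t + t') = U t \<circ> U t') \<and> U 0 = id \<and>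
     (\<forall>x y. continuous_on UNIV (\<lambda>t. cinner (U t x) y))"

definition continuous_frame ::
    "'g measure \<Rightarrow> ('g \<Rightarrow> 'h::complex_hilbert) \<Rightarrow> bool" where
  "continuous_frame \<mu> v \<longleftrightarrow>
     (\<exists>c1 c2. 0 < c1 \<and> c1 \<le> c2 \<and>
        (\<forall>x. ennreal (c1 * (norm x)\<^sup>2) \<le> (\<integral>\<^sup>+ t. ennreal ((cmod (cinner x (v t)))\<^sup>2) \<partial>\<mu>) \<and>
             (\<integral>\<^sup>+ t. ennreal ((cmod (cinner x (v t)))\<^sup>2) \<partial>\<mu>) \<le> ennreal (c2 * (norm x)\<^sup>2)))"

text \<open>All sums below over \<open>H\<close> with square-summable coefficients converge unconditionally once
  the translates form a Riesz basis.\<close>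

definition synthesis ::
    "'g set \<Rightarrow> ('g \<Rightarrow> 'h \<Rightarrow> 'h) \<Rightarrow> ('n::finite \<Rightarrow> 'h) \<Rightarrow> ('n \<Rightarrow> 'g \<Rightarrow> complex) \<Rightarrow> 'h::complex_hilbert"
  where
  "synthesis H U \<Phi> x = (\<Sum>n\<in>UNIV. \<Sum>\<^sub>\<infinity>h\<in>H. x n h *\<^sub>C U h (\<Phi> n))"

definition H_Phi ::
    "'g set \<Rightarrow> ('g \<Rightarrow> 'h \<Rightarrow> 'h) \<Rightarrow> ('n::finite \<Rightarrow> 'h) \<Rightarrow> 'h::complex_hilbert set" where
  "H_Phi H U \<Phi> = {synthesis H U \<Phi> x | x. \<forall>n. x n \<in> l2 H}"

definition voice_transform ::
    "('g \<Rightarrow> 'h \<Rightarrow> 'h) \<Rightarrow> 'h \<Rightarrow> 'h::complex_hilbert \<Rightarrow> 'g \<Rightarrow> complex" where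
  "voice_transform U \<phi> f t = cinner f (U t \<phi>)"

definition sampling_space ::
    "'g set \<Rightarrow> ('g \<Rightarrow> 'h \<Rightarrow> 'h) \<Rightarrow> 'h \<Rightarrow> ('n::finite \<Rightarrow> 'h::complex_hilbert) \<Rightarrow> ('g \<Rightarrow> complex) set"
  where
  "sampling_space H U \<phi> \<Phi> = voice_transform U \<phi> ` H_Phi H U \<Phi>"

text \<open>\<open>Ahat\<close> is (a representative of) the transfer matrix of \<open>A\<close>. The determinant of
  \<open>Ahat(\<xi>)\<^sup>* Ahat(\<xi>)\<close> is a nonnegative real number, so taking its real part
  is just a type conversion.\<close>

definition stable_sampling_procedure ::
    "'g::topological_ab_group_add set \<Rightarrow> ('g \<Rightarrow> complex) measure \<Rightarrow>
     ('g \<Rightarrow> 'h \<Rightarrow> 'h) \<Rightarrow> 'h \<Rightarrow> ('n::finite \<Rightarrow> 'h::complex_hilbert) \<Rightarrow>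
     ('g \<Rightarrow> complex)^'n^'m \<Rightarrow> (('g \<Rightarrow> complex) \<Rightarrow> complex^'n^'m) \<Rightarrow>
     ('m::finite \<Rightarrow> ('g \<Rightarrow> complex) \<Rightarrow> 'g \<Rightarrow> complex) \<Rightarrow> bool" where
  "stable_sampling_procedure H \<nu> U \<phi> \<Phi> A Ahat L \<longleftrightarrow>
     (\<forall>m n. A $ m $ n \<in> l2 H) \<and>
     (\<forall>m n. is_fourier_l2 H \<nu> (A $ m $ n) (\<lambda>\<xi>. Ahat \<xi> $ m $ n)) \<and>
     (\<forall>m n. in_Linfty \<nu> (\<lambda>\<xi>. Ahat \<xi> $ m $ n)) \<and>
     0 < essinf \<nu> (\<lambda>\<xi>. ereal (Re (det (conj_transpose (Ahat \<xi>) ** Ahat \<xi>)))) \<and>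
     (\<forall>x. (\<forall>n. x n \<in> l2 H) \<longrightarrow>
        (\<forall>m. \<forall>t\<in>H. L m (voice_transform U \<phi> (synthesis H U \<Phi> x)) t
                    = (\<Sum>n\<in>UNIV. convolution H (A $ m $ n) (x n) t)))"

end

theory Submission
  imports Defs "HOL-Probability.Probability_Measure"
begin

text \<open>The coefficient map \<open>\<Theta>\<close>, which sends \<open>f\<close> in the Riesz subspace to the samples
  \<open>(L\<^sub>m F\<^sub>f(t))\<^sub>m\<^sub>,\<^sub>t\<close>, is convolution with \<open>A\<close>. By Plancherel it becomes multiplication by the
  transfer matrix, so the boundedness of the entries and the lower bound of the determinant make it
  bounded and bounded below. Hence \<open>(f, k) \<mapsto> \<langle>\<Theta> f, \<Theta> k\<rangle>\<close> is an equivalent inner product, and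
  the vectors \<open>g\<^sub>m\<close> which represent the functionals \<open>f \<mapsto> L\<^sub>m F\<^sub>f(0)\<close> in it generate,
  under translation by \<open>H\<close>, a Parseval frame for it. Its expansion \<open>f = \<Sum> L\<^sub>m F\<^sub>f(t) U(t) g\<^sub>m\<close> is
  the sampling formula once \<open>S\<^sub>m\<close> is taken to be the voice transform of \<open>g\<^sub>m\<close>. This avoids
  inverting the transfer matrix, so that the surjectivity of the Fourier transform is not needed.\<close>

section \<open>Characters of a discrete subgroup\<close>

text \<open>Plancherel rests on the orthogonality of characters: translation invariance makes the
  integral of \<xi>(h) vanish once some character differs from 1 at h, and this existence is what
  the extension of partial characters provides. Multiplying the transfer matrix with the transform
  of an arbitrary square-summable vector would require a description of the transform of a
  convolution of two square-summable sequences. The two-sided estimate is therefore proved for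
  finitely supported vectors, whose transforms are trigonometric polynomials, and is carried over by
  truncation. The Parseval property belongs to the equivalent inner product, whereas the theorem
  asks for a frame in \<open>L\<^sup>2(G)\<close>. The passage uses a bounded synthesis operator
  together with expansions whose square-summable coefficients are controlled by the norm: such a
  system is a frame for every inner product equivalent to the norm, and the continuous frame
  condition says that the \<open>L\<^sup>2(G)\<close> product of voice transforms is one.\<close>

primrec nat_mult :: "nat \<Rightarrow> 'g::ab_group_add \<Rightarrow> 'g" where
  "nat_mult 0 a = 0"
| "nat_mult (Suc n) a = a + nat_mult n a"

lemma nat_mult_add: "nat_mult (m + n) a = nat_mult m a + nat_mult n a"
  by (induction m) (simp_all add: add.assoc)

lemma nat_mult_mult: "nat_mult (m * n) a = nat_mult m (nat_mult n a)"
  by (induction m) (simp_all add: nat_mult_add)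

lemma nat_mult_diff: "n \<le> m \<Longrightarrow> nat_mult (m - n) a = nat_mult m a - nat_mult n a"
  by (metis add_diff_cancel_right' le_add_diff_inverse2 nat_mult_add)

lemma nat_mult_in_subgroup: "add_subgroup H \<Longrightarrow> a \<in> H \<Longrightarrow> nat_mult n a \<in> H"
  by (induction n) (auto simp: add_subgroup_def)

text \<open>Unitary characters of subgroups of \<open>H\<close>, encoded by their graphs.\<close>

definition partial_character :: "'g::ab_group_add set \<Rightarrow> ('g \<times> complex) set \<Rightarrow> bool" where
  "partial_character H R \<longleftrightarrow>
     (\<forall>(a, z)\<in>R. a \<in> H \<and> cmod z = 1) \<and> (0, 1) \<in> R \<and>
     (\<forall>(a, z)\<in>R. \<forall>(b, w)\<in>R. (a + b, z * w) \<in> R) \<and>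
     (\<forall>(a, z)\<in>R. (- a, cnj z) \<in> R) \<and> (\<forall>z. (0, z) \<in> R \<longrightarrow> z = 1)"

lemma partial_characterD:
  assumes "partial_character H R"
  shows "(a, z) \<in> R \<Longrightarrow> a \<in> H" "(a, z) \<in> R \<Longrightarrow> cmod z = 1" "(0, 1) \<in> R"
    "(a, z) \<in> R \<Longrightarrow> (b, w) \<in> R \<Longrightarrow> (a + b, z * w) \<in> R"
    "(a, z) \<in> R \<Longrightarrow> (- a, cnj z) \<in> R" "(0, z) \<in> R \<Longrightarrow> z = 1"
  using assms unfolding partial_character_def by auto

lemma partial_characterI:
  assumes "\<And>a z. (a, z) \<in> R \<Longrightarrow> a \<in> H" "\<And>a z. (a, z) \<in> R \<Longrightarrow> cmod z = 1" "(0, 1) \<in> R"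
    "\<And>a z b w. (a, z) \<in> R \<Longrightarrow> (b, w) \<in> R \<Longrightarrow> (a + b, z * w) \<in> R"
    "\<And>a z. (a, z) \<in> R \<Longrightarrow> (- a, cnj z) \<in> R" "\<And>z. (0, z) \<in> R \<Longrightarrow> z = 1"
  shows "partial_character H R"
  using assms unfolding partial_character_def by fast

lemma mult_cnj_eq_1: "cmod z = 1 \<Longrightarrow> z * cnj z = 1"
  by (metis complex_norm_square mult.commute of_real_1 one_power2)

text \<open>The defining clauses fix the value only over \<open>0\<close>. The quotient of two
  values over \<open>a\<close> lies there, so the relation is the graph of a function.\<close>

lemma partial_character_unique:
  assumes R: "partial_character H R" and az: "(a, z) \<in> R" and aw: "(a, w) \<in> R"
  shows "z = w"
proof -
  have "(a + - a, z * cnj w) \<in> R"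
    by (intro partial_characterD[OF R] az aw)
  then have "z * cnj w = 1"
    using partial_characterD(6)[OF R] by simp
  then have "z * (w * cnj w) = w"
    by (simp add: ac_simps)
  then show ?thesis
    using mult_cnj_eq_1 partial_characterD(2)[OF R aw] by simp
qed

lemma partial_character_power:
  assumes R: "partial_character H R" and az: "(a, z) \<in> R"
  shows "(nat_mult n a, z ^ n) \<in> R"
  by (induction n) (auto intro: partial_characterD[OF R] az)

text \<open>For \<open>u = 1\<close> the root \<open>cis (2 * pi / m)\<close> differs from
  \<open>1\<close> because \<open>m\<close> is at least \<open>2\<close>; for any other
  \<open>u\<close> no root can be \<open>1\<close>.\<close>

lemma unit_root_neq_1:
  assumes u: "cmod u = 1" and m: "2 \<le> m"
  shows "\<exists>w. cmod w = 1 \<and> w \<noteq> 1 \<and> w ^ m = u"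
proof (cases "u = 1")
  case True
  have "cis (2 * pi / m) \<noteq> 1"
  proof
    assume "cis (2 * pi / m) = 1"
    then have "cos (2 * pi / m) = 1"
      by (simp add: complex_eq_iff)
    then obtain k :: int where k: "2 * pi / m = k * 2 * pi"
      by (auto simp: cos_one_2pi_int)
    then have "real_of_int k * real m = 1"
      using m by (simp add: field_simps)
    then have "k * int m = 1"
      by (metis of_int_1 of_int_eq_iff of_int_mult of_int_of_nat_eq)
    then show False
      using m by (auto simp: zmult_eq_1_iff)
  qed
  moreover have "cis (2 * pi / m) ^ m = 1"
  proof -
    have "real m * (2 * pi / m) = 2 * pi"
      using m by simp
    then show ?thesis
      using Complex.DeMoivre[of "2 * pi / m" m] by simp
  qed
  ultimately show ?thesis
    using True by (intro exI[of _ "cis (2 * pi / m)"]) simp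
next
  case False
  have "cis (Arg u / m) ^ m = u"
  proof -
    have "u \<noteq> 0" "real m * (Arg u / m) = Arg u"
      using m u by auto
    then show ?thesis
      using Complex.DeMoivre[of "Arg u / m" m] cis_Arg[of u] u by (simp add: sgn_eq)
  qed
  then show ?thesis
    using False by (intro exI[of _ "cis (Arg u / m)"]) auto
qed

text \<open>If \<open>m\<close> is the least positive multiple of \<open>a\<close> in the domain, \<open>w\<close> is an \<open>m\<close>-th root of the
  value there; \<open>m \<ge> 2\<close> leaves room for a root different from \<open>1\<close>.\<close>

lemma partial_character_value:
  assumes R: "partial_character H R" and a: "\<And>z. (a, z) \<notin> R"
  shows "\<exists>w. cmod w = 1 \<and> w \<noteq> 1 \<and> (\<forall>d v. (nat_mult d a, v) \<in> R \<longrightarrow> v = w ^ d)"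
proof (cases "\<exists>m>0. \<exists>u. (nat_mult m a, u) \<in> R")
  case False
  \<comment> \<open>No positive multiple of \<open>a\<close> has a value yet, so any unit number
    other than \<open>1\<close> would do; \<open>-1\<close> is taken.\<close>
  then have v: "v = (-1) ^ d" if "(nat_mult d a, v) \<in> R" for d v
  proof -
    have "d = 0"
      using False that by (metis gr0I)
    then show ?thesis
      using that partial_characterD(6)[OF R] by simp
  qed
  show ?thesis
  proof (intro exI[of _ "-1"] conjI allI impI)
    show "cmod (- 1) = 1" "- 1 \<noteq> (1 :: complex)"
      by simp_all
  qed (rule v)
next
  case True
  define m where "m = (LEAST m. m > 0 \<and> (\<exists>u. (nat_mult m a, u) \<in> R))"
  have m: "m > 0 \<and> (\<exists>u. (nat_mult m a, u) \<in> R)"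
    unfolding m_def by (rule LeastI_ex) (use True in auto)
  then obtain u where u: "(nat_mult m a, u) \<in> R"
    by blast
  have min: "\<not> (j > 0 \<and> (\<exists>u. (nat_mult j a, u) \<in> R))" if "j < m" for j
    using that unfolding m_def by (rule not_less_Least)
  have "m \<noteq> 1"
    using u a by auto
  with m have "2 \<le> m"
    by linarith
  then obtain w where w: "cmod w = 1" "w \<noteq> 1" "w ^ m = u"
    using unit_root_neq_1 partial_characterD(2)[OF R u] by blast
  have "v = w ^ d" if v: "(nat_mult d a, v) \<in> R" for d v
  proof -
    \<comment> \<open>Division by \<open>m\<close> leaves a remainder whose multiple of
      \<open>a\<close> is again in the domain. Minimality of \<open>m\<close> makes it
      \<open>0\<close>, so the value at the \<open>d\<close>-th multiple is a power of
      \<open>u\<close>.\<close>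
    define k where "k = d div m"
    have du: "(nat_mult (m * k) a, u ^ k) \<in> R"
      using partial_character_power[OF R u, of k] by (simp add: nat_mult_mult[symmetric] mult.commute)
    have "m * k \<le> d" "d - m * k = d mod m"
      by (simp_all add: k_def minus_mult_div_eq_mod)
    then have "(nat_mult (d mod m) a, v * cnj (u ^ k)) \<in> R"
      using partial_characterD(4)[OF R v partial_characterD(5)[OF R du]]
      by (metis nat_mult_diff uminus_add_conv_diff add.commute)
    moreover have "d mod m < m"
      using m by simp
    ultimately have "d mod m = 0"
      using min[of "d mod m"] by auto
    then have "d = m * k"
      by (auto simp: k_def)
    then show ?thesis
      using partial_character_unique[OF R v] du by (simp add: power_mult w(3))
  qed
  with w show ?thesis
    by blast
qed

text \<open>The element \<open>a\<close> is adjoined with the value \<open>w\<close>. The two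
  natural exponents in \<open>E\<close> stand for the integer exponent \<open>n - k\<close>, with
  \<open>cnj w\<close> as the inverse of \<open>w\<close>. Being well defined amounts to the clause
  over \<open>0\<close>: if b + n a - k a = 0, then a natural multiple of \<open>a\<close> equals
  \<open>b\<close> or \<open>- b\<close>, so it lies in the old domain and its value is the
  prescribed power of \<open>w\<close>. Keeping \<open>w\<close> away from \<open>1\<close> serves
  the separation of points.\<close>

lemma partial_character_extend:
  fixes H :: "'g::ab_group_add set"
  assumes H: "add_subgroup H" and R: "partial_character H R"
    and aH: "a \<in> H" and a: "\<And>z. (a, z) \<notin> R"
  shows "\<exists>R' w. partial_character H R' \<and> R \<subseteq> R' \<and> (a, w) \<in> R' \<and> w \<noteq> 1"
proof -
  obtain w where w: "cmod w = 1" "w \<noteq> 1" and wd: "\<And>d v. (nat_mult d a, v) \<in> R \<Longrightarrow> v = w ^ d"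
    using partial_character_value[OF R a] by blast
  define E where "E b z n k = (b + nat_mult n a - nat_mult k a, z * w ^ n * cnj w ^ k)"
    for b z and n k :: nat
  define R' where "R' = {E b z n k | b z n k. (b, z) \<in> R}"
  have wk: "w ^ k * cnj w ^ k = 1" for k
    using mult_cnj_eq_1[OF w(1)] by (simp flip: power_mult_distrib)
  have "partial_character H R'"
  proof (rule partial_characterI)
    fix b z assume "(b, z) \<in> R'"
    then obtain b' z' n k where *: "(b', z') \<in> R" "b = b' + nat_mult n a - nat_mult k a"
      "z = z' * w ^ n * cnj w ^ k"
      by (auto simp: R'_def E_def)
    have "b' \<in> H" "nat_mult n a \<in> H" "nat_mult k a \<in> H"
      using * partial_characterD(1)[OF R] nat_mult_in_subgroup[OF H aH] by auto
    with H show "b \<in> H"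
      unfolding *(2) add_subgroup_def by (metis ab_group_add_class.ab_diff_conv_add_uminus)
    show "cmod z = 1"
      using * partial_characterD(2)[OF R] w(1) by (simp add: norm_mult norm_power)
    have "(- b, cnj z) = E (- b') (cnj z') k n"
      by (simp add: E_def * algebra_simps)
    then show "(- b, cnj z) \<in> R'"
      using partial_characterD(5)[OF R *(1)] unfolding R'_def by blast
  next
    show "(0, 1) \<in> R'"
      unfolding R'_def using partial_characterD(3)[OF R] 
      by (intro CollectI exI[of _ 0] exI[of _ 1] conjI) (auto simp: E_def)
  next
    fix b z c y assume "(b, z) \<in> R'" "(c, y) \<in> R'"
    then obtain b' z' n k c' y' n' k' where *: "(b', z') \<in> R" "(b, z) = E b' z' n k"
      "(c', y') \<in> R" "(c, y) = E c' y' n' k'"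
      unfolding R'_def by blast
    have "(b + c, z * y) = E (b' + c') (z' * y') (n + n') (k + k')"
      using * by (auto simp: E_def nat_mult_add power_add ac_simps add_diff_eq diff_add_eq diff_diff_eq)
    then show "(b + c, z * y) \<in> R'"
      using partial_characterD(4)[OF R *(1) *(3)] unfolding R'_def by blast
  next
    fix z assume "(0, z) \<in> R'"
    then obtain b z' n k where *: "(b, z') \<in> R" "b + nat_mult n a - nat_mult k a = 0"
      "z = z' * w ^ n * cnj w ^ k"
      unfolding R'_def E_def by auto
    have z': "cmod z' = 1"
      using partial_characterD(2)[OF R *(1)] .
    show "z = 1"
    proof (cases "n \<le> k")
      case True
      then have "nat_mult (k - n) a = b"
        using * by (simp add: nat_mult_diff algebra_simps)
      then have "z' = w ^ (k - n)"
        using wd *(1) by simp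
      then show ?thesis
        using True *(3) wk[of k] by (simp flip: power_add)
    next
      case False
      then have "nat_mult (n - k) a = - b"
        using * by (simp add: nat_mult_diff algebra_simps)
      then have "cnj z' = w ^ (n - k)"
        using wd partial_characterD(5)[OF R *(1)] by simp
      then have "z' * w ^ (n - k) = 1"
        using mult_cnj_eq_1[OF z'] by simp
      moreover have "z = z' * w ^ (n - k) * (w ^ k * cnj w ^ k)"
        using False *(3) by (metis le_add_diff_inverse2 linorder_le_cases mult.assoc power_add)
      ultimately show ?thesis
        using wk by simp
    qed
  qed
  moreover have "R \<subseteq> R'"
  proof
    fix p assume "p \<in> R"
    moreover have "p = E (fst p) (snd p) 0 0"
      by (simp add: E_def)
    ultimately show "p \<in> R'"
      unfolding R'_def by (metis (mono_tags, lifting) CollectI prod.collapse)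
  qed
  moreover have "(a, w) = E 0 1 1 0"
    by (simp add: E_def)
  then have "(a, w) \<in> R'"
    unfolding R'_def using partial_characterD(3)[OF R] by blast
  ultimately show ?thesis
    using w(2) by blast
qed

lemma continuous_on_discrete:
  fixes f :: "'a::topological_space \<Rightarrow> 'b::topological_space"
  assumes "discrete S"
  shows "continuous_on S f"
  unfolding continuous_on_topological
proof (intro ballI allI impI)
  fix x B assume "x \<in> S" "open B" "f x \<in> B"
  then obtain T where "open T" "T \<inter> S = {x}"
    using assms unfolding discrete_def isolated_in_def by blast
  moreover from this have "y = x" if "y \<in> S" "y \<in> T" for y
    using that by (metis IntI singletonD)
  ultimately show "\<exists>A. open A \<and> x \<in> A \<and> (\<forall>y\<in>S. y \<in> A \<longrightarrow> f y \<in> B)"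
    using \<open>f x \<in> B\<close> by (intro exI[of _ T]) auto
qed

text \<open>The trivial character of \<open>{0}\<close> is extended so that \<open>a\<close> gets a
  value other than \<open>1\<close>, and Zorn's lemma enlarges the result to a maximal partial
  character. A maximal one is defined on all of \<open>H\<close>, since a missing element could
  still be adjoined. Behind this stands the divisibility of the circle group.\<close>

lemma dual_group_separates_points:
  fixes H :: "'g::topological_ab_group_add set"
  assumes H: "add_subgroup H" "discrete H" and a: "a \<in> H" "a \<noteq> 0"
  shows "\<exists>\<xi>\<in>dual_group H. \<xi> a \<noteq> 1"
proof -
  have triv: "partial_character H {(0, 1)}"
    using H by (auto simp: partial_character_def add_subgroup_def)
  obtain R0 w where R0: "partial_character H R0" "(a, w) \<in> R0" "w \<noteq> 1"
    using partial_character_extend[OF H(1) triv a(1)] a(2) by blast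
  define \<R> where "\<R> = {R. partial_character H R \<and> R0 \<subseteq> R}"
  have "\<exists>M\<in>\<R>. \<forall>X\<in>\<R>. M \<subseteq> X \<longrightarrow> X = M"
  proof (rule subset_Zorn_nonempty)
    show "\<R> \<noteq> {}"
      using R0 by (auto simp: \<R>_def)
    fix \<C> assume ne: "\<C> \<noteq> {}" and ch: "subset.chain \<R> \<C>"
    then have \<C>: "partial_character H R" "R0 \<subseteq> R" if "R \<in> \<C>" for R
      using that by (auto simp: \<R>_def subset_chain_def)
    have common: "\<exists>R\<in>\<C>. p \<in> R \<and> q \<in> R" if pq: "p \<in> \<Union>\<C>" "q \<in> \<Union>\<C>" for p q
    proof -
      obtain X Y where XY: "X \<in> \<C>" "p \<in> X" "Y \<in> \<C>" "q \<in> Y"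
        using pq by blast
      then have "X \<subseteq> Y \<or> Y \<subseteq> X"
        using ch unfolding subset_chain_def by simp
      with XY show ?thesis
        by blast
    qed
    have "partial_character H (\<Union>\<C>)"
    proof (rule partial_characterI)
      fix b z assume "(b, z) \<in> \<Union>\<C>"
      then show "b \<in> H" "cmod z = 1" "(- b, cnj z) \<in> \<Union>\<C>"
        using partial_characterD[OF \<C>(1)] by blast+
    next
      show "(0, 1) \<in> \<Union>\<C>"
        using ne partial_characterD(3)[OF \<C>(1)] by blast
    next
      fix b z c y assume "(b, z) \<in> \<Union>\<C>" "(c, y) \<in> \<Union>\<C>"
      then obtain S where "S \<in> \<C>" "(b, z) \<in> S" "(c, y) \<in> S"
        using common[of "(b, z)" "(c, y)"] by blast
      then show "(b + c, z * y) \<in> \<Union>\<C>"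
        using partial_characterD(4)[OF \<C>(1)] by blast
    next
      fix z assume "(0, z) \<in> \<Union>\<C>"
      then show "z = 1"
        using partial_characterD(6)[OF \<C>(1)] by blast
    qed
    then show "\<Union>\<C> \<in> \<R>"
      using ne \<C>(2) by (auto simp: \<R>_def)
  qed
  then obtain M where M\<R>: "M \<in> \<R>" and max\<R>: "\<forall>X\<in>\<R>. M \<subseteq> X \<longrightarrow> X = M"
    by (elim bexE)
  have M: "partial_character H M" "R0 \<subseteq> M"
    using M\<R> by (simp_all add: \<R>_def)
  have max: "X = M" if "partial_character H X" "M \<subseteq> X" for X
    using max\<R> that M(2) by (simp add: \<R>_def)
  have "\<exists>z. (b, z) \<in> M" if b: "b \<in> H" for b
  proof (rule ccontr)
    assume "\<nexists>z. (b, z) \<in> M"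
    then obtain X y where "partial_character H X" "M \<subseteq> X" "(b, y) \<in> X"
      using partial_character_extend[OF H(1) M(1) b] by auto
    with max \<open>\<nexists>z. (b, z) \<in> M\<close> show False
      by auto
  qed
  then have ex: "(b, THE z. (b, z) \<in> M) \<in> M" if "b \<in> H" for b
    using theI'[of "\<lambda>z. (b, z) \<in> M"] partial_character_unique[OF M(1)] that by (metis (lifting))
  define \<xi> where "\<xi> = (\<lambda>b\<in>H. THE z. (b, z) \<in> M)"
  have \<xi>: "(b, \<xi> b) \<in> M" if "b \<in> H" for b
    using ex that by (simp add: \<xi>_def)
  have "\<xi> \<in> dual_group H"
    unfolding dual_group_def
  proof (intro CollectI conjI ballI)
    show "\<xi> \<in> extensional H"
      by (simp add: \<xi>_def)
    show "continuous_on H \<xi>"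
      by (rule continuous_on_discrete[OF H(2)])
    fix h assume h: "h \<in> H"
    show "cmod (\<xi> h) = 1"
      using partial_characterD(2)[OF M(1) \<xi>[OF h]] .
    fix k assume k: "k \<in> H"
    have "(h + k, \<xi> h * \<xi> k) \<in> M"
      using partial_characterD(4)[OF M(1) \<xi>[OF h] \<xi>[OF k]] .
    moreover have "h + k \<in> H"
      using H h k by (auto simp: add_subgroup_def)
    ultimately show "\<xi> (h + k) = \<xi> h * \<xi> k"
      using partial_character_unique[OF M(1)] \<xi> by blast
  qed
  moreover have "\<xi> a \<noteq> 1"
    using partial_character_unique[OF M(1) \<xi>[OF a(1)]] R0 M(2) by blast
  ultimately show ?thesis
    by blast
qed

section \<open>The Fourier transform on the dual group\<close>

lemma nn_integral_count_space_infsum: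
  fixes f :: "'a \<Rightarrow> real"
  assumes f: "f summable_on A" and nonneg: "\<And>x. x \<in> A \<Longrightarrow> 0 \<le> f x"
  shows "(\<integral>\<^sup>+ x. ennreal (f x) \<partial>count_space A) = ennreal (infsum f A)"
proof -
  have abs: "Infinite_Set_Sum.abs_summable_on f A"
    using f nonneg abs_summable_equivalent[of f A] summable_on_cong[of A "\<lambda>x. norm (f x)" f] by simp
  have "(\<integral>\<^sup>+ x. ennreal (f x) \<partial>count_space A) = ennreal (infsetsum f A)"
    by (rule nn_integral_conv_infsetsum[OF abs nonneg])
  then show ?thesis
    by (simp add: infsetsum_infsum[OF abs])
qed

text \<open>The cross term 2 |a| |b| is at most e |a|^2 + |b|^2 / e. The free weight keeps the first
  constant near \<open>1\<close>, so that norms are preserved exactly in limits, while the large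
  second constant meets a term tending to \<open>0\<close>.\<close>

lemma norm_add_square_le:
  fixes a b :: "'a::real_normed_vector"
  assumes e: "0 < e"
  shows "(norm (a + b))\<^sup>2 \<le> (1 + e) * (norm a)\<^sup>2 + (1 + 1 / e) * (norm b)\<^sup>2"
proof -
  have "(norm (a + b))\<^sup>2 \<le> (norm a + norm b)\<^sup>2"
    by (intro power_mono norm_triangle_ineq) simp
  also have "0 \<le> (e * norm a - norm b)\<^sup>2 / e"
    using e by simp
  then have "(norm a + norm b)\<^sup>2 \<le> (norm a + norm b)\<^sup>2 + (e * norm a - norm b)\<^sup>2 / e"
    by simp
  also have "\<dots> = (1 + e) * (norm a)\<^sup>2 + (1 + 1 / e) * (norm b)\<^sup>2"
    using e by (simp add: power2_eq_square field_simps)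
  finally show ?thesis .
qed

lemma norm_add_square_le_2:
  fixes a b :: "'a::real_normed_vector"
  shows "(norm (a + b))\<^sup>2 \<le> 2 * (norm a)\<^sup>2 + 2 * (norm b)\<^sup>2"
  using norm_add_square_le[of 1 a b] by simp

lemma L2_dist_sq_commute: "L2_dist_sq M u v = L2_dist_sq M v u"
  by (simp add: L2_dist_sq_def norm_minus_commute)

lemma L2_dist_sq_zero_le:
  assumes [measurable]: "u \<in> borel_measurable M" "v \<in> borel_measurable M" and e: "0 < e"
  shows "L2_dist_sq M u (\<lambda>_. 0) \<le> ennreal (1 + e) * L2_dist_sq M v (\<lambda>_. 0) + ennreal (1 + 1 / e) * L2_dist_sq M v u"
proof -
  have "L2_dist_sq M u (\<lambda>_. 0) \<le>
      (\<integral>\<^sup>+ t. ennreal (1 + e) * ennreal ((cmod (v t))\<^sup>2) + ennreal (1 + 1 / e) * ennreal ((cmod (v t - u t))\<^sup>2) \<partial>M)"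
    unfolding L2_dist_sq_def
  proof (rule nn_integral_mono)
    fix t
    have "(cmod (u t - 0))\<^sup>2 \<le> (1 + e) * (cmod (v t))\<^sup>2 + (1 + 1 / e) * (cmod (v t - u t))\<^sup>2"
      using norm_add_square_le[OF e, of "v t" "u t - v t"] by (simp add: norm_minus_commute)
    then have "ennreal ((cmod (u t - 0))\<^sup>2) \<le> ennreal ((1 + e) * (cmod (v t))\<^sup>2 + (1 + 1 / e) * (cmod (v t - u t))\<^sup>2)"
      by (rule ennreal_leI)
    then show "ennreal ((cmod (u t - 0))\<^sup>2) \<le>
        ennreal (1 + e) * ennreal ((cmod (v t))\<^sup>2) + ennreal (1 + 1 / e) * ennreal ((cmod (v t - u t))\<^sup>2)"
      using e by (simp add: ennreal_mult ennreal_plus)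
  qed
  also have "\<dots> = ennreal (1 + e) * L2_dist_sq M v (\<lambda>_. 0) + ennreal (1 + 1 / e) * L2_dist_sq M v u"
    unfolding L2_dist_sq_def by (simp add: nn_integral_add nn_integral_cmult)
  finally show ?thesis .
qed

text \<open>The weighted inequality is applied twice, once in each space. For fixed \<open>e\<close>
  the two distances disappear as \<open>k\<close> grows and the factor
  \<open>(1 + e)\<^sup>2\<close> remains; then \<open>e\<close> tends to \<open>0\<close>. With an
  infinite right-hand side nothing is claimed, so only a finite \<open>r\<close> needs the
  argument.\<close>

lemma L2_norm_limit_le:
  assumes u: "\<And>k. u k \<in> borel_measurable M" "u' \<in> borel_measurable M"
    and v: "\<And>k. v k \<in> borel_measurable N" "v' \<in> borel_measurable N"
    and lim_u: "(\<lambda>k. L2_dist_sq M (u k) u') \<longlonglongrightarrow> 0"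
    and lim_v: "(\<lambda>k. L2_dist_sq N (v k) v') \<longlonglongrightarrow> 0"
    and eq: "\<And>k. L2_dist_sq M (u k) (\<lambda>_. 0) = L2_dist_sq N (v k) (\<lambda>_. 0)"
  shows "L2_dist_sq M u' (\<lambda>_. 0) \<le> L2_dist_sq N v' (\<lambda>_. 0)"
proof (cases "L2_dist_sq N v' (\<lambda>_. 0)")
  case (real r)
  have le: "L2_dist_sq M u' (\<lambda>_. 0) \<le> ennreal ((1 + e) * ((1 + e) * r))" if e: "0 < e" for e
  proof (rule tendsto_lowerbound)
    define D where "D k = ennreal (1 + e) * (ennreal (1 + e) * L2_dist_sq N v' (\<lambda>_. 0) +
        ennreal (1 + 1 / e) * L2_dist_sq N (v k) v') + ennreal (1 + 1 / e) * L2_dist_sq M (u k) u'" for k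
    have "D \<longlonglongrightarrow> ennreal (1 + e) * (ennreal (1 + e) * L2_dist_sq N v' (\<lambda>_. 0) + ennreal (1 + 1 / e) * 0)
        + ennreal (1 + 1 / e) * 0"
      unfolding D_def by (intro tendsto_add ennreal_tendsto_cmult lim_u lim_v tendsto_const) simp_all
    then show "D \<longlonglongrightarrow> ennreal ((1 + e) * ((1 + e) * r))"
      using e real by (simp add: ennreal_mult)
    have "L2_dist_sq M u' (\<lambda>_. 0) \<le> D k" for k
    proof -
      have "L2_dist_sq M u' (\<lambda>_. 0) \<le> ennreal (1 + e) * L2_dist_sq N (v k) (\<lambda>_. 0) + ennreal (1 + 1 / e) * L2_dist_sq M (u k) u'"
        using L2_dist_sq_zero_le[OF u(2) u(1) e] by (simp add: eq)
      also have "\<dots> \<le> D k"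
        unfolding D_def using L2_dist_sq_zero_le[OF v(1) v(2) e] L2_dist_sq_commute
        by (metis (no_types, lifting) add_right_mono mult_left_mono zero_le)
      finally show ?thesis .
    qed
    then show "\<forall>\<^sub>F k in sequentially. L2_dist_sq M u' (\<lambda>_. 0) \<le> D k"
      by simp
  qed simp
  have "(\<lambda>n. ennreal ((1 + inverse (real (Suc n))) * ((1 + inverse (real (Suc n))) * r)))
      \<longlonglongrightarrow> ennreal ((1 + 0) * ((1 + 0) * r))"
    by (intro tendsto_ennrealI tendsto_mult tendsto_add tendsto_const LIMSEQ_inverse_real_of_nat)
  then have "L2_dist_sq M u' (\<lambda>_. 0) \<le> ennreal ((1 + 0) * ((1 + 0) * r))"
    by (rule tendsto_lowerbound) (auto intro!: always_eventually le)
  then show ?thesis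
    by (simp add: real)
qed simp

lemma L2_norm_limit_eq:
  assumes "\<And>k. u k \<in> borel_measurable M" "u' \<in> borel_measurable M"
    and "\<And>k. v k \<in> borel_measurable N" "v' \<in> borel_measurable N"
    and "(\<lambda>k. L2_dist_sq M (u k) u') \<longlonglongrightarrow> 0"
    and "(\<lambda>k. L2_dist_sq N (v k) v') \<longlonglongrightarrow> 0"
    and "\<And>k. L2_dist_sq M (u k) (\<lambda>_. 0) = L2_dist_sq N (v k) (\<lambda>_. 0)"
  shows "L2_dist_sq M u' (\<lambda>_. 0) = L2_dist_sq N v' (\<lambda>_. 0)"
  using assms by (intro antisym L2_norm_limit_le[of u M u' v N v'] L2_norm_limit_le[of v N v' u M u']) simp_all

lemma L2_dist_sq_add_le:
  assumes [measurable]: "u \<in> borel_measurable M" "v \<in> borel_measurable M"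
    "u' \<in> borel_measurable M" "v' \<in> borel_measurable M"
  shows "L2_dist_sq M (\<lambda>t. u t + u' t) (\<lambda>t. v t + v' t) \<le> 2 * L2_dist_sq M u v + 2 * L2_dist_sq M u' v'"
proof -
  have "L2_dist_sq M (\<lambda>t. u t + u' t) (\<lambda>t. v t + v' t) \<le>
      (\<integral>\<^sup>+ t. 2 * ennreal ((cmod (u t - v t))\<^sup>2) + 2 * ennreal ((cmod (u' t - v' t))\<^sup>2) \<partial>M)"
    unfolding L2_dist_sq_def
  proof (rule nn_integral_mono)
    fix t
    have "(cmod (u t + u' t - (v t + v' t)))\<^sup>2 \<le> 2 * (cmod (u t - v t))\<^sup>2 + 2 * (cmod (u' t - v' t))\<^sup>2"
      using norm_add_square_le_2[of "u t - v t" "u' t - v' t"] by (simp add: algebra_simps)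
    then have "ennreal ((cmod (u t + u' t - (v t + v' t)))\<^sup>2) \<le> ennreal (2 * (cmod (u t - v t))\<^sup>2 + 2 * (cmod (u' t - v' t))\<^sup>2)"
      by (rule ennreal_leI)
    then show "ennreal ((cmod (u t + u' t - (v t + v' t)))\<^sup>2) \<le>
        2 * ennreal ((cmod (u t - v t))\<^sup>2) + 2 * ennreal ((cmod (u' t - v' t))\<^sup>2)"
      by (simp add: ennreal_mult ennreal_plus)
  qed
  also have "\<dots> = 2 * L2_dist_sq M u v + 2 * L2_dist_sq M u' v'"
    unfolding L2_dist_sq_def by (simp add: nn_integral_add nn_integral_cmult)
  finally show ?thesis .
qed

section \<open>Sequence spaces on \<open>H\<close>, shifts and truncations\<close>

lemma l1_subset_l2: "l1 H \<subseteq> l2 H"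
proof
  fix x assume "x \<in> l1 H"
  then have x: "(\<lambda>h. cmod (x h)) summable_on H"
    by (simp add: l1_def)
  show "x \<in> l2 H"
    unfolding l2_def
  proof (rule CollectI, rule summable_on_comparison_test)
    show "(\<lambda>h. infsum (\<lambda>h. cmod (x h)) H * cmod (x h)) summable_on H"
      by (intro summable_on_cmult_right x)
    fix h assume "h \<in> H"
    then have "cmod (x h) \<le> infsum (\<lambda>h. cmod (x h)) H"
      using finite_sum_le_infsum[OF x, of "{h}"] by simp
    then show "(cmod (x h))\<^sup>2 \<le> infsum (\<lambda>h. cmod (x h)) H * cmod (x h)"
      by (simp add: power2_eq_square mult_right_mono)
  qed simp
qed

lemma l2_add: "x \<in> l2 H \<Longrightarrow> y \<in> l2 H \<Longrightarrow> (\<lambda>h. x h + y h) \<in> l2 H"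
  unfolding l2_def mem_Collect_eq
  by (rule summable_on_comparison_test[of "\<lambda>h. 2 * (cmod (x h))\<^sup>2 + 2 * (cmod (y h))\<^sup>2"])
    (auto intro!: summable_on_add summable_on_cmult_right norm_add_square_le_2)

lemma l2_cmult: "x \<in> l2 H \<Longrightarrow> (\<lambda>h. c * x h) \<in> l2 H"
  unfolding l2_def by (auto simp: norm_mult power_mult_distrib intro!: summable_on_cmult_right)

lemma l2_diff: "x \<in> l2 H \<Longrightarrow> y \<in> l2 H \<Longrightarrow> (\<lambda>h. x h - y h) \<in> l2 H"
  using l2_add[of x H "\<lambda>h. -1 * y h"] l2_cmult[of y H "-1"] by simp

lemma l2_zero: "(\<lambda>_. 0) \<in> l2 H"
  by (simp add: l2_def)

lemma bij_betw_shift: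
  fixes H :: "'g::ab_group_add set"
  assumes H: "add_subgroup H" and s: "s \<in> H"
  shows "bij_betw (\<lambda>h. h - s) H H"
  by (rule bij_betw_byWitness[where f' = "\<lambda>h. h + s"])
    (use H s in \<open>auto simp: add_subgroup_def\<close>, metis ab_group_add_class.ab_diff_conv_add_uminus)

lemma l2_shift:
  fixes H :: "'g::ab_group_add set"
  assumes H: "add_subgroup H" and s: "s \<in> H" and x: "x \<in> l2 H"
  shows "(\<lambda>h. x (h - s)) \<in> l2 H"
  using x summable_on_reindex_bij_betw[OF bij_betw_shift[OF H s], of "\<lambda>h. (cmod (x h))\<^sup>2"]
  by (simp add: l2_def)

text \<open>Presents \<open>\<ell>\<^sup>2(H)\<close> as the \<open>L\<^sup>2\<close> space of
  counting measure, so that the same limit lemmas serve both sides of Plancherel.\<close>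

lemma L2_dist_sq_count_space:
  assumes "x \<in> l2 H" "y \<in> l2 H"
  shows "L2_dist_sq (count_space H) x y = ennreal (\<Sum>\<^sub>\<infinity>h\<in>H. (cmod (x h - y h))\<^sup>2)"
  using l2_diff[OF assms] unfolding L2_dist_sq_def l2_def by (intro nn_integral_count_space_infsum) auto

lemma l1_truncation:
  assumes y: "y \<in> l1 H" and e: "0 < e"
  shows "\<exists>X. finite X \<and> X \<subseteq> H \<and> (\<Sum>\<^sub>\<infinity>h\<in>H - X. cmod (y h)) \<le> e"
proof -
  have s: "(\<lambda>h. cmod (y h)) summable_on H"
    using y by (simp add: l1_def)
  obtain X where X: "finite X" "X \<subseteq> H" "dist (\<Sum>h\<in>X. cmod (y h)) (\<Sum>\<^sub>\<infinity>h\<in>H. cmod (y h)) \<le> e"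
    using infsum_finite_approximation[OF s e] by blast
  have "(\<Sum>\<^sub>\<infinity>h\<in>H - X. cmod (y h)) = (\<Sum>\<^sub>\<infinity>h\<in>H. cmod (y h)) - (\<Sum>h\<in>X. cmod (y h))"
    using X s by (subst infsum_Diff) auto
  with X show ?thesis
    by (intro exI[of _ X]) (simp add: dist_real_def)
qed

section \<open>The dual group with its normalized Haar measure\<close>

locale discrete_dual =
  fixes H :: "'g::topological_ab_group_add set" and \<nu> :: "('g \<Rightarrow> complex) measure"
  assumes subgroup: "add_subgroup H" and discrete: "discrete H"
    and dual_haar: "dual_haar_measure H \<nu>"
begin

lemma subgroupD: "0 \<in> H" "x \<in> H \<Longrightarrow> y \<in> H \<Longrightarrow> x + y \<in> H" "x \<in> H \<Longrightarrow> - x \<in> H"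
    "x \<in> H \<Longrightarrow> y \<in> H \<Longrightarrow> x - y \<in> H"
  using subgroup by (auto simp: add_subgroup_def) (metis ab_group_add_class.ab_diff_conv_add_uminus)

lemma topspace_dual: "topspace (dual_topology H) = dual_group H"
  by (auto simp: dual_topology_def dual_group_def PiE_def)

lemma space_dual: "space \<nu> = dual_group H"
  using dual_haar by (simp add: dual_haar_measure_def haar_measure_def topspace_dual)

lemma sets_dual: "sets \<nu> = sigma_sets (dual_group H) {W. openin (dual_topology H) W}"
  using dual_haar by (simp add: dual_haar_measure_def haar_measure_def topspace_dual)

lemma prob: "prob_space \<nu>"
  using dual_haar by (intro prob_spaceI) (simp add: dual_haar_measure_def)

sublocale prob_space \<nu>
  by (rule prob)

lemma character:
  assumes "\<xi> \<in> dual_group H"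
  shows "h \<in> H \<Longrightarrow> cmod (\<xi> h) = 1" "h \<in> H \<Longrightarrow> k \<in> H \<Longrightarrow> \<xi> (h + k) = \<xi> h * \<xi> k"
    "\<xi> \<in> extensional H"
  using assms by (auto simp: dual_group_def)

lemma character_diff:
  assumes \<xi>: "\<xi> \<in> dual_group H" and h: "h \<in> H" and k: "k \<in> H"
  shows "\<xi> (h - k) = \<xi> h * cnj (\<xi> k)"
proof -
  have "\<xi> h = \<xi> (h - k) * \<xi> k"
    using character(2)[OF \<xi> subgroupD(4)[OF h k] k] by simp
  then have "\<xi> h * cnj (\<xi> k) = \<xi> (h - k) * (\<xi> k * cnj (\<xi> k))"
    by (simp add: mult.assoc)
  then show ?thesis
    using mult_cnj_eq_1 character(1)[OF \<xi> k] by simp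
qed

lemma continuous_map_measurable:
  fixes f :: "('g \<Rightarrow> complex) \<Rightarrow> 'b::topological_space"
  assumes "continuous_map (dual_topology H) euclidean f"
  shows "f \<in> borel_measurable \<nu>"
proof (rule borel_measurableI)
  fix S :: "'b set" assume S: "open S"
  then have "openin (dual_topology H) {x \<in> topspace (dual_topology H). f x \<in> S}"
    by (intro openin_continuous_map_preimage[OF assms]) (use S in simp)
  moreover have "f -` S \<inter> space \<nu> = {x \<in> topspace (dual_topology H). f x \<in> S}"
    by (auto simp: space_dual topspace_dual)
  ultimately show "f -` S \<inter> space \<nu> \<in> sets \<nu>"
    unfolding sets_dual by (simp add: sigma_sets.Basic)
qed

lemma continuous_map_eval: "h \<in> H \<Longrightarrow> continuous_map (dual_topology H) euclidean (\<lambda>\<xi>. \<xi> h)"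
  unfolding dual_topology_def
  by (intro continuous_map_from_subtopology continuous_map_product_projection)

lemma eval_measurable [measurable]: "h \<in> H \<Longrightarrow> (\<lambda>\<xi>. \<xi> h) \<in> borel_measurable \<nu>"
  by (intro continuous_map_measurable continuous_map_eval)

lemma cnj_eval_measurable [measurable]: "h \<in> H \<Longrightarrow> (\<lambda>\<xi>. cnj (\<xi> h)) \<in> borel_measurable \<nu>"
  by (rule measurable_compose[OF eval_measurable borel_measurable_continuous_onI])
    (auto intro: continuous_intros)

lemma dual_mult_in_dual:
  assumes "\<eta> \<in> dual_group H" "\<xi> \<in> dual_group H"
  shows "dual_mult H \<eta> \<xi> \<in> dual_group H"
  using character[OF assms(1)] character[OF assms(2)] continuous_on_discrete[OF discrete]
  by (auto simp: dual_group_def dual_mult_def norm_mult subgroupD)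

text \<open>Each coordinate of \<open>dual_mult H \<eta>\<close> is a coordinate times a constant,
  so translation is continuous for pointwise convergence, and the open sets generate
  \<open>sets \<nu>\<close>.\<close>

lemma dual_mult_measurable:
  assumes \<eta>: "\<eta> \<in> dual_group H"
  shows "dual_mult H \<eta> \<in> \<nu> \<rightarrow>\<^sub>M \<nu>"
proof (rule measurable_sigma_sets[OF sets_dual])
  show "{W. openin (dual_topology H) W} \<subseteq> Pow (dual_group H)"
    using openin_subset topspace_dual by blast
  show "dual_mult H \<eta> \<in> space \<nu> \<rightarrow> dual_group H"
    using dual_mult_in_dual[OF \<eta>] by (simp add: space_dual)
  have "continuous_map (dual_topology H) (product_topology (\<lambda>_. euclidean) H) (dual_mult H \<eta>)"
    unfolding continuous_map_componentwise
  proof (intro conjI ballI)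
    show "dual_mult H \<eta> ` topspace (dual_topology H) \<subseteq> extensional H"
      by (auto simp: dual_mult_def)
    fix k assume k: "k \<in> H"
    have "continuous_map (dual_topology H) euclidean ((\<lambda>z. \<eta> k * z) \<circ> (\<lambda>\<xi>. \<xi> k))"
      by (rule continuous_map_compose[OF continuous_map_eval[OF k]])
        (auto intro!: continuous_intros)
    then show "continuous_map (dual_topology H) euclidean (\<lambda>\<xi>. dual_mult H \<eta> \<xi> k)"
      using k by (simp add: dual_mult_def o_def)
  qed
  then have cont: "continuous_map (dual_topology H) (dual_topology H) (dual_mult H \<eta>)"
    using dual_mult_in_dual[OF \<eta>]
    by (subst (2) dual_topology_def) (auto simp: continuous_map_in_subtopology topspace_dual)
  fix W assume "W \<in> {W. openin (dual_topology H) W}"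
  then have "openin (dual_topology H) {x \<in> topspace (dual_topology H). dual_mult H \<eta> x \<in> W}"
    using cont by (intro openin_continuous_map_preimage) auto
  moreover have "dual_mult H \<eta> -` W \<inter> space \<nu> = {x \<in> topspace (dual_topology H). dual_mult H \<eta> x \<in> W}"
    by (auto simp: space_dual topspace_dual)
  ultimately show "dual_mult H \<eta> -` W \<inter> space \<nu> \<in> sets \<nu>"
    unfolding sets_dual by (simp add: sigma_sets.Basic)
qed

text \<open>Invariance in \<open>haar_measure\<close> is stated for images, the distribution uses
  preimages. The conjugate character \<open>\<zeta>\<close> inverts \<open>\<eta>\<close>, which
  turns the preimage under one translation into the image under the other.\<close>

lemma dual_translation_invariant:
  assumes \<eta>: "\<eta> \<in> dual_group H"
  shows "distr \<nu> \<nu> (dual_mult H \<eta>) = \<nu>"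
proof (rule measure_eqI)
  define \<zeta> where "\<zeta> = (\<lambda>h\<in>H. cnj (\<eta> h))"
  have \<zeta>: "\<zeta> \<in> dual_group H"
    using character[OF \<eta>] continuous_on_discrete[OF discrete]
    by (auto simp: dual_group_def \<zeta>_def subgroupD)
  have inv: "dual_mult H \<zeta> (dual_mult H \<eta> \<xi>) = \<xi>" "dual_mult H \<eta> (dual_mult H \<zeta> \<xi>) = \<xi>"
    if \<xi>: "\<xi> \<in> dual_group H" for \<xi>
  proof -
    have "cnj (\<eta> h) * \<eta> h = 1" if "h \<in> H" for h
      using mult_cnj_eq_1 character(1)[OF \<eta> that] by (simp add: mult.commute)
    then show "dual_mult H \<zeta> (dual_mult H \<eta> \<xi>) = \<xi>" "dual_mult H \<eta> (dual_mult H \<zeta> \<xi>) = \<xi>"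
      using character(3)[OF \<xi>]
      by (auto simp: dual_mult_def \<zeta>_def extensional_def fun_eq_iff mult.commute simp flip: mult.assoc)
  qed
  fix B assume "B \<in> sets (distr \<nu> \<nu> (dual_mult H \<eta>))"
  then have B: "B \<in> sets \<nu>"
    by simp
  then have "B \<subseteq> dual_group H"
    using sets.sets_into_space space_dual by blast
  then have "dual_mult H \<eta> -` B \<inter> space \<nu> = dual_mult H \<zeta> ` B"
    using inv dual_mult_in_dual[OF \<zeta>] by (force simp: space_dual image_iff)
  then have "emeasure (distr \<nu> \<nu> (dual_mult H \<eta>)) B = emeasure \<nu> (dual_mult H \<zeta> ` B)"
    by (simp add: emeasure_distr dual_mult_measurable[OF \<eta>] B)
  also have "\<dots> = emeasure \<nu> B"
    using dual_haar \<zeta> B by (simp add: dual_haar_measure_def haar_measure_def topspace_dual)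
  finally show "emeasure (distr \<nu> \<nu> (dual_mult H \<eta>)) B = emeasure \<nu> B" .
qed simp

lemma integrable_eval: "h \<in> H \<Longrightarrow> integrable \<nu> (\<lambda>\<xi>. \<xi> h)"
  by (rule integrable_const_bound[of _ 1]) (auto simp: space_dual character)

text \<open>Translating by a character \<open>\<eta>\<close> multiplies the integral by
  \<open>\<eta> h\<close> and leaves it unchanged; choosing \<open>\<eta> h \<noteq> 1\<close>
  forces it to vanish. At \<open>h = 0\<close> the integral is the total mass
  \<open>1\<close>.\<close>

lemma integral_character:
  assumes h: "h \<in> H"
  shows "(LINT \<xi>|\<nu>. \<xi> h) = (if h = 0 then 1 else 0)"
proof (cases "h = 0")
  case True
  have "\<xi> 0 = 1" if "\<xi> \<in> dual_group H" for \<xi>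
    using character(2)[OF that subgroupD(1) subgroupD(1)] character(1)[OF that subgroupD(1)] by auto
  then have "(LINT \<xi>|\<nu>. \<xi> h) = (LINT \<xi>|\<nu>. 1)"
    using True by (intro Bochner_Integration.integral_cong) (auto simp: space_dual)
  then show ?thesis
    using True by (simp add: prob_space)
next
  case False
  obtain \<eta> where \<eta>: "\<eta> \<in> dual_group H" "\<eta> h \<noteq> 1"
    using dual_group_separates_points[OF subgroup discrete h False] by blast
  have "(LINT \<xi>|\<nu>. \<xi> h) = (LINT \<xi>|distr \<nu> \<nu> (dual_mult H \<eta>). \<xi> h)"
    by (simp add: dual_translation_invariant[OF \<eta>(1)])
  also have "\<dots> = (LINT \<xi>|\<nu>. dual_mult H \<eta> \<xi> h)"
    by (rule integral_distr[OF dual_mult_measurable[OF \<eta>(1)]]) (use h in measurable)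
  also have "\<dots> = \<eta> h * (LINT \<xi>|\<nu>. \<xi> h)"
    using h by (simp add: dual_mult_def)
  finally show ?thesis
    using \<eta>(2) False by simp
qed

text \<open>The squared modulus is the double sum \<open>f\<close> over the characters at
  \<open>k - h\<close>, and orthogonality leaves its diagonal.\<close>

lemma plancherel_finite:
  assumes X: "finite X" "X \<subseteq> H"
  shows "(\<integral>\<^sup>+ \<xi>. ennreal ((cmod (\<Sum>h\<in>X. y h * cnj (\<xi> h)))\<^sup>2) \<partial>\<nu>) = ennreal (\<Sum>h\<in>X. (cmod (y h))\<^sup>2)"
proof -
  define f where "f \<xi> = (\<Sum>h\<in>X. \<Sum>k\<in>X. (y h * cnj (y k)) * \<xi> (k - h))" for \<xi> :: "'g \<Rightarrow> complex"
  have diff: "k - h \<in> H" if "h \<in> X" "k \<in> X" for h k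
    using that X by (intro subgroupD) auto
  have f: "f \<xi> = complex_of_real ((cmod (\<Sum>h\<in>X. y h * cnj (\<xi> h)))\<^sup>2)" if \<xi>: "\<xi> \<in> dual_group H" for \<xi>
  proof -
    have "complex_of_real ((cmod (\<Sum>h\<in>X. y h * cnj (\<xi> h)))\<^sup>2) =
        (\<Sum>h\<in>X. \<Sum>k\<in>X. (y h * cnj (\<xi> h)) * (cnj (y k) * \<xi> k))"
      unfolding complex_norm_square by (simp add: sum_product)
    also have "\<dots> = f \<xi>"
      unfolding f_def using X \<xi>
      by (intro sum.cong refl) (simp add: character_diff subset_iff ac_simps)
    finally show ?thesis ..
  qed
  have "(LINT \<xi>|\<nu>. f \<xi>) = (\<Sum>h\<in>X. \<Sum>k\<in>X. (y h * cnj (y k)) * (LINT \<xi>|\<nu>. \<xi> (k - h)))"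
    unfolding f_def using diff by (simp add: Bochner_Integration.integral_sum integrable_eval)
  also have "\<dots> = (\<Sum>h\<in>X. \<Sum>k\<in>X. if h = k then y h * cnj (y k) else 0)"
    using diff by (intro sum.cong refl) (simp add: integral_character)
  also have "\<dots> = complex_of_real (\<Sum>h\<in>X. (cmod (y h))\<^sup>2)"
    using X by (simp add: complex_norm_square flip: of_real_power)
  finally have int: "(LINT \<xi>|\<nu>. f \<xi>) = complex_of_real (\<Sum>h\<in>X. (cmod (y h))\<^sup>2)" .
  have "integrable \<nu> f"
    unfolding f_def using diff by (intro Bochner_Integration.integrable_sum integrable_mult_right integrable_eval)
  then have 1: "integrable \<nu> (\<lambda>\<xi>. complex_of_real ((cmod (\<Sum>h\<in>X. y h * cnj (\<xi> h)))\<^sup>2))"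
    by (rule Bochner_Integration.integrable_cong[THEN iffD1, rotated -1]) (simp_all add: f space_dual)
  then have 2: "integrable \<nu> (\<lambda>\<xi>. (cmod (\<Sum>h\<in>X. y h * cnj (\<xi> h)))\<^sup>2)"
    by (simp only: complex_of_real_integrable_eq)
  have "complex_of_real (LINT \<xi>|\<nu>. (cmod (\<Sum>h\<in>X. y h * cnj (\<xi> h)))\<^sup>2) = (LINT \<xi>|\<nu>. f \<xi>)"
    unfolding integral_complex_of_real[symmetric]
    by (intro Bochner_Integration.integral_cong) (simp_all add: f space_dual)
  then have "(LINT \<xi>|\<nu>. (cmod (\<Sum>h\<in>X. y h * cnj (\<xi> h)))\<^sup>2) = (\<Sum>h\<in>X. (cmod (y h))\<^sup>2)"
    unfolding int of_real_eq_iff .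
  then show ?thesis
    using nn_integral_eq_integral[OF 2] by simp
qed

section \<open>Plancherel for absolutely summable sequences\<close>

lemma summable_fourier_l1:
  assumes y: "y \<in> l1 H" and \<xi>: "\<xi> \<in> dual_group H"
  shows "(\<lambda>h. y h * cnj (\<xi> h)) summable_on H"
proof (rule abs_summable_summable)
  have "cmod (y h * cnj (\<xi> h)) = cmod (y h)" if "h \<in> H" for h
    using character(1)[OF \<xi> that] by (simp add: norm_mult)
  then show "(\<lambda>h. cmod (y h * cnj (\<xi> h))) summable_on H"
    using y by (subst summable_on_cong) (simp_all add: l1_def)
qed

text \<open>Characters have modulus \<open>1\<close>, so the bound is independent of
  \<open>\<xi>\<close>. Uniform approximation by trigonometric polynomials gives measurability and,
  since \<open>\<nu>\<close> has mass \<open>1\<close>, approximation in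
  \<open>L\<^sup>2\<close>.\<close>

lemma fourier_l1_truncation:
  assumes y: "y \<in> l1 H" and X: "finite X" "X \<subseteq> H" and \<xi>: "\<xi> \<in> dual_group H"
  shows "cmod ((\<Sum>h\<in>X. y h * cnj (\<xi> h)) - fourier_l1 H y \<xi>) \<le> (\<Sum>\<^sub>\<infinity>h\<in>H - X. cmod (y h))"
proof -
  have norm: "cmod (y h * cnj (\<xi> h)) = cmod (y h)" if "h \<in> H" for h
    using character(1)[OF \<xi> that] by (simp add: norm_mult)
  have abs: "(\<lambda>h. cmod (y h * cnj (\<xi> h))) summable_on H"
    using y by (subst summable_on_cong[OF norm]) (simp_all add: l1_def)
  have abs': "(\<lambda>h. cmod (y h * cnj (\<xi> h))) summable_on H - X"
    by (rule summable_on_subset_banach[OF abs]) simp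
  have "(\<Sum>\<^sub>\<infinity>h\<in>H - X. y h * cnj (\<xi> h)) = fourier_l1 H y \<xi> - (\<Sum>h\<in>X. y h * cnj (\<xi> h))"
    unfolding fourier_l1_def using X abs_summable_summable[OF abs] by (subst infsum_Diff) auto
  moreover have "cmod (\<Sum>\<^sub>\<infinity>h\<in>H - X. y h * cnj (\<xi> h)) \<le> (\<Sum>\<^sub>\<infinity>h\<in>H - X. cmod (y h * cnj (\<xi> h)))"
    by (rule norm_infsum_bound[OF abs'])
  moreover have "(\<Sum>\<^sub>\<infinity>h\<in>H - X. cmod (y h * cnj (\<xi> h))) = (\<Sum>\<^sub>\<infinity>h\<in>H - X. cmod (y h))"
    using norm by (intro infsum_cong) auto
  ultimately show ?thesis
    by (simp add: norm_minus_commute)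
qed

lemma l1_truncation_sequence:
  assumes y: "y \<in> l1 H"
  obtains X where "\<And>k. finite (X k)" "\<And>k. X k \<subseteq> H"
    "\<And>k. (\<Sum>\<^sub>\<infinity>h\<in>H - X k. cmod (y h)) \<le> inverse (real (Suc k))"
proof -
  have "\<forall>k. \<exists>X. finite X \<and> X \<subseteq> H \<and> (\<Sum>\<^sub>\<infinity>h\<in>H - X. cmod (y h)) \<le> inverse (real (Suc k))"
    using l1_truncation[OF y] by simp
  then obtain X where "\<forall>k. finite (X k) \<and> X k \<subseteq> H \<and> (\<Sum>\<^sub>\<infinity>h\<in>H - X k. cmod (y h)) \<le> inverse (real (Suc k))"
    by (rule choice[elim_format]) blast
  then show ?thesis
    using that by blast
qed

lemma fourier_l1_measurable [measurable]:
  assumes y: "y \<in> l1 H"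
  shows "fourier_l1 H y \<in> borel_measurable \<nu>"
proof -
  obtain X where X: "\<And>k. finite (X k)" "\<And>k. X k \<subseteq> H"
    and small: "\<And>k. (\<Sum>\<^sub>\<infinity>h\<in>H - X k. cmod (y h)) \<le> inverse (real (Suc k))"
    by (rule l1_truncation_sequence[OF y]) (rule that)
  show ?thesis
  proof (rule borel_measurable_LIMSEQ_metric)
    fix k
    show "(\<lambda>\<xi>. \<Sum>h\<in>X k. y h * cnj (\<xi> h)) \<in> borel_measurable \<nu>"
      using X(2)[of k] by (intro borel_measurable_sum borel_measurable_times borel_measurable_const
          cnj_eval_measurable) auto
  next
    fix \<xi> assume "\<xi> \<in> space \<nu>"
    then have \<xi>: "\<xi> \<in> dual_group H"
      by (simp add: space_dual)
    have "cmod ((\<Sum>h\<in>X k. y h * cnj (\<xi> h)) - fourier_l1 H y \<xi>) \<le> inverse (real (Suc k))" for k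
      using fourier_l1_truncation[OF y X \<xi>] small by (rule order_trans)
    then have "(\<lambda>k. (\<Sum>h\<in>X k. y h * cnj (\<xi> h)) - fourier_l1 H y \<xi>) \<longlonglongrightarrow> 0"
      by (intro Lim_null_comparison[OF always_eventually LIMSEQ_inverse_real_of_nat]) blast
    then show "(\<lambda>k. \<Sum>h\<in>X k. y h * cnj (\<xi> h)) \<longlonglongrightarrow> fourier_l1 H y \<xi>"
      by (rule LIM_zero_cancel)
  qed
qed

text \<open>The finite case holds for the truncations \<open>u k\<close> and \<open>v k\<close>;
  both converge in \<open>L\<^sup>2\<close>, and \<open>L2_norm_limit_eq\<close> transfers the
  equality of norms to the limits.\<close>

lemma plancherel_l1:
  assumes y: "y \<in> l1 H"
  shows "L2_dist_sq (count_space H) y (\<lambda>_. 0) = L2_dist_sq \<nu> (fourier_l1 H y) (\<lambda>_. 0)"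
proof -
  obtain X where X: "\<And>k. finite (X k)" "\<And>k. X k \<subseteq> H"
    and small: "\<And>k. (\<Sum>\<^sub>\<infinity>h\<in>H - X k. cmod (y h)) \<le> inverse (real (Suc k))"
    by (rule l1_truncation_sequence[OF y]) (rule that)
  define u where "u k h = (if h \<in> X k then y h else 0)" for k h
  define v where "v k \<xi> = (\<Sum>h\<in>X k. y h * cnj (\<xi> h))" for k and \<xi> :: "'g \<Rightarrow> complex"
  have sq_lim: "(\<lambda>k. ennreal ((inverse (real (Suc k)))\<^sup>2)) \<longlonglongrightarrow> 0"
    using tendsto_ennrealI[OF tendsto_power[OF LIMSEQ_inverse_real_of_nat, of 2]] by simp
  show ?thesis
  proof (rule L2_norm_limit_eq)
    show "v k \<in> borel_measurable \<nu>" for k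
      unfolding v_def using X(2)[of k]
      by (intro borel_measurable_sum borel_measurable_times borel_measurable_const
          cnj_eval_measurable) auto
    show "L2_dist_sq (count_space H) (u k) (\<lambda>_. 0) = L2_dist_sq \<nu> (v k) (\<lambda>_. 0)" for k
    proof -
      have "L2_dist_sq (count_space H) (u k) (\<lambda>_. 0) = (\<Sum>h\<in>X k. ennreal ((cmod (u k h))\<^sup>2))"
        unfolding L2_dist_sq_def using X by (subst nn_integral_count_space'[of "X k"]) (auto simp: u_def)
      also have "\<dots> = ennreal (\<Sum>h\<in>X k. (cmod (y h))\<^sup>2)"
        by (simp add: u_def)
      also have "\<dots> = L2_dist_sq \<nu> (v k) (\<lambda>_. 0)"
        using plancherel_finite[OF X(1)[of k] X(2)[of k], of y] by (simp add: L2_dist_sq_def v_def)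
      finally show ?thesis .
    qed
    show "(\<lambda>k. L2_dist_sq \<nu> (v k) (fourier_l1 H y)) \<longlonglongrightarrow> 0"
    proof (rule tendsto_sandwich[OF _ _ tendsto_const sq_lim])
      have "L2_dist_sq \<nu> (v k) (fourier_l1 H y) \<le> ennreal ((inverse (real (Suc k)))\<^sup>2)" for k
      proof -
        have "L2_dist_sq \<nu> (v k) (fourier_l1 H y) \<le> (\<integral>\<^sup>+ \<xi>. ennreal ((inverse (real (Suc k)))\<^sup>2) \<partial>\<nu>)"
          unfolding L2_dist_sq_def
        proof (rule nn_integral_mono)
          fix \<xi> assume "\<xi> \<in> space \<nu>"
          then have \<xi>: "\<xi> \<in> dual_group H"
            by (simp add: space_dual)
          have "cmod (v k \<xi> - fourier_l1 H y \<xi>) \<le> inverse (real (Suc k))"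
            unfolding v_def by (rule order_trans[OF fourier_l1_truncation[OF y X \<xi>] small])
          then show "ennreal ((cmod (v k \<xi> - fourier_l1 H y \<xi>))\<^sup>2) \<le> ennreal ((inverse (real (Suc k)))\<^sup>2)"
            by (intro ennreal_leI power_mono) auto
        qed
        then show ?thesis
          by (simp add: emeasure_space_1)
      qed
      then show "\<forall>\<^sub>F k in sequentially. L2_dist_sq \<nu> (v k) (fourier_l1 H y) \<le> ennreal ((inverse (real (Suc k)))\<^sup>2)"
        by simp
    qed simp
    show "(\<lambda>k. L2_dist_sq (count_space H) (u k) y) \<longlonglongrightarrow> 0"
    proof (rule tendsto_sandwich[OF _ _ tendsto_const sq_lim])
      have "L2_dist_sq (count_space H) (u k) y \<le> ennreal ((inverse (real (Suc k)))\<^sup>2)" for k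
      proof -
        define e where "e = inverse (real (Suc k))"
        \<comment> \<open>\<open>r\<close> is the size of the discarded part of \<open>y\<close>.
          Each of its values is at most its sum, hence at most \<open>e\<close>, so its squares sum
          to at most \<open>e\<^sup>2\<close>.\<close>
        define r where "r h = (if h \<in> X k then 0 else cmod (y h))" for h
        have s: "(\<lambda>h. cmod (y h)) summable_on H - X k"
          by (rule summable_on_subset_banach[of _ H]) (use y in \<open>auto simp: l1_def\<close>)
        have "r summable_on H \<longleftrightarrow> (\<lambda>h. cmod (y h)) summable_on H - X k"
          by (rule summable_on_cong_neutral) (auto simp: r_def)
        moreover have "infsum r H = (\<Sum>\<^sub>\<infinity>h\<in>H - X k. cmod (y h))"
          by (rule infsum_cong_neutral) (auto simp: r_def)
        ultimately have r: "r summable_on H" "infsum r H \<le> e"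
          using s small[of k] by (simp_all add: e_def)
        have r_nonneg: "0 \<le> r h" for h
          by (simp add: r_def)
        then have r_le: "r h \<le> e" if "h \<in> H" for h
          using finite_sum_le_infsum[OF r(1), of "{h}"] r(2) that by simp
        have "L2_dist_sq (count_space H) (u k) y \<le> (\<integral>\<^sup>+ h. ennreal (e * r h) \<partial>count_space H)"
          unfolding L2_dist_sq_def
        proof (rule nn_integral_mono, rule ennreal_leI)
          fix h assume "h \<in> space (count_space H)"
          then have "r h * r h \<le> e * r h"
            using r_le r_nonneg by (intro mult_right_mono) auto
          then show "(cmod (u k h - y h))\<^sup>2 \<le> e * r h"
            by (auto simp: u_def r_def power2_eq_square)
        qed
        also have "\<dots> = ennreal (e * infsum r H)"
          using r r_nonneg by (subst nn_integral_count_space_infsum)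
            (auto intro!: summable_on_cmult_right simp: infsum_cmult_right e_def)
        also have "\<dots> \<le> ennreal (e\<^sup>2)"
          using r(2) by (auto simp: power2_eq_square e_def intro!: ennreal_leI mult_left_mono)
        finally show ?thesis
          by (simp add: e_def)
      qed
      then show "\<forall>\<^sub>F k in sequentially. L2_dist_sq (count_space H) (u k) y \<le> ennreal ((inverse (real (Suc k)))\<^sup>2)"
        by simp
    qed simp
  qed (use y in simp_all)
qed

section \<open>The Fourier transform of square-summable sequences\<close>

lemma l2_limit_iff:
  assumes "\<And>k. y k \<in> l1 H" "x \<in> l2 H"
  shows "(\<lambda>k. \<Sum>\<^sub>\<infinity>h\<in>H. (cmod (y k h - x h))\<^sup>2) \<longlonglongrightarrow> 0 \<longleftrightarrow>
    (\<lambda>k. L2_dist_sq (count_space H) (y k) x) \<longlonglongrightarrow> 0"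
proof -
  have "L2_dist_sq (count_space H) (y k) x = ennreal (\<Sum>\<^sub>\<infinity>h\<in>H. (cmod (y k h - x h))\<^sup>2)" for k
    using assms l1_subset_l2 by (intro L2_dist_sq_count_space) auto
  moreover have "(\<lambda>k. ennreal (\<Sum>\<^sub>\<infinity>h\<in>H. (cmod (y k h - x h))\<^sup>2)) \<longlonglongrightarrow> ennreal 0 \<longleftrightarrow>
      (\<lambda>k. \<Sum>\<^sub>\<infinity>h\<in>H. (cmod (y k h - x h))\<^sup>2) \<longlonglongrightarrow> 0"
    by (rule tendsto_ennreal_iff) (auto intro!: always_eventually infsum_nonneg)
  ultimately show ?thesis
    by simp
qed

lemma is_fourier_l2E:
  assumes "is_fourier_l2 H \<nu> x g"
  obtains y where "x \<in> l2 H" "g \<in> borel_measurable \<nu>" "\<And>k. y k \<in> l1 H"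
    "(\<lambda>k. L2_dist_sq (count_space H) (y k) x) \<longlonglongrightarrow> 0"
    "(\<lambda>k. L2_dist_sq \<nu> (fourier_l1 H (y k)) g) \<longlonglongrightarrow> 0"
proof -
  obtain y where x: "x \<in> l2 H" and g: "g \<in> borel_measurable \<nu>" and y: "\<forall>k. y k \<in> l1 H"
    and lim: "(\<lambda>k. \<Sum>\<^sub>\<infinity>h\<in>H. (cmod (y k h - x h))\<^sup>2) \<longlonglongrightarrow> 0"
    and lim': "(\<lambda>k. L2_dist_sq \<nu> (fourier_l1 H (y k)) g) \<longlonglongrightarrow> 0"
    using assms unfolding is_fourier_l2_def by (elim conjE exE)
  from lim have "(\<lambda>k. L2_dist_sq (count_space H) (y k) x) \<longlonglongrightarrow> 0"
    using l2_limit_iff[of y x] y x by simp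
  then show ?thesis
    using that[of y] x g y lim' by simp
qed

lemma is_fourier_l2I:
  assumes "x \<in> l2 H" "g \<in> borel_measurable \<nu>" "\<And>k. y k \<in> l1 H"
    "(\<lambda>k. L2_dist_sq (count_space H) (y k) x) \<longlonglongrightarrow> 0"
    "(\<lambda>k. L2_dist_sq \<nu> (fourier_l1 H (y k)) g) \<longlonglongrightarrow> 0"
  shows "is_fourier_l2 H \<nu> x g"
  using assms l2_limit_iff[of y x] unfolding is_fourier_l2_def by (intro conjI exI[of _ y]) simp_all

text \<open>The norms agree along the absolutely summable approximants and pass to both
  limits.\<close>

lemma plancherel:
  assumes "is_fourier_l2 H \<nu> x g"
  shows "L2_dist_sq \<nu> g (\<lambda>_. 0) = ennreal (\<Sum>\<^sub>\<infinity>h\<in>H. (cmod (x h))\<^sup>2)"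
  using assms
proof (rule is_fourier_l2E)
  fix y assume y: "x \<in> l2 H" "g \<in> borel_measurable \<nu>" "\<And>k. y k \<in> l1 H"
    "(\<lambda>k. L2_dist_sq (count_space H) (y k) x) \<longlonglongrightarrow> 0"
    "(\<lambda>k. L2_dist_sq \<nu> (fourier_l1 H (y k)) g) \<longlonglongrightarrow> 0"
  have "L2_dist_sq (count_space H) x (\<lambda>_. 0) = L2_dist_sq \<nu> g (\<lambda>_. 0)"
    by (rule L2_norm_limit_eq[OF _ _ _ _ y(4,5)])
      (use y(2,3) in \<open>simp_all add: plancherel_l1\<close>)
  then show ?thesis
    using L2_dist_sq_count_space[OF y(1) l2_zero] by simp
qed

lemma is_fourier_l2_add:
  assumes "is_fourier_l2 H \<nu> x g" "is_fourier_l2 H \<nu> x' g'"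
  shows "is_fourier_l2 H \<nu> (\<lambda>h. x h + x' h) (\<lambda>\<xi>. g \<xi> + g' \<xi>)"
proof -
  obtain y where y: "x \<in> l2 H" "g \<in> borel_measurable \<nu>" "\<And>k. y k \<in> l1 H"
    "(\<lambda>k. L2_dist_sq (count_space H) (y k) x) \<longlonglongrightarrow> 0"
    "(\<lambda>k. L2_dist_sq \<nu> (fourier_l1 H (y k)) g) \<longlonglongrightarrow> 0"
    by (rule is_fourier_l2E[OF assms(1)]) (rule that)
  obtain y' where y': "x' \<in> l2 H" "g' \<in> borel_measurable \<nu>" "\<And>k. y' k \<in> l1 H"
    "(\<lambda>k. L2_dist_sq (count_space H) (y' k) x') \<longlonglongrightarrow> 0"
    "(\<lambda>k. L2_dist_sq \<nu> (fourier_l1 H (y' k)) g') \<longlonglongrightarrow> 0"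
    by (rule is_fourier_l2E[OF assms(2)]) (rule that)
  have lim0: "(\<lambda>k. 2 * a k + 2 * b k) \<longlonglongrightarrow> 0" if "a \<longlonglongrightarrow> 0" "b \<longlonglongrightarrow> 0" for a b :: "nat \<Rightarrow> ennreal"
    using tendsto_add[OF ennreal_tendsto_cmult[OF _ that(1), of 2] ennreal_tendsto_cmult[OF _ that(2), of 2]]
    by simp
  show ?thesis
  proof (rule is_fourier_l2I)
    show "(\<lambda>h. x h + x' h) \<in> l2 H"
      by (rule l2_add[OF y(1) y'(1)])
    show "(\<lambda>\<xi>. g \<xi> + g' \<xi>) \<in> borel_measurable \<nu>"
      using y(2) y'(2) by simp
    show l1: "(\<lambda>h. y k h + y' k h) \<in> l1 H" for k
      using y(3)[of k] y'(3)[of k] unfolding l1_def mem_Collect_eq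
      by (rule summable_on_comparison_test[OF summable_on_add]) (auto intro: norm_triangle_ineq)
    show "(\<lambda>k. L2_dist_sq (count_space H) (\<lambda>h. y k h + y' k h) (\<lambda>h. x h + x' h)) \<longlonglongrightarrow> 0"
      by (rule tendsto_sandwich[OF _ _ tendsto_const lim0[OF y(4) y'(4)]])
        (auto intro!: always_eventually L2_dist_sq_add_le)
    have "fourier_l1 H (\<lambda>h. y k h + y' k h) \<xi> = fourier_l1 H (y k) \<xi> + fourier_l1 H (y' k) \<xi>"
      if \<xi>: "\<xi> \<in> dual_group H" for k \<xi>
    proof -
      have s: "(\<lambda>h. z h * cnj (\<xi> h)) summable_on H" if "z \<in> l1 H" for z
        by (rule summable_fourier_l1[OF that \<xi>])
      show ?thesis
        unfolding fourier_l1_def distrib_right by (rule infsum_add[OF s[OF y(3)] s[OF y'(3)]])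
    qed
    then have eq: "L2_dist_sq \<nu> (fourier_l1 H (\<lambda>h. y k h + y' k h)) (\<lambda>\<xi>. g \<xi> + g' \<xi>) =
        L2_dist_sq \<nu> (\<lambda>\<xi>. fourier_l1 H (y k) \<xi> + fourier_l1 H (y' k) \<xi>) (\<lambda>\<xi>. g \<xi> + g' \<xi>)" for k
      unfolding L2_dist_sq_def by (intro nn_integral_cong) (simp add: space_dual)
    show "(\<lambda>k. L2_dist_sq \<nu> (fourier_l1 H (\<lambda>h. y k h + y' k h)) (\<lambda>\<xi>. g \<xi> + g' \<xi>)) \<longlonglongrightarrow> 0"
      unfolding eq by (rule tendsto_sandwich[OF _ _ tendsto_const lim0[OF y(5) y'(5)]])
        (use y y' in \<open>auto intro!: always_eventually L2_dist_sq_add_le\<close>)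
  qed
qed

text \<open>A shift turns into multiplication by the unit number \<open>cnj (\<xi> s)\<close>, so
  shifted and scaled approximants have their errors multiplied by the same factor on both sides.
  Scaling and shifting occur together because a convolution with a finitely supported sequence is a
  sum of such terms.\<close>

lemma is_fourier_l2_cmult_shift:
  assumes f: "is_fourier_l2 H \<nu> x g" and s: "s \<in> H"
  shows "is_fourier_l2 H \<nu> (\<lambda>h. c * x (h - s)) (\<lambda>\<xi>. c * cnj (\<xi> s) * g \<xi>)"
proof -
  obtain y where y: "x \<in> l2 H" "g \<in> borel_measurable \<nu>" "\<And>k. y k \<in> l1 H"
    "(\<lambda>k. L2_dist_sq (count_space H) (y k) x) \<longlonglongrightarrow> 0"
    "(\<lambda>k. L2_dist_sq \<nu> (fourier_l1 H (y k)) g) \<longlonglongrightarrow> 0"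
    by (rule is_fourier_l2E[OF f]) (rule that)
  note [measurable] = y(2) cnj_eval_measurable[OF s] fourier_l1_measurable[OF y(3)]
  have bij: "bij_betw (\<lambda>h. h - s) H H"
    by (rule bij_betw_shift[OF subgroup s])
  have lim0: "(\<lambda>k. ennreal ((cmod c)\<^sup>2) * a k) \<longlonglongrightarrow> 0" if "a \<longlonglongrightarrow> 0" for a :: "nat \<Rightarrow> ennreal"
    using ennreal_tendsto_cmult[OF _ that, of "ennreal ((cmod c)\<^sup>2)"] by simp
  show ?thesis
  proof (rule is_fourier_l2I)
    show "(\<lambda>h. c * x (h - s)) \<in> l2 H"
      by (intro l2_cmult l2_shift[OF subgroup s] y)
    show "(\<lambda>\<xi>. c * cnj (\<xi> s) * g \<xi>) \<in> borel_measurable \<nu>"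
      by measurable
    show l1: "(\<lambda>h. c * y k (h - s)) \<in> l1 H" for k
      using y(3)[of k] summable_on_reindex_bij_betw[OF bij, of "\<lambda>h. cmod (y k h)"]
      by (simp add: l1_def norm_mult summable_on_cmult_right)
    have "L2_dist_sq (count_space H) (\<lambda>h. c * y k (h - s)) (\<lambda>h. c * x (h - s)) =
        (\<integral>\<^sup>+ h. ennreal ((cmod c)\<^sup>2) * ennreal ((cmod (y k (h - s) - x (h - s)))\<^sup>2) \<partial>count_space H)" for k
      unfolding L2_dist_sq_def
      by (simp add: norm_mult power_mult_distrib ennreal_mult flip: right_diff_distrib)
    also have "\<dots> k = ennreal ((cmod c)\<^sup>2) * L2_dist_sq (count_space H) (y k) x" for k
      unfolding L2_dist_sq_def
      using nn_integral_bij_count_space[OF bij, of "\<lambda>h. ennreal ((cmod (y k h - x h))\<^sup>2)"]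
      by (simp add: nn_integral_cmult)
    finally show "(\<lambda>k. L2_dist_sq (count_space H) (\<lambda>h. c * y k (h - s)) (\<lambda>h. c * x (h - s))) \<longlonglongrightarrow> 0"
      using lim0[OF y(4)] by simp
    have four: "fourier_l1 H (\<lambda>h. c * y k (h - s)) \<xi> = c * cnj (\<xi> s) * fourier_l1 H (y k) \<xi>"
      if \<xi>: "\<xi> \<in> dual_group H" for k \<xi>
    proof -
      have split: "\<xi> h = \<xi> (h - s) * \<xi> s" if "h \<in> H" for h
        using character(2)[OF \<xi> subgroupD(4)[OF that s] s] by simp
      have "fourier_l1 H (\<lambda>h. c * y k (h - s)) \<xi> = (\<Sum>\<^sub>\<infinity>h\<in>H. c * cnj (\<xi> s) * (y k (h - s) * cnj (\<xi> (h - s))))"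
        unfolding fourier_l1_def by (intro infsum_cong) (simp add: split)
      also have "\<dots> = c * cnj (\<xi> s) * (\<Sum>\<^sub>\<infinity>h\<in>H. y k (h - s) * cnj (\<xi> (h - s)))"
        by (rule infsum_cmult_right')
      also have "(\<Sum>\<^sub>\<infinity>h\<in>H. y k (h - s) * cnj (\<xi> (h - s))) = fourier_l1 H (y k) \<xi>"
        unfolding fourier_l1_def by (rule infsum_reindex_bij_betw[OF bij])
      finally show ?thesis .
    qed
    have "L2_dist_sq \<nu> (fourier_l1 H (\<lambda>h. c * y k (h - s))) (\<lambda>\<xi>. c * cnj (\<xi> s) * g \<xi>) =
        (\<integral>\<^sup>+ \<xi>. ennreal ((cmod c)\<^sup>2) * ennreal ((cmod (fourier_l1 H (y k) \<xi> - g \<xi>))\<^sup>2) \<partial>\<nu>)" for k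
      unfolding L2_dist_sq_def
    proof (rule nn_integral_cong)
      fix \<xi> assume "\<xi> \<in> space \<nu>"
      then have \<xi>: "\<xi> \<in> dual_group H"
        by (simp add: space_dual)
      show "ennreal ((cmod (fourier_l1 H (\<lambda>h. c * y k (h - s)) \<xi> - c * cnj (\<xi> s) * g \<xi>))\<^sup>2) =
          ennreal ((cmod c)\<^sup>2) * ennreal ((cmod (fourier_l1 H (y k) \<xi> - g \<xi>))\<^sup>2)"
        using character(1)[OF \<xi> s]
        by (simp add: four[OF \<xi>] norm_mult power_mult_distrib ennreal_mult flip: right_diff_distrib)
    qed
    also have "\<dots> k = ennreal ((cmod c)\<^sup>2) * L2_dist_sq \<nu> (fourier_l1 H (y k)) g" for k
      unfolding L2_dist_sq_def by (simp add: nn_integral_cmult)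
    finally show "(\<lambda>k. L2_dist_sq \<nu> (fourier_l1 H (\<lambda>h. c * y k (h - s))) (\<lambda>\<xi>. c * cnj (\<xi> s) * g \<xi>)) \<longlonglongrightarrow> 0"
      using lim0[OF y(5)] by simp
  qed
qed

lemma is_fourier_l2_zero: "is_fourier_l2 H \<nu> (\<lambda>_. 0) (\<lambda>_. 0)"
  by (rule is_fourier_l2I[of _ _ "\<lambda>_ _. 0"])
    (simp_all add: l2_zero l1_def L2_dist_sq_def fourier_l1_def)

lemma is_fourier_l2_sum:
  assumes "finite I" "\<And>i. i \<in> I \<Longrightarrow> is_fourier_l2 H \<nu> (x i) (g i)"
  shows "is_fourier_l2 H \<nu> (\<lambda>h. \<Sum>i\<in>I. x i h) (\<lambda>\<xi>. \<Sum>i\<in>I. g i \<xi>)"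
  using assms by (induction rule: finite_induct) (auto intro: is_fourier_l2_zero is_fourier_l2_add)

end

section \<open>Transfer matrices and convolution\<close>

text \<open>Each term of the Leibniz expansion uses exactly one entry of column \<open>k\<close>,
  bounded by \<open>b\<close>. The remaining CARD('n) - 1 factors are at most \<open>L\<close>, and
  \<open>1 \<le> L\<close> allows one more factor \<open>L\<close> for a simpler exponent.\<close>

lemma norm_det_le:
  fixes A :: "complex^'n^'n"
  assumes L: "1 \<le> L" and k: "\<And>i. cmod (A $ i $ k) \<le> b" and A: "\<And>i j. j \<noteq> k \<Longrightarrow> cmod (A $ i $ j) \<le> L"
  shows "cmod (det A) \<le> fact CARD('n) * (b * L ^ CARD('n))"
proof -
  have b: "0 \<le> b"
    using k norm_ge_zero order_trans by blast
  have "cmod (of_int (sign p) * (\<Prod>i\<in>UNIV. A $ i $ p i)) \<le> b * L ^ CARD('n)"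
    if p: "p permutes (UNIV :: 'n set)" for p
  proof -
    define i0 where "i0 = inv p k"
    have i0: "p i0 = k" and ne: "i \<noteq> i0 \<Longrightarrow> p i \<noteq> k" for i
      using permutes_inverses[OF p] by (auto simp: i0_def)
    have "cmod (of_int (sign p) * (\<Prod>i\<in>UNIV. A $ i $ p i)) = (\<Prod>i\<in>UNIV. cmod (A $ i $ p i))"
      by (simp add: norm_mult prod_norm sign_def)
    also have "\<dots> = cmod (A $ i0 $ p i0) * (\<Prod>i\<in>UNIV - {i0}. cmod (A $ i $ p i))"
      by (rule prod.remove) auto
    also have "\<dots> \<le> b * (\<Prod>i\<in>UNIV - {i0}. L)"
      using k A ne b by (intro mult_mono prod_mono prod_nonneg) (auto simp: i0)
    also have "\<dots> \<le> b * L ^ CARD('n)"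
      using L b by (intro mult_left_mono) (auto intro!: power_increasing)
    finally show ?thesis .
  qed
  then have "cmod (det A) \<le> (\<Sum>p | p permutes (UNIV :: 'n set). b * L ^ CARD('n))"
    unfolding det_def by (intro sum_norm_le) auto
  then show ?thesis
    by (simp add: card_permutations[OF refl])
qed

lemma sum_square_le:
  fixes f :: "'a \<Rightarrow> real"
  shows "(\<Sum>i\<in>A. f i)\<^sup>2 \<le> real (card A) * (\<Sum>i\<in>A. (f i)\<^sup>2)"
  using Cauchy_Schwarz_ineq_sum[of "\<lambda>_. 1" f A] by simp

lemma matrix_upper_bound:
  fixes B :: "complex^'n^'m"
  assumes K: "\<And>m n. cmod (B $ m $ n) \<le> K"
  shows "(\<Sum>m\<in>UNIV. (cmod ((B *v v) $ m))\<^sup>2) \<le>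
    real CARD('m) * (real CARD('n) * K\<^sup>2) * (\<Sum>n\<in>UNIV. (cmod (v $ n))\<^sup>2)"
proof -
  have "(cmod ((B *v v) $ m))\<^sup>2 \<le> (real CARD('n) * K\<^sup>2) * (\<Sum>n\<in>UNIV. (cmod (v $ n))\<^sup>2)" for m
  proof -
    have "cmod ((B *v v) $ m) \<le> (\<Sum>n\<in>UNIV. K * cmod (v $ n))"
      unfolding matrix_vector_mult_def vec_lambda_beta
      by (rule sum_norm_le) (simp add: norm_mult K mult_right_mono)
    then have "(cmod ((B *v v) $ m))\<^sup>2 \<le> (\<Sum>n\<in>UNIV. K * cmod (v $ n))\<^sup>2"
      by (intro power_mono) auto
    also have "\<dots> \<le> real CARD('n) * (\<Sum>n\<in>UNIV. (K * cmod (v $ n))\<^sup>2)"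
      by (rule sum_square_le)
    finally show ?thesis
      by (simp add: power_mult_distrib sum_distrib_left mult.assoc)
  qed
  then have "(\<Sum>m\<in>UNIV. (cmod ((B *v v) $ m))\<^sup>2) \<le>
      (\<Sum>m\<in>(UNIV :: 'm set). (real CARD('n) * K\<^sup>2) * (\<Sum>n\<in>UNIV. (cmod (v $ n))\<^sup>2))"
    by (rule sum_mono)
  then show ?thesis
    by (simp add: mult.assoc)
qed

text \<open>Cramer's rule for \<open>B\<^sup>* B\<close> recovers \<open>v\<close> from \<open>B v\<close> at a cost controlled by the entries and the
  determinant.\<close>

lemma matrix_lower_bound:
  fixes B :: "complex^'n^'m" and K d :: real
  defines "Q \<equiv> fact CARD('n) * (K * (real CARD('m) * K\<^sup>2 + 1) ^ CARD('n)) / d"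
  assumes K: "\<And>m n. cmod (B $ m $ n) \<le> K" and d: "0 < d" "d \<le> cmod (det (conj_transpose B ** B))"
  shows "(\<Sum>n\<in>UNIV. (cmod (v $ n))\<^sup>2) \<le>
    real CARD('n) * (Q\<^sup>2 * real CARD('m)) * (\<Sum>m\<in>UNIV. (cmod ((B *v v) $ m))\<^sup>2)"
proof -
  define E where "E = conj_transpose B ** B"
  define s where "s = (\<Sum>m\<in>UNIV. cmod ((B *v v) $ m))"
  \<comment> \<open>The first summand bounds the entries of \<open>E\<close>; the \<open>1\<close>
    ensures \<open>1 \<le> L\<close> for \<open>norm_det_le\<close>.\<close>
  define L where "L = real CARD('m) * K\<^sup>2 + 1"
  have K0: "0 \<le> K"
    using K norm_ge_zero order_trans by blast
  have E: "cmod (E $ i $ j) \<le> L" for i j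
  proof -
    have "cmod (E $ i $ j) \<le> (\<Sum>m\<in>(UNIV :: 'm set). K * K)"
      unfolding E_def conj_transpose_def matrix_matrix_mult_def map_matrix_def transpose_def vec_lambda_beta
      by (rule sum_norm_le) (use K K0 in \<open>auto simp: norm_mult intro!: mult_mono\<close>)
    then show ?thesis
      by (simp add: L_def power2_eq_square)
  qed
  have Ev: "cmod ((E *v v) $ i) \<le> K * s" for i
  proof -
    have "(E *v v) $ i = (conj_transpose B *v (B *v v)) $ i"
      by (simp add: E_def matrix_vector_mul_assoc)
    also have "cmod \<dots> \<le> (\<Sum>m\<in>UNIV. K * cmod ((B *v v) $ m))"
      unfolding conj_transpose_def map_matrix_def transpose_def
      by (subst matrix_vector_mult_def, unfold vec_lambda_beta, rule sum_norm_le)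
        (use K in \<open>auto simp: norm_mult intro!: mult_right_mono\<close>)
    finally show ?thesis
      by (simp add: s_def sum_distrib_left)
  qed
  \<comment> \<open>\<open>v $ k * det E\<close> is the determinant of \<open>E\<close> with column
    \<open>k\<close> replaced by \<open>E *v v\<close>. The bound \<open>K * s\<close> for that
    column is the \<open>b\<close> of \<open>norm_det_le\<close>.\<close>
  have comp: "cmod (v $ k) \<le> Q * s" for k
  proof -
    have "cmod (v $ k) * d \<le> cmod (v $ k * det E)"
      using d(2) by (simp add: norm_mult E_def mult_left_mono)
    also have "\<dots> = cmod (det (\<chi> i j. if j = k then (E *v v) $ i else E $ i $ j))"
      by (simp add: cramer_lemma)
    also have "\<dots> \<le> fact CARD('n) * ((K * s) * L ^ CARD('n))"
      by (rule norm_det_le[where k = k]) (use E Ev in \<open>auto simp: L_def\<close>)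
    finally show ?thesis
      using d(1) by (simp add: Q_def L_def field_simps)
  qed
  have "(cmod (v $ k))\<^sup>2 \<le> (Q\<^sup>2 * real CARD('m)) * (\<Sum>m\<in>UNIV. (cmod ((B *v v) $ m))\<^sup>2)" for k
  proof -
    have "(cmod (v $ k))\<^sup>2 \<le> (Q * s)\<^sup>2"
      using comp by (intro power_mono) auto
    also have "\<dots> \<le> Q\<^sup>2 * (real CARD('m) * (\<Sum>m\<in>UNIV. (cmod ((B *v v) $ m))\<^sup>2))"
      unfolding power_mult_distrib s_def by (intro mult_left_mono sum_square_le) auto
    finally show ?thesis
      by (simp add: mult.assoc)
  qed
  then have "(\<Sum>k\<in>UNIV. (cmod (v $ k))\<^sup>2) \<le>
      (\<Sum>k\<in>(UNIV :: 'n set). (Q\<^sup>2 * real CARD('m)) * (\<Sum>m\<in>UNIV. (cmod ((B *v v) $ m))\<^sup>2))"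
    by (rule sum_mono)
  then show ?thesis
    by (simp add: mult.assoc)
qed

lemma in_Linfty_AE_bound:
  assumes "in_Linfty M g"
  shows "\<exists>K. 0 \<le> K \<and> (AE \<xi> in M. cmod (g \<xi>) \<le> K)"
proof -
  have fin: "esssup M (\<lambda>\<xi>. ereal (cmod (g \<xi>))) < \<infinity>"
    using assms by (simp add: in_Linfty_def)
  then obtain K where K: "esssup M (\<lambda>\<xi>. ereal (cmod (g \<xi>))) < ereal K"
    using ereal_dense2 by blast
  have "AE \<xi> in M. ereal (cmod (g \<xi>)) \<le> esssup M (\<lambda>\<xi>. ereal (cmod (g \<xi>)))"
    by (rule esssup_AE)
  then have "AE \<xi> in M. cmod (g \<xi>) \<le> max 0 K"
  proof eventually_elim
    case (elim \<xi>)
    then have "ereal (cmod (g \<xi>)) < ereal K"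
      using K by (rule order_le_less_trans)
    then show ?case
      by simp
  qed
  then show ?thesis
    by (intro exI[of _ "max 0 K"]) simp
qed

text \<open>The essential infimum is an extended real and may be infinite, so a real number strictly
  between \<open>0\<close> and it serves as \<open>d\<close>.\<close>

lemma essinf_AE_bound:
  assumes "0 < essinf M (\<lambda>\<xi>. ereal (f \<xi>))"
  shows "\<exists>d>0. AE \<xi> in M. d \<le> f \<xi>"
proof -
  obtain d where d: "0 < ereal d" "ereal d < essinf M (\<lambda>\<xi>. ereal (f \<xi>))"
    using ereal_dense2[OF assms] by blast
  have "AE \<xi> in M. - ereal (f \<xi>) \<le> esssup M (\<lambda>\<xi>. - ereal (f \<xi>))"
    by (rule esssup_AE)
  then have "AE \<xi> in M. d \<le> f \<xi>"
  proof eventually_elim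
    case (elim \<xi>)
    then have "essinf M (\<lambda>\<xi>. ereal (f \<xi>)) \<le> ereal (f \<xi>)"
      unfolding essinf_def by (metis ereal_minus_le_minus ereal_uminus_uminus)
    then have "ereal d < ereal (f \<xi>)"
      using d(2) by (rule order_less_le_trans[rotated])
    then show ?case
      by simp
  qed
  then show ?thesis
    using d(1) by (intro exI[of _ d]) simp
qed

definition l2_sq :: "'a set \<Rightarrow> ('b::finite \<Rightarrow> 'a \<Rightarrow> complex) \<Rightarrow> real" where
  "l2_sq H x = (\<Sum>n\<in>UNIV. \<Sum>\<^sub>\<infinity>h\<in>H. (cmod (x n h))\<^sup>2)"

definition matrix_convolution ::
    "'g::ab_group_add set \<Rightarrow> ('g \<Rightarrow> complex)^'n^'m \<Rightarrow> ('n::finite \<Rightarrow> 'g \<Rightarrow> complex) \<Rightarrow> 'm \<Rightarrow> 'g \<Rightarrow> complex" where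
  "matrix_convolution H A x m t = (\<Sum>n\<in>UNIV. convolution H (A $ m $ n) (x n) t)"

context discrete_dual
begin

text \<open>The exceptional null set is the same for all \<open>v\<close>: this matters because
  \<open>v\<close> will itself depend on \<open>\<xi>\<close>. Only the finitely many entries and
  the determinant contribute null sets.\<close>

lemma transfer_matrix_bounds:
  fixes Ahat :: "('g \<Rightarrow> complex) \<Rightarrow> complex^'n^'m::finite"
  assumes Linf: "\<And>m n. in_Linfty \<nu> (\<lambda>\<xi>. Ahat \<xi> $ m $ n)"
    and det: "0 < essinf \<nu> (\<lambda>\<xi>. ereal (Re (det (conj_transpose (Ahat \<xi>) ** Ahat \<xi>))))"
  shows "\<exists>D C. 0 < D \<and> 0 \<le> C \<and> (AE \<xi> in \<nu>. \<forall>v.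
    (\<Sum>n\<in>UNIV. (cmod (v $ n))\<^sup>2) \<le> D * (\<Sum>m\<in>UNIV. (cmod ((Ahat \<xi> *v v) $ m))\<^sup>2) \<and>
    (\<Sum>m\<in>UNIV. (cmod ((Ahat \<xi> *v v) $ m))\<^sup>2) \<le> C * (\<Sum>n\<in>UNIV. (cmod (v $ n))\<^sup>2))"
proof -
  obtain K where K: "\<And>m n. 0 \<le> K m n" "\<And>m n. AE \<xi> in \<nu>. cmod (Ahat \<xi> $ m $ n) \<le> K m n"
    using in_Linfty_AE_bound[OF Linf] by metis
  define L where "L = (\<Sum>m\<in>UNIV. \<Sum>n\<in>UNIV. K m n)"
  have KL: "K m n \<le> L" for m n
  proof -
    have "K m n \<le> (\<Sum>n\<in>UNIV. K m n)"
      by (rule member_le_sum) (auto simp: K)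
    also have "\<dots> \<le> L"
      unfolding L_def by (rule member_le_sum) (auto simp: K intro!: sum_nonneg)
    finally show ?thesis .
  qed
  obtain d where d: "0 < d" "AE \<xi> in \<nu>. d \<le> Re (det (conj_transpose (Ahat \<xi>) ** Ahat \<xi>))"
    using essinf_AE_bound[OF det] by blast
  define Q where "Q = fact CARD('n) * (L * (real CARD('m) * L\<^sup>2 + 1) ^ CARD('n)) / d"
  define D where "D = real CARD('n) * (Q\<^sup>2 * real CARD('m))"
  define C where "C = real CARD('m) * (real CARD('n) * L\<^sup>2)"
  have "AE \<xi> in \<nu>. \<forall>m n. cmod (Ahat \<xi> $ m $ n) \<le> K m n"
    using K(2) by (simp add: AE_all_countable)
  \<comment> \<open>\<open>D\<close> is only known to be nonnegative; \<open>D + 1\<close> is a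
    positive constant for the same estimate.\<close>
  then have "AE \<xi> in \<nu>. \<forall>v.
    (\<Sum>n\<in>UNIV. (cmod (v $ n))\<^sup>2) \<le> (D + 1) * (\<Sum>m\<in>UNIV. (cmod ((Ahat \<xi> *v v) $ m))\<^sup>2) \<and>
    (\<Sum>m\<in>UNIV. (cmod ((Ahat \<xi> *v v) $ m))\<^sup>2) \<le> C * (\<Sum>n\<in>UNIV. (cmod (v $ n))\<^sup>2)"
    using d(2)
  proof eventually_elim
    case (elim \<xi>)
    have L: "cmod (Ahat \<xi> $ m $ n) \<le> L" for m n
      using elim(1) KL order_trans by blast
    have "d \<le> cmod (det (conj_transpose (Ahat \<xi>) ** Ahat \<xi>))"
      using elim(2) complex_Re_le_cmod order_trans by blast
    then have "(\<Sum>n\<in>UNIV. (cmod (v $ n))\<^sup>2) \<le> D * (\<Sum>m\<in>UNIV. (cmod ((Ahat \<xi> *v v) $ m))\<^sup>2)" for v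
      unfolding D_def Q_def using matrix_lower_bound[OF L d(1)] by blast
    moreover have "D * (\<Sum>m\<in>UNIV. (cmod ((Ahat \<xi> *v v) $ m))\<^sup>2) \<le>
        (D + 1) * (\<Sum>m\<in>UNIV. (cmod ((Ahat \<xi> *v v) $ m))\<^sup>2)" for v
      by (intro mult_right_mono) (auto intro!: sum_nonneg)
    ultimately show ?case
      unfolding C_def using matrix_upper_bound[OF L] order_trans by blast
  qed
  moreover have "0 \<le> D" "0 \<le> C"
    by (auto simp: D_def C_def)
  ultimately show ?thesis
    by (intro exI[of _ "D + 1"] exI[of _ C]) auto
qed

end

section \<open>Norms and truncations of vectors of sequences\<close>

lemma l2_sq_nonneg: "0 \<le> l2_sq H x"
  unfolding l2_sq_def by (intro sum_nonneg infsum_nonneg) simp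

lemma l2_sq_add_le:
  assumes "\<And>n. x n \<in> l2 H" "\<And>n. y n \<in> l2 H"
  shows "l2_sq H (\<lambda>n h. x n h + y n h) \<le> 2 * l2_sq H x + 2 * l2_sq H y"
proof -
  have "(\<Sum>\<^sub>\<infinity>h\<in>H. (cmod (x n h + y n h))\<^sup>2) \<le>
      2 * (\<Sum>\<^sub>\<infinity>h\<in>H. (cmod (x n h))\<^sup>2) + 2 * (\<Sum>\<^sub>\<infinity>h\<in>H. (cmod (y n h))\<^sup>2)" for n
  proof -
    have s: "(\<lambda>h. (cmod (x n h))\<^sup>2) summable_on H" "(\<lambda>h. (cmod (y n h))\<^sup>2) summable_on H"
      using assms[of n] by (simp_all add: l2_def)
    have "(\<Sum>\<^sub>\<infinity>h\<in>H. (cmod (x n h + y n h))\<^sup>2) \<le> (\<Sum>\<^sub>\<infinity>h\<in>H. 2 * (cmod (x n h))\<^sup>2 + 2 * (cmod (y n h))\<^sup>2)"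
      using l2_add[OF assms] s
      by (intro infsum_mono norm_add_square_le_2) (auto simp: l2_def intro!: summable_on_add summable_on_cmult_right)
    also have "\<dots> = 2 * (\<Sum>\<^sub>\<infinity>h\<in>H. (cmod (x n h))\<^sup>2) + 2 * (\<Sum>\<^sub>\<infinity>h\<in>H. (cmod (y n h))\<^sup>2)"
      using s by (simp add: infsum_add summable_on_cmult_right infsum_cmult_right)
    finally show ?thesis .
  qed
  then have "l2_sq H (\<lambda>n h. x n h + y n h) \<le>
      (\<Sum>n\<in>UNIV. 2 * (\<Sum>\<^sub>\<infinity>h\<in>H. (cmod (x n h))\<^sup>2) + 2 * (\<Sum>\<^sub>\<infinity>h\<in>H. (cmod (y n h))\<^sup>2))"
    unfolding l2_sq_def by (rule sum_mono)
  then show ?thesis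
    by (simp add: l2_sq_def sum.distrib sum_distrib_left)
qed

lemma finite_sum_le_l2_sq:
  assumes "\<And>n. x n \<in> l2 H" and Y: "finite Y" "Y \<subseteq> H"
  shows "(\<Sum>n\<in>UNIV. \<Sum>h\<in>Y. (cmod (x n h))\<^sup>2) \<le> l2_sq H x"
  unfolding l2_sq_def using assms by (intro sum_mono finite_sum_le_infsum) (auto simp: l2_def)

lemma l2_sq_tendsto:
  assumes "\<And>n. x n \<in> l2 H"
  shows "((\<lambda>Y. \<Sum>n\<in>UNIV. \<Sum>h\<in>Y. (cmod (x n h))\<^sup>2) \<longlongrightarrow> l2_sq H x) (finite_subsets_at_top H)"
  unfolding l2_sq_def using assms by (intro tendsto_sum infsum_tendsto) (simp add: l2_def)

text \<open>A Fatou-type principle: membership in \<open>\<ell>\<^sup>2(H)\<close> and the norm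
  bound both come from finite partial sums, which are accessible by pointwise limits.\<close>

lemma l2I_bounded_partial_sums:
  assumes le: "\<And>Y. finite Y \<Longrightarrow> Y \<subseteq> H \<Longrightarrow> (\<Sum>n\<in>UNIV. \<Sum>h\<in>Y. (cmod (x n h))\<^sup>2) \<le> B"
  shows "x n \<in> l2 H" "l2_sq H x \<le> B"
proof -
  show l2: "x n \<in> l2 H" for n
    unfolding l2_def mem_Collect_eq
  proof (rule nonneg_bounded_partial_sums_imp_summable_on[where C = B])
    have "(\<Sum>h\<in>Y. (cmod (x n h))\<^sup>2) \<le> B" if "finite Y" "Y \<subseteq> H" for Y
    proof -
      have "(\<Sum>h\<in>Y. (cmod (x n h))\<^sup>2) \<le> (\<Sum>n\<in>UNIV. \<Sum>h\<in>Y. (cmod (x n h))\<^sup>2)"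
        by (rule member_le_sum[where f = "\<lambda>n. \<Sum>h\<in>Y. (cmod (x n h))\<^sup>2"]) (auto intro!: sum_nonneg)
      also have "\<dots> \<le> B"
        by (rule le[OF that])
      finally show ?thesis .
    qed
    then show "\<forall>\<^sub>F Y in finite_subsets_at_top H. (\<Sum>h\<in>Y. (cmod (x n h))\<^sup>2) \<le> B"
      by (rule eventually_finite_subsets_at_top_weakI)
  qed simp
  show "l2_sq H x \<le> B"
    by (rule tendsto_upperbound[OF l2_sq_tendsto[OF l2] eventually_finite_subsets_at_top_weakI[OF le]])
      simp_all
qed

text \<open>The kept and the discarded part have disjoint supports, so their squared norms add up.
  Hence the error of truncation tends to \<open>0\<close> as \<open>Y\<close> grows.\<close>

lemma l2_sq_truncated:
  assumes x: "\<And>n. x n \<in> l2 H" and Y: "finite Y" "Y \<subseteq> H"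
  shows "(\<lambda>h. if h \<in> Y then x n h else 0) \<in> l2 H"
    and "l2_sq H (\<lambda>n h. if h \<in> Y then x n h else 0) = (\<Sum>n\<in>UNIV. \<Sum>h\<in>Y. (cmod (x n h))\<^sup>2)"
    and "l2_sq H (\<lambda>n h. (if h \<in> Y then x n h else 0) - x n h) =
      l2_sq H x - (\<Sum>n\<in>UNIV. \<Sum>h\<in>Y. (cmod (x n h))\<^sup>2)"
proof -
  have s: "(\<lambda>h. (cmod (x n h))\<^sup>2) summable_on H" for n
    using x[of n] by (simp add: l2_def)
  show "(\<lambda>h. if h \<in> Y then x n h else 0) \<in> l2 H"
    unfolding l2_def mem_Collect_eq by (rule summable_on_comparison_test[OF s]) auto
  have "(\<Sum>\<^sub>\<infinity>h\<in>H. (cmod (if h \<in> Y then x n h else 0))\<^sup>2) = (\<Sum>\<^sub>\<infinity>h\<in>Y. (cmod (x n h))\<^sup>2)" for n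
    using Y by (intro infsum_cong_neutral) auto
  then show "l2_sq H (\<lambda>n h. if h \<in> Y then x n h else 0) = (\<Sum>n\<in>UNIV. \<Sum>h\<in>Y. (cmod (x n h))\<^sup>2)"
    using Y by (simp add: l2_sq_def)
  have "(\<Sum>\<^sub>\<infinity>h\<in>H. (cmod ((if h \<in> Y then x n h else 0) - x n h))\<^sup>2) = (\<Sum>\<^sub>\<infinity>h\<in>H - Y. (cmod (x n h))\<^sup>2)" for n
    by (intro infsum_cong_neutral) auto
  also have "\<dots> n = (\<Sum>\<^sub>\<infinity>h\<in>H. (cmod (x n h))\<^sup>2) - (\<Sum>h\<in>Y. (cmod (x n h))\<^sup>2)" for n
    using Y s by (subst infsum_Diff) auto
  finally show "l2_sq H (\<lambda>n h. (if h \<in> Y then x n h else 0) - x n h) =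
      l2_sq H x - (\<Sum>n\<in>UNIV. \<Sum>h\<in>Y. (cmod (x n h))\<^sup>2)"
    by (simp add: l2_sq_def sum_subtractf)
qed

context discrete_dual
begin

section \<open>Convolution with a matrix of sequences\<close>

lemma bij_betw_reflect: "t \<in> H \<Longrightarrow> bij_betw (\<lambda>h. t - h) H H"
  by (rule bij_betw_byWitness[where f' = "\<lambda>h. t - h"]) (auto simp: subgroupD)

lemma convolution_summable:
  assumes a: "a \<in> l2 H" and x: "x \<in> l2 H" and t: "t \<in> H"
  shows "(\<lambda>h. a (t - h) * x h) summable_on H"
proof (rule abs_summable_summable, rule abs_summable_product)
  show "(\<lambda>h. cmod (a (t - h) * a (t - h))) summable_on H"
    using a summable_on_reindex_bij_betw[OF bij_betw_reflect[OF t], of "\<lambda>h. (cmod (a h))\<^sup>2"]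
    by (simp add: l2_def norm_mult power2_eq_square)
  show "(\<lambda>h. cmod (x h * x h)) summable_on H"
    using x by (simp add: l2_def norm_mult power2_eq_square)
qed

lemma matrix_convolution_add:
  assumes A: "\<And>m n. A $ m $ n \<in> l2 H" and x: "\<And>n. x n \<in> l2 H" and y: "\<And>n. y n \<in> l2 H" and t: "t \<in> H"
  shows "matrix_convolution H A (\<lambda>n h. x n h + y n h) m t = matrix_convolution H A x m t + matrix_convolution H A y m t"
  unfolding matrix_convolution_def convolution_def distrib_left
  by (simp add: infsum_add[OF convolution_summable[OF A x t] convolution_summable[OF A y t]] sum.distrib)

lemma matrix_convolution_cmult:
  "matrix_convolution H A (\<lambda>n h. c * x n h) m t = c * matrix_convolution H A x m t"
proof -
  have "(\<Sum>\<^sub>\<infinity>h\<in>H. a (t - h) * (c * y h)) = c * (\<Sum>\<^sub>\<infinity>h\<in>H. a (t - h) * y h)" for a y :: "'g \<Rightarrow> complex"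
    using infsum_cmult_right'[of c "\<lambda>h. a (t - h) * y h" H] by (simp add: mult.left_commute)
  then show ?thesis
    by (simp add: matrix_convolution_def convolution_def sum_distrib_left)
qed

text \<open>This commutation with translations is the source of the \<open>H\<close>-symmetry of the
  sampling functionals, and finally of the form \<open>S m (s - t)\<close> of the expansion.\<close>

lemma matrix_convolution_shift:
  assumes s: "s \<in> H"
  shows "matrix_convolution H A (\<lambda>n h. x n (h - s)) m t = matrix_convolution H A x m (t - s)"
proof -
  have "(\<Sum>\<^sub>\<infinity>h\<in>H. a (t - h) * y (h - s)) = (\<Sum>\<^sub>\<infinity>h\<in>H. a (t - s - h) * y h)" for a y :: "'g \<Rightarrow> complex"
  proof -
    have "(\<Sum>\<^sub>\<infinity>h\<in>H. a (t - h) * y (h - s)) = (\<Sum>\<^sub>\<infinity>h\<in>H. (\<lambda>h. a (t - s - h) * y h) (h - s))"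
      by (intro infsum_cong) (simp add: algebra_simps)
    also have "\<dots> = (\<Sum>\<^sub>\<infinity>h\<in>H. a (t - s - h) * y h)"
      by (rule infsum_reindex_bij_betw[OF bij_betw_shift[OF subgroup s]])
    finally show ?thesis .
  qed
  then show ?thesis
    by (simp add: matrix_convolution_def convolution_def)
qed

lemma matrix_convolution_truncated:
  assumes Y: "finite Y" "Y \<subseteq> H"
  shows "matrix_convolution H A (\<lambda>n h. if h \<in> Y then x n h else 0) m t =
    (\<Sum>n\<in>UNIV. \<Sum>h\<in>Y. x n h * (A $ m $ n) (t - h))"
proof -
  have "(\<Sum>\<^sub>\<infinity>h\<in>H. a (t - h) * (if h \<in> Y then y h else 0)) = (\<Sum>h\<in>Y. y h * a (t - h))" for a y :: "'g \<Rightarrow> complex"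
  proof -
    have "(\<Sum>\<^sub>\<infinity>h\<in>H. a (t - h) * (if h \<in> Y then y h else 0)) = (\<Sum>\<^sub>\<infinity>h\<in>Y. y h * a (t - h))"
      using Y by (intro infsum_cong_neutral) auto
    then show ?thesis
      using Y by simp
  qed
  then show ?thesis
    by (simp add: matrix_convolution_def convolution_def)
qed

text \<open>For finitely supported \<open>x\<close> the convolution \<open>b\<close> is a finite
  combination of translates of the entries of \<open>A\<close>. Its transform is therefore the
  transfer matrix applied to the vector \<open>v\<close> of trigonometric polynomials, and
  integrating the pointwise matrix bounds gives the estimates by Plancherel on both sides.\<close>

lemma finite_convolution_bounds:
  fixes A :: "('g \<Rightarrow> complex)^'n^'m::finite" and Ahat :: "('g \<Rightarrow> complex) \<Rightarrow> complex^'n^'m"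
    and x :: "'n \<Rightarrow> 'g \<Rightarrow> complex"
  assumes four: "\<And>m n. is_fourier_l2 H \<nu> (A $ m $ n) (\<lambda>\<xi>. Ahat \<xi> $ m $ n)"
    and AE: "AE \<xi> in \<nu>. \<forall>v.
      (\<Sum>n\<in>UNIV. (cmod (v $ n))\<^sup>2) \<le> D * (\<Sum>m\<in>UNIV. (cmod ((Ahat \<xi> *v v) $ m))\<^sup>2) \<and>
      (\<Sum>m\<in>UNIV. (cmod ((Ahat \<xi> *v v) $ m))\<^sup>2) \<le> C * (\<Sum>n\<in>UNIV. (cmod (v $ n))\<^sup>2)"
    and D: "0 < D" and C: "0 \<le> C" and Y: "finite Y" "Y \<subseteq> H"
  defines "b \<equiv> \<lambda>m t. \<Sum>n\<in>UNIV. \<Sum>h\<in>Y. x n h * (A $ m $ n) (t - h)"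
  shows "b m \<in> l2 H" "(\<Sum>n\<in>UNIV. \<Sum>h\<in>Y. (cmod (x n h))\<^sup>2) \<le> D * l2_sq H b"
    "l2_sq H b \<le> C * (\<Sum>n\<in>UNIV. \<Sum>h\<in>Y. (cmod (x n h))\<^sup>2)"
proof -
  define v :: "('g \<Rightarrow> complex) \<Rightarrow> complex^'n" where "v \<xi> = (\<chi> n. \<Sum>h\<in>Y. x n h * cnj (\<xi> h))" for \<xi>
  have Av: "(\<Sum>n\<in>UNIV. \<Sum>h\<in>Y. x n h * cnj (\<xi> h) * Ahat \<xi> $ m $ n) = (Ahat \<xi> *v v \<xi>) $ m" for m \<xi>
    by (simp add: matrix_vector_mult_def v_def sum_distrib_left mult.commute)
  have b: "is_fourier_l2 H \<nu> (b m) (\<lambda>\<xi>. (Ahat \<xi> *v v \<xi>) $ m)" for m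
    unfolding b_def Av[symmetric] using Y
    by (intro is_fourier_l2_sum is_fourier_l2_cmult_shift four) auto
  show l2: "b m \<in> l2 H" for m
    using b[of m] by (simp add: is_fourier_l2_def)
  have [measurable]: "(\<lambda>\<xi>. (Ahat \<xi> *v v \<xi>) $ m) \<in> borel_measurable \<nu>" for m
    using b[of m] by (simp add: is_fourier_l2_def)
  have [measurable]: "(\<lambda>\<xi>. v \<xi> $ n) \<in> borel_measurable \<nu>" for n
    unfolding v_def vec_lambda_beta using Y(2)
    by (intro borel_measurable_sum borel_measurable_times borel_measurable_const cnj_eval_measurable) auto
  have Nb: "ennreal (l2_sq H b) = (\<integral>\<^sup>+ \<xi>. ennreal (\<Sum>m\<in>UNIV. (cmod ((Ahat \<xi> *v v \<xi>) $ m))\<^sup>2) \<partial>\<nu>)"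
  proof -
    have "ennreal (l2_sq H b) = (\<Sum>m\<in>UNIV. ennreal (\<Sum>\<^sub>\<infinity>t\<in>H. (cmod (b m t))\<^sup>2))"
      unfolding l2_sq_def by (subst sum_ennreal) (auto intro!: infsum_nonneg)
    also have "\<dots> = (\<Sum>m\<in>UNIV. \<integral>\<^sup>+ \<xi>. ennreal ((cmod ((Ahat \<xi> *v v \<xi>) $ m))\<^sup>2) \<partial>\<nu>)"
      using plancherel[OF b] by (simp add: L2_dist_sq_def)
    also have "\<dots> = (\<integral>\<^sup>+ \<xi>. ennreal (\<Sum>m\<in>UNIV. (cmod ((Ahat \<xi> *v v \<xi>) $ m))\<^sup>2) \<partial>\<nu>)"
      by (subst nn_integral_sum[symmetric]) (auto simp: sum_ennreal)
    finally show ?thesis .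
  qed
  have Nx: "ennreal (\<Sum>n\<in>UNIV. \<Sum>h\<in>Y. (cmod (x n h))\<^sup>2) = (\<integral>\<^sup>+ \<xi>. ennreal (\<Sum>n\<in>UNIV. (cmod (v \<xi> $ n))\<^sup>2) \<partial>\<nu>)"
  proof -
    have "ennreal (\<Sum>n\<in>UNIV. \<Sum>h\<in>Y. (cmod (x n h))\<^sup>2) = (\<Sum>n\<in>UNIV. ennreal (\<Sum>h\<in>Y. (cmod (x n h))\<^sup>2))"
      by (subst sum_ennreal) (auto intro!: sum_nonneg)
    also have "\<dots> = (\<Sum>n\<in>UNIV. \<integral>\<^sup>+ \<xi>. ennreal ((cmod (v \<xi> $ n))\<^sup>2) \<partial>\<nu>)"
      unfolding v_def vec_lambda_beta by (intro sum.cong refl) (rule plancherel_finite[OF Y, symmetric])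
    also have "\<dots> = (\<integral>\<^sup>+ \<xi>. ennreal (\<Sum>n\<in>UNIV. (cmod (v \<xi> $ n))\<^sup>2) \<partial>\<nu>)"
      by (subst nn_integral_sum[symmetric]) (auto simp: sum_ennreal)
    finally show ?thesis .
  qed
  have Nx0: "0 \<le> (\<Sum>n\<in>UNIV. \<Sum>h\<in>Y. (cmod (x n h))\<^sup>2)"
    by (intro sum_nonneg) auto
  have "ennreal (\<Sum>n\<in>UNIV. \<Sum>h\<in>Y. (cmod (x n h))\<^sup>2) \<le>
      (\<integral>\<^sup>+ \<xi>. ennreal D * ennreal (\<Sum>m\<in>UNIV. (cmod ((Ahat \<xi> *v v \<xi>) $ m))\<^sup>2) \<partial>\<nu>)"
    unfolding Nx using AE
    by (intro nn_integral_mono_AE, eventually_elim)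
      (use D in \<open>auto simp: ennreal_mult[symmetric] sum_nonneg intro!: ennreal_leI\<close>)
  also have "\<dots> = ennreal (D * l2_sq H b)"
    using D l2_sq_nonneg[of H b] by (simp add: nn_integral_cmult Nb[symmetric] ennreal_mult)
  finally show "(\<Sum>n\<in>UNIV. \<Sum>h\<in>Y. (cmod (x n h))\<^sup>2) \<le> D * l2_sq H b"
    using D l2_sq_nonneg[of H b] by (subst (asm) ennreal_le_iff) auto
  have "ennreal (l2_sq H b) \<le> (\<integral>\<^sup>+ \<xi>. ennreal C * ennreal (\<Sum>n\<in>UNIV. (cmod (v \<xi> $ n))\<^sup>2) \<partial>\<nu>)"
    unfolding Nb using AE
    by (intro nn_integral_mono_AE, eventually_elim)
      (use C in \<open>auto simp: ennreal_mult[symmetric] sum_nonneg intro!: ennreal_leI\<close>)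
  also have "\<dots> = ennreal (C * (\<Sum>n\<in>UNIV. \<Sum>h\<in>Y. (cmod (x n h))\<^sup>2))"
    using C Nx0 by (simp add: nn_integral_cmult Nx[symmetric] ennreal_mult)
  finally show "l2_sq H b \<le> C * (\<Sum>n\<in>UNIV. \<Sum>h\<in>Y. (cmod (x n h))\<^sup>2)"
    using C Nx0 by (subst (asm) ennreal_le_iff) auto
qed

text \<open>Extension of the finite case by truncation. The upper bound has to come before the lower
  one, because the lower bound is passed to the limit by controlling the convolution of the
  discarded tail.\<close>

lemma matrix_convolution_bounds:
  fixes A :: "('g \<Rightarrow> complex)^'n^'m::finite" and Ahat :: "('g \<Rightarrow> complex) \<Rightarrow> complex^'n^'m"
  assumes four: "\<And>m n. is_fourier_l2 H \<nu> (A $ m $ n) (\<lambda>\<xi>. Ahat \<xi> $ m $ n)"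
    and Linf: "\<And>m n. in_Linfty \<nu> (\<lambda>\<xi>. Ahat \<xi> $ m $ n)"
    and det: "0 < essinf \<nu> (\<lambda>\<xi>. ereal (Re (det (conj_transpose (Ahat \<xi>) ** Ahat \<xi>))))"
  shows "\<exists>D C. 0 < D \<and> 0 \<le> C \<and> (\<forall>x. (\<forall>n. x n \<in> l2 H) \<longrightarrow>
    (\<forall>m. matrix_convolution H A x m \<in> l2 H) \<and>
    l2_sq H x \<le> D * l2_sq H (matrix_convolution H A x) \<and>
    l2_sq H (matrix_convolution H A x) \<le> C * l2_sq H x)"
proof -
  obtain D C where D: "0 < D" and C: "0 \<le> C" and AE: "AE \<xi> in \<nu>. \<forall>v.
      (\<Sum>n\<in>UNIV. (cmod (v $ n))\<^sup>2) \<le> D * (\<Sum>m\<in>UNIV. (cmod ((Ahat \<xi> *v v) $ m))\<^sup>2) \<and>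
      (\<Sum>m\<in>UNIV. (cmod ((Ahat \<xi> *v v) $ m))\<^sup>2) \<le> C * (\<Sum>n\<in>UNIV. (cmod (v $ n))\<^sup>2)"
    using transfer_matrix_bounds[OF Linf det] by blast
  have A: "A $ m $ n \<in> l2 H" for m n
    using four[of m n] by (simp add: is_fourier_l2_def)
  note fin = finite_convolution_bounds[OF four AE D C]
  define trunc where "trunc x Y n h = (if h \<in> Y then x n h else 0)" for x :: "'n \<Rightarrow> 'g \<Rightarrow> complex" and Y n h
  have conv_trunc: "matrix_convolution H A (trunc x Y) = (\<lambda>m t. \<Sum>n\<in>UNIV. \<Sum>h\<in>Y. x n h * (A $ m $ n) (t - h))"
    if "finite Y" "Y \<subseteq> H" for x Y
    unfolding trunc_def using matrix_convolution_truncated[OF that] by (intro ext)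
  \<comment> \<open>A finite \<open>Z\<close> involves finitely many values of the convolution. Each
    is the limit of its truncations, which satisfy the bound by the finite case.\<close>
  have up: "(\<Sum>m\<in>UNIV. \<Sum>t\<in>Z. (cmod (matrix_convolution H A x m t))\<^sup>2) \<le> C * l2_sq H x"
    if x: "\<And>n. x n \<in> l2 H" and Z: "finite Z" "Z \<subseteq> H" for x Z
  proof (rule tendsto_upperbound)
    show "((\<lambda>Y. \<Sum>m\<in>UNIV. \<Sum>t\<in>Z. (cmod (\<Sum>n\<in>UNIV. \<Sum>h\<in>Y. x n h * (A $ m $ n) (t - h)))\<^sup>2)
        \<longlongrightarrow> (\<Sum>m\<in>UNIV. \<Sum>t\<in>Z. (cmod (matrix_convolution H A x m t))\<^sup>2)) (finite_subsets_at_top H)"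
      unfolding matrix_convolution_def convolution_def
    proof (intro tendsto_sum tendsto_power tendsto_norm)
      fix m n t assume "t \<in> Z"
      then show "((\<lambda>Y. \<Sum>h\<in>Y. x n h * (A $ m $ n) (t - h)) \<longlongrightarrow> (\<Sum>\<^sub>\<infinity>h\<in>H. (A $ m $ n) (t - h) * x n h))
          (finite_subsets_at_top H)"
        using infsum_tendsto[OF convolution_summable[OF A x, of t]] Z by (auto simp: mult.commute)
    qed
    have "(\<Sum>m\<in>UNIV. \<Sum>t\<in>Z. (cmod (\<Sum>n\<in>UNIV. \<Sum>h\<in>Y. x n h * (A $ m $ n) (t - h)))\<^sup>2) \<le> C * l2_sq H x"
      if Y: "finite Y" "Y \<subseteq> H" for Y
    proof -
      define b where "b m t = (\<Sum>n\<in>UNIV. \<Sum>h\<in>Y. x n h * (A $ m $ n) (t - h))" for m t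
      have b: "b m \<in> l2 H" for m
        unfolding b_def by (rule fin(1)[OF Y])
      have "(\<Sum>m\<in>UNIV. \<Sum>t\<in>Z. (cmod (b m t))\<^sup>2) \<le> l2_sq H b"
        by (rule finite_sum_le_l2_sq[of b, OF b Z])
      also have "\<dots> \<le> C * (\<Sum>n\<in>UNIV. \<Sum>h\<in>Y. (cmod (x n h))\<^sup>2)"
        unfolding b_def by (rule fin(3)[OF Y])
      also have "\<dots> \<le> C * l2_sq H x"
        by (intro mult_left_mono C finite_sum_le_l2_sq[of x, OF x Y])
      finally show ?thesis
        by (simp add: b_def)
    qed
    then show "\<forall>\<^sub>F Y in finite_subsets_at_top H.
        (\<Sum>m\<in>UNIV. \<Sum>t\<in>Z. (cmod (\<Sum>n\<in>UNIV. \<Sum>h\<in>Y. x n h * (A $ m $ n) (t - h)))\<^sup>2) \<le> C * l2_sq H x"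
      by (rule eventually_finite_subsets_at_top_weakI)
  qed simp
  have upper: "matrix_convolution H A x m \<in> l2 H" "l2_sq H (matrix_convolution H A x) \<le> C * l2_sq H x"
    if x: "\<And>n. x n \<in> l2 H" for x m
    using l2I_bounded_partial_sums[OF up[OF x]] by auto
  have lower: "l2_sq H x \<le> (2 * D) * l2_sq H (matrix_convolution H A x)" if x: "\<And>n. x n \<in> l2 H" for x
  proof -
    define p where "p Y = (\<Sum>n\<in>UNIV. \<Sum>h\<in>Y. (cmod (x n h))\<^sup>2)" for Y
    define N where "N = l2_sq H (matrix_convolution H A x)"
    \<comment> \<open>The truncation is \<open>x + w\<close>, where \<open>w\<close> is minus the
      discarded tail; the factors \<open>2\<close> come from \<open>l2_sq_add_le\<close>. As
      \<open>Y\<close> grows, \<open>p Y\<close> tends to \<open>l2_sq H x\<close>, the tail term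
      disappears and \<open>2 * D * N\<close> remains.\<close>
    have le: "p Y \<le> D * (2 * N + 2 * (C * (l2_sq H x - p Y)))" if Y: "finite Y" "Y \<subseteq> H" for Y
    proof -
      define w where "w n h = trunc x Y n h - x n h" for n h
      have w: "w n \<in> l2 H" for n
        unfolding w_def trunc_def by (intro l2_diff l2_sq_truncated(1)[of x, OF x Y] x)
      have w_sq: "l2_sq H w = l2_sq H x - p Y"
        unfolding w_def trunc_def p_def by (rule l2_sq_truncated(3)[of x, OF x Y])
      have split: "trunc x Y = (\<lambda>n h. x n h + w n h)"
        by (simp add: w_def)
      have "l2_sq H (matrix_convolution H A (trunc x Y)) =
          l2_sq H (\<lambda>m t. matrix_convolution H A x m t + matrix_convolution H A w m t)"
        unfolding l2_sq_def split
        by (intro sum.cong refl infsum_cong) (simp add: matrix_convolution_add[of A x w, OF A x w])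
      also have "\<dots> \<le> 2 * N + 2 * l2_sq H (matrix_convolution H A w)"
        unfolding N_def by (intro l2_sq_add_le upper x w)
      also have "\<dots> \<le> 2 * N + 2 * (C * (l2_sq H x - p Y))"
        using upper(2)[of w, OF w] by (simp add: w_sq)
      finally have "D * l2_sq H (matrix_convolution H A (trunc x Y)) \<le> D * (2 * N + 2 * (C * (l2_sq H x - p Y)))"
        using D by (intro mult_left_mono) auto
      then show ?thesis
        using fin(2)[OF Y, where x = x] unfolding conv_trunc[OF Y] p_def by simp
    qed
    have lim: "(p \<longlongrightarrow> l2_sq H x) (finite_subsets_at_top H)"
      unfolding p_def by (rule l2_sq_tendsto[of x, OF x])
    have "((\<lambda>Y. D * (2 * N + 2 * (C * (l2_sq H x - p Y)))) \<longlongrightarrow> D * (2 * N + 2 * (C * (l2_sq H x - l2_sq H x))))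
        (finite_subsets_at_top H)"
      by (intro tendsto_intros lim)
    then have "l2_sq H x \<le> D * (2 * N + 2 * (C * (l2_sq H x - l2_sq H x)))"
      by (rule tendsto_le[rotated, OF _ lim eventually_finite_subsets_at_top_weakI[OF le]]) simp_all
    then show ?thesis
      by (simp add: N_def mult_ac)
  qed
  show ?thesis
    using D C upper lower by (intro exI[of _ "2 * D"] exI[of _ C]) auto
qed

end

section \<open>Equivalent inner products\<close>

text \<open>The first-order condition at a minimum: for small \<open>t\<close> of sign opposite to
  \<open>a\<close> the linear term would dominate. The \<open>1\<close> in \<open>d\<close> keeps
  the denominator of \<open>t\<close> positive.\<close>

lemma linear_coefficient_eq_0:
  fixes a b :: real
  assumes nonneg: "\<And>t. 0 \<le> 2 * t * a + t\<^sup>2 * b"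
  shows "a = 0"
proof (rule ccontr)
  assume "a \<noteq> 0"
  define d where "d = \<bar>b\<bar> + 1"
  define t where "t = - a / d"
  have d: "d > 0" "b \<le> d"
    by (simp_all add: d_def)
  have td: "t * d = - a"
    using d by (simp add: t_def)
  have "0 \<le> 2 * t * a + t\<^sup>2 * d"
    using nonneg[of t] mult_left_mono[OF d(2), of "t\<^sup>2"] by simp
  also have "t\<^sup>2 * d = - t * a"
    using td by (simp add: power2_eq_square mult.assoc)
  also have "2 * t * a + - t * a = - (a\<^sup>2 / d)"
    by (simp add: t_def power2_eq_square)
  finally show False
    using \<open>a \<noteq> 0\<close> d(1) by (simp add: divide_le_0_iff)
qed

text \<open>Two finite sums that extend a common \<open>X0\<close> differ from it by sums over
  disjoint remainders, whose squared norm is at most a tail of \<open>b\<close>. This is a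
  convergence criterion for series of orthogonal type, which need not converge absolutely in
  norm.\<close>

lemma summable_on_if_norm_sum_le:
  fixes v :: "'i \<Rightarrow> 'b::banach" and b :: "'i \<Rightarrow> real"
  assumes le: "\<And>X. finite X \<Longrightarrow> X \<subseteq> J \<Longrightarrow> (norm (sum v X))\<^sup>2 \<le> sum b X" and b: "b summable_on J"
  shows "v summable_on J"
proof -
  have "cauchy_filter (filtermap (sum v) (finite_subsets_at_top J))"
    unfolding cauchy_filter_metric_filtermap
  proof (intro allI impI)
    fix e :: real assume e: "e > 0"
    \<comment> \<open>Two partial sums of \<open>b\<close> within \<open>d\<close> of the limit
      differ by less than \<open>2 * d\<close>, that is \<open>e\<^sup>2 / 8\<close>, which is below
      \<open>(e / 2)\<^sup>2\<close>.\<close>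
    define d where "d = e\<^sup>2 / 16"
    have "d > 0"
      using e by (simp add: d_def)
    moreover have "(sum b \<longlongrightarrow> infsum b J) (finite_subsets_at_top J)"
      using b by (simp add: infsum_tendsto)
    ultimately have "\<forall>\<^sub>F X in finite_subsets_at_top J. dist (sum b X) (infsum b J) < d"
      by (simp add: tendsto_iff)
    then obtain X0 where X0: "finite X0" "X0 \<subseteq> J"
      and near: "\<And>X. finite X \<Longrightarrow> X0 \<subseteq> X \<Longrightarrow> X \<subseteq> J \<Longrightarrow> dist (sum b X) (infsum b J) < d"
      unfolding eventually_finite_subsets_at_top by metis
    have half: "dist (sum v X) (sum v X0) < e / 2" if X: "finite X" "X0 \<subseteq> X" "X \<subseteq> J" for X
    proof -
      have "(dist (sum v X) (sum v X0))\<^sup>2 = (norm (sum v (X - X0)))\<^sup>2"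
        using X by (simp add: dist_norm sum_diff)
      also have "\<dots> \<le> sum b (X - X0)"
        using X by (intro le) auto
      also have "\<dots> = sum b X - sum b X0"
        using X by (simp add: sum_diff)
      also have "\<dots> < 2 * d"
        using near[OF X] near[OF X0(1) order_refl X0(2)] by (simp add: dist_real_def)
      also have "\<dots> < (e / 2)\<^sup>2"
        using e by (simp add: d_def power_divide)
      finally show ?thesis
        by (rule power2_less_imp_less) (use e in simp)
    qed
    show "\<exists>P. eventually P (finite_subsets_at_top J) \<and>
        (\<forall>X Y. P X \<and> P Y \<longrightarrow> dist (sum v X) (sum v Y) < e)"
    proof (intro exI[of _ "\<lambda>X. finite X \<and> X0 \<subseteq> X \<and> X \<subseteq> J"] conjI allI impI)
      show "\<forall>\<^sub>F X in finite_subsets_at_top J. finite X \<and> X0 \<subseteq> X \<and> X \<subseteq> J"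
        unfolding eventually_finite_subsets_at_top using X0 by (intro exI[of _ X0]) simp
      fix X Y
      assume "(finite X \<and> X0 \<subseteq> X \<and> X \<subseteq> J) \<and> (finite Y \<and> X0 \<subseteq> Y \<and> Y \<subseteq> J)"
      then have "dist (sum v X) (sum v X0) < e / 2" "dist (sum v Y) (sum v X0) < e / 2"
        using half by simp_all
      then show "dist (sum v X) (sum v Y) < e"
        by (rule dist_triangle_half_l)
    qed
  qed
  moreover have "complete (UNIV :: 'b set)"
    by (meson Cauchy_convergent UNIV_I complete_def convergent_def)
  ultimately obtain l where "(sum v \<longlongrightarrow> l) (finite_subsets_at_top J)"
    using complete_uniform[where S = UNIV] by (force simp: filterlim_def)
  then show ?thesis
    by (auto simp: summable_on_def has_sum_def)
qed

text \<open>An inner product on \<open>V\<close> equivalent to the ambient norm. It is instantiated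
  by \<open>cinner\<close> itself, by the form built from the samples, and by the
  \<open>L\<^sup>2(G)\<close> product of voice transforms.\<close>

locale hermitian_form =
  fixes V :: "'h::complex_hilbert set" and q :: "'h \<Rightarrow> 'h \<Rightarrow> complex" and c C :: real
  assumes subspace: "complex_vec.subspace V"
    and add_left: "x \<in> V \<Longrightarrow> y \<in> V \<Longrightarrow> z \<in> V \<Longrightarrow> q (x + y) z = q x z + q y z"
    and scale_left: "x \<in> V \<Longrightarrow> y \<in> V \<Longrightarrow> q (a *\<^sub>C x) y = a * q x y"
    and commute: "x \<in> V \<Longrightarrow> y \<in> V \<Longrightarrow> q x y = cnj (q y x)"
    and c_pos: "0 < c"
    and C_nonneg: "0 \<le> C"
    and lower: "x \<in> V \<Longrightarrow> c * (norm x)\<^sup>2 \<le> Re (q x x)"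
    and upper: "x \<in> V \<Longrightarrow> Re (q x x) \<le> C * (norm x)\<^sup>2"
begin

lemma in_space:
  "0 \<in> V" "x \<in> V \<Longrightarrow> y \<in> V \<Longrightarrow> x + y \<in> V" "x \<in> V \<Longrightarrow> a *\<^sub>C x \<in> V"
  "x \<in> V \<Longrightarrow> y \<in> V \<Longrightarrow> x - y \<in> V"
  using complex_vec.subspace_0 complex_vec.subspace_add complex_vec.subspace_scale
    complex_vec.subspace_diff subspace by blast+

lemma sum_in_space: "(\<And>i. i \<in> X \<Longrightarrow> f i \<in> V) \<Longrightarrow> sum f X \<in> V"
  by (rule complex_vec.subspace_sum[OF subspace])

lemma add_right: "x \<in> V \<Longrightarrow> y \<in> V \<Longrightarrow> z \<in> V \<Longrightarrow> q z (x + y) = q z x + q z y"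
  by (metis add_left commute complex_cnj_add in_space(2))

lemma scale_right: "x \<in> V \<Longrightarrow> y \<in> V \<Longrightarrow> q x (a *\<^sub>C y) = cnj a * q x y"
  by (metis scale_left commute complex_cnj_mult in_space(3))

lemma diff_left: "x \<in> V \<Longrightarrow> y \<in> V \<Longrightarrow> z \<in> V \<Longrightarrow> q (x - y) z = q x z - q y z"
  by (metis add_diff_cancel_right' add_left diff_add_cancel in_space(4))

lemma diff_right: "x \<in> V \<Longrightarrow> y \<in> V \<Longrightarrow> z \<in> V \<Longrightarrow> q z (x - y) = q z x - q z y"
  by (metis add_diff_cancel_right' add_right diff_add_cancel in_space(4))

lemma zero_left: "x \<in> V \<Longrightarrow> q 0 x = 0"
  using diff_left[of x x x] by simp

lemma sum_left:
  assumes "\<And>i. i \<in> X \<Longrightarrow> f i \<in> V" "y \<in> V"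
  shows "q (\<Sum>i\<in>X. f i) y = (\<Sum>i\<in>X. q (f i) y)"
  using assms
  by (induction X rule: infinite_finite_induct) (simp_all add: zero_left add_left sum_in_space)

lemma self_nonneg: "x \<in> V \<Longrightarrow> 0 \<le> Re (q x x)"
  using lower[of x] c_pos by (meson mult_nonneg_nonneg order_less_imp_le order_trans zero_le_power2)

lemma self_real: "x \<in> V \<Longrightarrow> q x x = complex_of_real (Re (q x x))"
  using commute[of x x] by (metis Reals_cnj_iff of_real_Re)

lemma cauchy_schwarz:
  assumes x: "x \<in> V" and y: "y \<in> V"
  shows "(cmod (q x y))\<^sup>2 \<le> Re (q x x) * Re (q y y)"
proof -
  define s where "s = Re (q x x)"
  define t where "t = Re (q y y)"
  define a where "a = q x y"
  have qq: "q x x = complex_of_real s" "q y y = complex_of_real t" "q y x = cnj a"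
    using self_real x y commute[of y x] by (simp_all add: s_def t_def a_def)
  have "y = 0" if "t = 0"
  proof -
    have "c * (norm y)\<^sup>2 \<le> 0"
      using lower[OF y] that by (simp add: t_def)
    then show ?thesis
      using c_pos by (simp add: mult_le_0_iff)
  qed
  then have t0: "a = 0" if "t = 0"
    using that zero_left[OF x] commute[OF x y] by (simp add: a_def)
  \<comment> \<open>\<open>z\<close> is \<open>t\<close> times the component of \<open>x\<close>
    orthogonal to \<open>y\<close>; this scaling avoids a division by \<open>t\<close>.\<close>
  define z where "z = complex_of_real t *\<^sub>C x - a *\<^sub>C y"
  have "q z z = complex_of_real t * (complex_of_real t * complex_of_real s)
      - complex_of_real t * (cnj a * a) - a * (complex_of_real t * cnj a) + a * (cnj a * complex_of_real t)"
    unfolding z_def using x y in_space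
    by (simp add: diff_left diff_right scale_left scale_right qq a_def[symmetric] algebra_simps)
  also have "\<dots> = complex_of_real (t * (t * s - (cmod a)\<^sup>2))"
    by (simp add: complex_norm_square algebra_simps flip: of_real_power)
  finally have "0 \<le> t * (t * s - (cmod a)\<^sup>2)"
    using self_nonneg[of z] x y in_space by (simp add: z_def)
  moreover have "0 \<le> t"
    using self_nonneg[OF y] by (simp add: t_def)
  ultimately have "(cmod a)\<^sup>2 \<le> s * t"
    using t0 by (cases "t = 0") (auto simp: zero_le_mult_iff mult.commute)
  then show ?thesis
    by (simp add: a_def s_def t_def)
qed

lemma norm_form_le:
  assumes "x \<in> V" "y \<in> V"
  shows "cmod (q x y) \<le> C * norm x * norm y"
proof (cases "norm x = 0 \<or> norm y = 0")
  case True
  then show ?thesis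
    using assms zero_left commute[of x y] by auto
next
  case False
  have "(cmod (q x y))\<^sup>2 \<le> (C * (norm x)\<^sup>2) * (C * (norm y)\<^sup>2)"
    using cauchy_schwarz[OF assms] upper assms self_nonneg
    by (meson C_nonneg mult_mono order_trans mult_nonneg_nonneg zero_le_power2)
  also have "\<dots> = (C * norm x * norm y)\<^sup>2"
    by (simp add: power2_eq_square)
  finally show ?thesis
    by (rule power2_le_imp_le) (use C_nonneg in auto)
qed

lemma form_tendsto_left:
  assumes f: "\<And>i. f i \<in> V" and l: "l \<in> V" and y: "y \<in> V" and lim: "(f \<longlongrightarrow> l) F"
  shows "((\<lambda>i. q (f i) y) \<longlongrightarrow> q l y) F"
proof (rule LIM_zero_cancel, rule Lim_null_comparison)
  show "\<forall>\<^sub>F i in F. norm (q (f i) y - q l y) \<le> C * norm (f i - l) * norm y"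
    using norm_form_le[OF in_space(4)[OF f l] y] by (simp add: diff_left f l y)
  have "((\<lambda>i. norm (f i - l)) \<longlongrightarrow> 0) F"
    using lim by (simp add: tendsto_norm_zero_iff LIM_zero_iff)
  then show "((\<lambda>i. C * norm (f i - l) * norm y) \<longlongrightarrow> 0) F"
    by (intro tendsto_mult_left_zero tendsto_mult_right_zero)
qed

text \<open>The representing vector minimizes \<open>J\<close>, which is bounded below by completing
  the square. The parallelogram identity makes a minimizing sequence Cauchy, completeness gives its
  limit \<open>g\<close>, and the vanishing first variation of \<open>J\<close> at \<open>g\<close>
  is the desired identity for real parts.\<close>

lemma riesz_representation:
  assumes closed: "closed V"
    and l_add: "\<And>x y. x \<in> V \<Longrightarrow> y \<in> V \<Longrightarrow> l (x + y) = l x + l y"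
    and l_scale: "\<And>a x. x \<in> V \<Longrightarrow> l (a *\<^sub>C x) = a * l x"
    and l_bound: "\<And>x. x \<in> V \<Longrightarrow> cmod (l x) \<le> K * norm x"
  shows "\<exists>g\<in>V. \<forall>x\<in>V. l x = q x g"
proof -
  define J where "J x = Re (q x x) - 2 * Re (l x)" for x
  have expand: "J (x + complex_of_real t *\<^sub>C w) =
      J x + 2 * t * (Re (q x w) - Re (l w)) + t\<^sup>2 * Re (q w w)" if x: "x \<in> V" and w: "w \<in> V" for x w t
  proof -
    have "Re (q w x) = Re (q x w)"
      using commute[OF x w] by simp
    then show ?thesis
      using x w by (simp add: J_def in_space add_left add_right scale_left scale_right l_add l_scale
          algebra_simps power2_eq_square)
  qed
  have J_lower: "- (K\<^sup>2 / c) \<le> J x" if x: "x \<in> V" for x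
  proof -
    have "0 \<le> (c * norm x - K)\<^sup>2 / c"
      using c_pos by simp
    also have "\<dots> = c * (norm x)\<^sup>2 - 2 * (K * norm x) + K\<^sup>2 / c"
      using c_pos by (simp add: power2_eq_square field_simps)
    also have "\<dots> \<le> J x + K\<^sup>2 / c"
      using lower[OF x] l_bound[OF x] complex_Re_le_cmod[of "l x"] by (simp add: J_def)
    finally show ?thesis
      by simp
  qed
  define d where "d = Inf (J ` V)"
  have bdd: "bdd_below (J ` V)"
    using J_lower by (intro bdd_belowI2)
  have d_le: "d \<le> J x" if "x \<in> V" for x
    unfolding d_def using bdd that by (intro cInf_lower) auto
  have "\<exists>x\<in>V. J x < d + inverse (real (Suc n))" for n
  proof -
    have "Inf (J ` V) < d + inverse (real (Suc n))" "J ` V \<noteq> {}"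
      using in_space(1) by (auto simp: d_def)
    then obtain y where "y \<in> J ` V" "y < d + inverse (real (Suc n))"
      by (elim cInf_lessD[elim_format] bexE)
    then show ?thesis
      by (elim imageE) auto
  qed
  then obtain f where f: "\<And>n. f n \<in> V" and Jf: "\<And>n. J (f n) < d + inverse (real (Suc n))"
    by metis
  \<comment> \<open>Parallelogram identity: \<open>Re (q w w)\<close> is twice the sum of the end
    values of \<open>J\<close> minus four times the value at the midpoint, and that value is at
    least \<open>d\<close>.\<close>
  have close: "c * (norm (y - x))\<^sup>2 \<le> 2 * J x + 2 * J y - 4 * d" if x: "x \<in> V" and y: "y \<in> V" for x y
  proof -
    define w where "w = y - x"
    have w: "w \<in> V" "y = x + complex_of_real 1 *\<^sub>C w"
      using x y in_space by (simp_all add: w_def)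
    have "d \<le> J (x + complex_of_real (1/2) *\<^sub>C w)"
      using x w(1) by (intro d_le in_space)
    moreover have "J y = J x + 2 * (Re (q x w) - Re (l w)) + Re (q w w)"
      using expand[OF x w(1), of 1] w(2) by simp
    ultimately have "Re (q w w) \<le> 2 * J x + 2 * J y - 4 * d"
      using expand[OF x w(1), of "1/2"] by (simp add: power2_eq_square)
    then show ?thesis
      using lower[OF w(1)] by (simp add: w_def)
  qed
  have "Cauchy f"
    unfolding Cauchy_iff
  proof (intro allI impI)
    fix e :: real assume e: "e > 0"
    \<comment> \<open>If both values of \<open>J\<close> exceed \<open>d\<close> by less than
      \<open>c * e\<^sup>2 / 4\<close>, the bound in \<open>close\<close> is below
      \<open>c * e\<^sup>2\<close>.\<close>
    obtain N where N: "inverse (real (Suc N)) < c * e\<^sup>2 / 4"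
      using reals_Archimedean[of "c * e\<^sup>2 / 4"] c_pos e by auto
    have Nmn: "norm (f m - f n) < e" if "N \<le> m" "N \<le> n" for m n
    proof -
      have small: "J (f k) < d + c * e\<^sup>2 / 4" if "N \<le> k" for k
      proof -
        have "inverse (real (Suc k)) \<le> inverse (real (Suc N))"
          using that by (intro le_imp_inverse_le) auto
        with N show ?thesis
          by (intro order_less_trans[OF Jf] add_strict_left_mono) (rule order_le_less_trans)
      qed
      have arith: "x < E" if "x \<le> 2 * u + 2 * v - 4 * d" "u < d + E / 4" "v < d + E / 4" for x u v E
        using that by linarith
      have "c * (norm (f m - f n))\<^sup>2 < c * e\<^sup>2"
        by (rule arith[OF close[OF f f] small small]) fact+
      then show ?thesis
        using c_pos by (intro power2_less_imp_less[OF _ order_less_imp_le[OF e]]) simp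
    qed
    show "\<exists>N. \<forall>m\<ge>N. \<forall>n\<ge>N. norm (f m - f n) < e"
      by (intro exI[of _ N] allI impI Nmn)
  qed
  then obtain g where g: "f \<longlonglongrightarrow> g"
    by (auto dest!: Cauchy_convergent simp: convergent_def)
  have gV: "g \<in> V"
    by (rule closed_sequentially[OF closed _ g]) (simp add: f)
  \<comment> \<open>Moving from \<open>f n\<close> along \<open>w\<close> cannot bring
    \<open>J\<close> below \<open>d\<close>, and \<open>J (f n)\<close> exceeds \<open>d\<close> by
    less than \<open>inverse (real (Suc n))\<close>; in the limit the variation at \<open>g\<close>
    is nonnegative.\<close>
  have Re_eq: "Re (l w) = Re (q w g)" if w: "w \<in> V" for w
  proof -
    have "0 \<le> 2 * t * (Re (q g w) - Re (l w)) + t\<^sup>2 * Re (q w w)" for t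
    proof (rule LIMSEQ_le_const)
      show "(\<lambda>n. inverse (real (Suc n)) + (2 * t * (Re (q (f n) w) - Re (l w)) + t\<^sup>2 * Re (q w w)))
          \<longlonglongrightarrow> 2 * t * (Re (q g w) - Re (l w)) + t\<^sup>2 * Re (q w w)"
        by (rule tendsto_eq_intros LIMSEQ_inverse_real_of_nat tendsto_Re
            form_tendsto_left[OF f gV w g] refl | simp)+
      have "0 \<le> inverse (real (Suc n)) + (2 * t * (Re (q (f n) w) - Re (l w)) + t\<^sup>2 * Re (q w w))" for n
        using d_le[OF in_space(2)[OF f in_space(3)[OF w]], of n "complex_of_real t"]
          expand[OF f w, of n t] Jf[of n] by linarith
      then show "\<exists>N. \<forall>n\<ge>N. 0 \<le> inverse (real (Suc n)) +
          (2 * t * (Re (q (f n) w) - Re (l w)) + t\<^sup>2 * Re (q w w))"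
        by blast
    qed
    then have "Re (q g w) - Re (l w) = 0"
      by (rule linear_coefficient_eq_0)
    then show ?thesis
      using commute[OF w gV] by simp
  qed
  \<comment> \<open>Imaginary parts come from the real parts at
    \<open>\<i> *\<^sub>C w\<close>.\<close>
  have "l w = q w g" if w: "w \<in> V" for w
    using Re_eq[OF w] Re_eq[OF in_space(3)[OF w], of "\<i>"] w gV
    by (simp add: complex_eq_iff l_scale scale_left)
  then show ?thesis
    using gV by blast
qed

text \<open>Analysis and synthesis are adjoint to each other and share their bound. With
  \<open>s\<close> the squared length of the synthesized vector \<open>u\<close>, Cauchy-Schwarz
  bounds \<open>s\<^sup>2\<close> by a multiple of \<open>s\<close>, and one factor cancels.\<close>

lemma bessel_dual:
  assumes B: "0 \<le> B" and g: "\<And>i. i \<in> X \<Longrightarrow> g i \<in> V"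
    and bessel: "\<And>f. f \<in> V \<Longrightarrow> (\<Sum>i\<in>X. (cmod (q f (g i)))\<^sup>2) \<le> B * Re (q f f)"
  shows "Re (q (\<Sum>i\<in>X. a i *\<^sub>C g i) (\<Sum>i\<in>X. a i *\<^sub>C g i)) \<le> B * (\<Sum>i\<in>X. (cmod (a i))\<^sup>2)"
proof -
  define u where "u = (\<Sum>i\<in>X. a i *\<^sub>C g i)"
  define s where "s = Re (q u u)"
  have u: "u \<in> V"
    unfolding u_def by (intro sum_in_space in_space g)
  have "q u u = (\<Sum>i\<in>X. q (a i *\<^sub>C g i) u)"
    using sum_left[of X "\<lambda>i. a i *\<^sub>C g i" u] g u in_space(3) by (simp add: u_def)
  also have "\<dots> = (\<Sum>i\<in>X. a i * cnj (q u (g i)))"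
    using g u by (intro sum.cong refl) (metis scale_left commute)
  finally have "s \<le> cmod (\<Sum>i\<in>X. a i * cnj (q u (g i)))"
    unfolding s_def by (metis complex_Re_le_cmod)
  also have "\<dots> \<le> (\<Sum>i\<in>X. cmod (a i) * cmod (q u (g i)))"
    by (rule order_trans[OF norm_sum]) (simp add: norm_mult)
  finally have "s \<le> (\<Sum>i\<in>X. cmod (a i) * cmod (q u (g i)))" .
  then have "s\<^sup>2 \<le> (\<Sum>i\<in>X. cmod (a i) * cmod (q u (g i)))\<^sup>2"
    using self_nonneg[OF u] by (intro power_mono) (auto simp: s_def)
  also have "\<dots> \<le> (\<Sum>i\<in>X. (cmod (a i))\<^sup>2) * (\<Sum>i\<in>X. (cmod (q u (g i)))\<^sup>2)"
    by (rule Cauchy_Schwarz_ineq_sum)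
  also have "\<dots> \<le> (\<Sum>i\<in>X. (cmod (a i))\<^sup>2) * (B * s)"
    using bessel[OF u] unfolding s_def by (intro mult_left_mono sum_nonneg) auto
  finally have "s * s \<le> (B * (\<Sum>i\<in>X. (cmod (a i))\<^sup>2)) * s"
    by (simp add: power2_eq_square ac_simps)
  moreover have "0 \<le> s" "0 \<le> B * (\<Sum>i\<in>X. (cmod (a i))\<^sup>2)"
    using self_nonneg[OF u] B by (auto simp: s_def intro!: sum_nonneg mult_nonneg_nonneg)
  ultimately have "s \<le> B * (\<Sum>i\<in>X. (cmod (a i))\<^sup>2)"
    by (cases "s = 0") auto
  then show ?thesis
    by (simp add: s_def u_def)
qed

text \<open>Converse of \<open>bessel_dual\<close>: synthesis with the coefficients
  \<open>q f (g i)\<close> themselves produces a vector \<open>u\<close> for which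
  \<open>q u f\<close> is exactly the sum to be estimated.\<close>

lemma bessel:
  assumes B: "0 \<le> B" and g: "\<And>i. i \<in> X \<Longrightarrow> g i \<in> V" and f: "f \<in> V"
    and dual: "\<And>a. Re (q (\<Sum>i\<in>X. a i *\<^sub>C g i) (\<Sum>i\<in>X. a i *\<^sub>C g i)) \<le> B * (\<Sum>i\<in>X. (cmod (a i))\<^sup>2)"
  shows "(\<Sum>i\<in>X. (cmod (q f (g i)))\<^sup>2) \<le> B * Re (q f f)"
proof -
  define u where "u = (\<Sum>i\<in>X. q f (g i) *\<^sub>C g i)"
  define s where "s = (\<Sum>i\<in>X. (cmod (q f (g i)))\<^sup>2)"
  have u: "u \<in> V"
    unfolding u_def by (intro sum_in_space in_space g)
  have "q u f = (\<Sum>i\<in>X. q (q f (g i) *\<^sub>C g i) f)"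
    unfolding u_def using g f in_space by (intro sum_left) auto
  also have "\<dots> = (\<Sum>i\<in>X. complex_of_real ((cmod (q f (g i)))\<^sup>2))"
    using g f by (intro sum.cong refl) (metis scale_left commute complex_norm_square of_real_power)
  finally have "q u f = complex_of_real s"
    by (simp add: s_def)
  then have "s\<^sup>2 = (cmod (q u f))\<^sup>2"
    by simp
  also have "\<dots> \<le> Re (q u u) * Re (q f f)"
    by (rule cauchy_schwarz[OF u f])
  also have "\<dots> \<le> (B * s) * Re (q f f)"
    using dual[of "\<lambda>i. q f (g i)"] self_nonneg[OF f] unfolding u_def s_def by (rule mult_right_mono)
  finally have *: "s * s \<le> (B * Re (q f f)) * s"
    by (simp add: power2_eq_square ac_simps)
  have "0 \<le> s"
    by (auto simp: s_def intro: sum_nonneg)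
  moreover have "0 \<le> B * Re (q f f)"
    using B self_nonneg[OF f] by simp
  ultimately have "s \<le> B * Re (q f f)"
    using * by (cases "s = 0") auto
  then show ?thesis
    by (simp add: s_def)
qed

text \<open>The coefficients \<open>a\<close> need not be the products \<open>q f (g i)\<close>. The
  upper bound is adjoint to the synthesis bound. For the lower one, \<open>q f f\<close> is expanded
  through \<open>f\<close>; Cauchy-Schwarz pairs the coefficients, bounded by \<open>K\<close>, with
  the frame coefficients, and \<open>norm f\<close> is absorbed at the cost of \<open>1 / c\<close>.
  This turns a Parseval frame of one form into a frame for an equivalent one.\<close>

lemma frame_bounds:
  assumes f: "f \<in> V" and g: "\<And>i. i \<in> I \<Longrightarrow> g i \<in> V" and B: "0 \<le> B" and K: "0 \<le> K"
    and synth: "\<And>X a. finite X \<Longrightarrow> X \<subseteq> I \<Longrightarrow> (norm (\<Sum>i\<in>X. a i *\<^sub>C g i))\<^sup>2 \<le> B * (\<Sum>i\<in>X. (cmod (a i))\<^sup>2)"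
    and expansion: "((\<lambda>i. a i *\<^sub>C g i) has_sum f) I"
    and a: "(\<lambda>i. (cmod (a i))\<^sup>2) summable_on I" "(\<Sum>\<^sub>\<infinity>i\<in>I. (cmod (a i))\<^sup>2) \<le> K * (norm f)\<^sup>2"
  shows "(\<lambda>i. (cmod (q f (g i)))\<^sup>2) summable_on I"
    and "Re (q f f) \<le> (K / c) * (\<Sum>\<^sub>\<infinity>i\<in>I. (cmod (q f (g i)))\<^sup>2)"
    and "(\<Sum>\<^sub>\<infinity>i\<in>I. (cmod (q f (g i)))\<^sup>2) \<le> (C * B) * Re (q f f)"
proof -
  have le: "(\<Sum>i\<in>X. (cmod (q f (g i)))\<^sup>2) \<le> (C * B) * Re (q f f)" if X: "finite X" "X \<subseteq> I" for X
  proof (rule bessel)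
    fix b :: "_ \<Rightarrow> complex"
    define u where "u = (\<Sum>i\<in>X. b i *\<^sub>C g i)"
    have "u \<in> V"
      unfolding u_def using g X by (intro sum_in_space in_space) auto
    then have "Re (q u u) \<le> C * (norm u)\<^sup>2"
      by (rule upper)
    also have "\<dots> \<le> C * (B * (\<Sum>i\<in>X. (cmod (b i))\<^sup>2))"
      unfolding u_def by (intro mult_left_mono synth X C_nonneg)
    finally show "Re (q (\<Sum>i\<in>X. b i *\<^sub>C g i) (\<Sum>i\<in>X. b i *\<^sub>C g i)) \<le> C * B * (\<Sum>i\<in>X. (cmod (b i))\<^sup>2)"
      by (simp add: u_def mult.assoc)
  qed (use f g X B C_nonneg in auto)
  show summable: "(\<lambda>i. (cmod (q f (g i)))\<^sup>2) summable_on I"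
    by (rule nonneg_bounded_partial_sums_imp_summable_on[where C = "(C * B) * Re (q f f)"])
      (use le in \<open>auto intro!: eventually_finite_subsets_at_top_weakI\<close>)
  show "(\<Sum>\<^sub>\<infinity>i\<in>I. (cmod (q f (g i)))\<^sup>2) \<le> (C * B) * Re (q f f)"
    using le by (intro infsum_le_finite_sums[OF summable]) auto
  define S where "S = (\<Sum>\<^sub>\<infinity>i\<in>I. (cmod (q f (g i)))\<^sup>2)"
  define s where "s = Re (q f f)"
  have S: "0 \<le> S"
    unfolding S_def by (intro infsum_nonneg) simp
  have s: "0 \<le> s" "c * (norm f)\<^sup>2 \<le> s"
    using self_nonneg[OF f] lower[OF f] by (simp_all add: s_def)
  have part: "(cmod (q (\<Sum>i\<in>X. a i *\<^sub>C g i) f))\<^sup>2 \<le> K * (norm f)\<^sup>2 * S" if X: "finite X" "X \<subseteq> I" for X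
  proof -
    have "q (\<Sum>i\<in>X. a i *\<^sub>C g i) f = (\<Sum>i\<in>X. q (a i *\<^sub>C g i) f)"
      using X f g in_space(3) by (intro sum_left) auto
    also have "\<dots> = (\<Sum>i\<in>X. a i * cnj (q f (g i)))"
      using g f X by (intro sum.cong refl) (metis scale_left commute subsetD)
    finally have expand: "q (\<Sum>i\<in>X. a i *\<^sub>C g i) f = (\<Sum>i\<in>X. a i * cnj (q f (g i)))" .
    have "cmod (q (\<Sum>i\<in>X. a i *\<^sub>C g i) f) \<le> (\<Sum>i\<in>X. cmod (a i) * cmod (q f (g i)))"
      unfolding expand by (rule order_trans[OF norm_sum]) (simp add: norm_mult)
    then have "(cmod (q (\<Sum>i\<in>X. a i *\<^sub>C g i) f))\<^sup>2 \<le> (\<Sum>i\<in>X. cmod (a i) * cmod (q f (g i)))\<^sup>2"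
      by (intro power_mono) auto
    also have "\<dots> \<le> (\<Sum>i\<in>X. (cmod (a i))\<^sup>2) * (\<Sum>i\<in>X. (cmod (q f (g i)))\<^sup>2)"
      by (rule Cauchy_Schwarz_ineq_sum)
    also have "\<dots> \<le> (K * (norm f)\<^sup>2) * S"
    proof (rule mult_mono)
      show "(\<Sum>i\<in>X. (cmod (a i))\<^sup>2) \<le> K * (norm f)\<^sup>2"
        using finite_sum_le_infsum[OF a(1) X] a(2) by simp
      show "(\<Sum>i\<in>X. (cmod (q f (g i)))\<^sup>2) \<le> S"
        unfolding S_def using finite_sum_le_infsum[OF summable X] by simp
    qed (use K in \<open>auto intro!: sum_nonneg\<close>)
    finally show ?thesis .
  qed
  have lim: "((\<lambda>X. \<Sum>i\<in>X. a i *\<^sub>C g i) \<longlongrightarrow> f) (finite_subsets_at_top I)"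
    using expansion by (simp add: has_sum_def)
  \<comment> \<open>The default \<open>0\<close> keeps \<open>P X\<close> in \<open>V\<close> for
    every \<open>X\<close>, as \<open>form_tendsto_left\<close> demands; along the filter only
    subsets of \<open>I\<close> occur.\<close>
  define P where "P X = (if X \<subseteq> I then \<Sum>i\<in>X. a i *\<^sub>C g i else 0)" for X
  have "(P \<longlongrightarrow> f) (finite_subsets_at_top I)"
    by (rule Lim_transform_eventually[OF lim])
      (auto simp: P_def intro!: eventually_finite_subsets_at_top_weakI)
  moreover have "P X \<in> V" for X
    unfolding P_def using g by (auto intro!: sum_in_space in_space)
  ultimately have "((\<lambda>X. q (P X) f) \<longlongrightarrow> q f f) (finite_subsets_at_top I)"
    by (intro form_tendsto_left f)
  then have "((\<lambda>X. (cmod (q (P X) f))\<^sup>2) \<longlongrightarrow> (cmod (q f f))\<^sup>2) (finite_subsets_at_top I)"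
    by (intro tendsto_intros)
  then have "(cmod (q f f))\<^sup>2 \<le> K * (norm f)\<^sup>2 * S"
    by (rule tendsto_upperbound)
      (use part in \<open>auto simp: P_def intro!: eventually_finite_subsets_at_top_weakI\<close>)
  then have "s * s \<le> K * (norm f)\<^sup>2 * S"
    using self_real[OF f] s(1) by (metis norm_of_real abs_of_nonneg power2_eq_square s_def)
  also have "\<dots> \<le> K * (s / c) * S"
    using s(2) c_pos K S by (intro mult_right_mono mult_left_mono) (auto simp: field_simps)
  finally have "s * s \<le> (K / c * S) * s"
    by (simp add: field_simps)
  then have "s \<le> K / c * S"
    using s(1) S K c_pos mult_right_le_imp_le[of s s "K / c * S"] by (cases "s = 0") simp_all
  then show "Re (q f f) \<le> (K / c) * (\<Sum>\<^sub>\<infinity>i\<in>I. (cmod (q f (g i)))\<^sup>2)"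
    by (simp add: s_def S_def)
qed

text \<open>Parseval contains the Bessel bound \<open>1\<close> in \<open>q\<close>; returning to
  the norm costs \<open>1 / c\<close>.\<close>

lemma parseval_synthesis_bound:
  assumes g: "\<And>i. i \<in> I \<Longrightarrow> g i \<in> V"
    and parseval: "\<And>f. f \<in> V \<Longrightarrow> ((\<lambda>i. (cmod (q f (g i)))\<^sup>2) has_sum Re (q f f)) I"
    and X: "finite X" "X \<subseteq> I"
  shows "(norm (\<Sum>i\<in>X. a i *\<^sub>C g i))\<^sup>2 \<le> (1 / c) * (\<Sum>i\<in>X. (cmod (a i))\<^sup>2)"
proof -
  define u where "u = (\<Sum>i\<in>X. a i *\<^sub>C g i)"
  have u: "u \<in> V"
    unfolding u_def using g X by (intro sum_in_space in_space) auto
  have "Re (q u u) \<le> 1 * (\<Sum>i\<in>X. (cmod (a i))\<^sup>2)"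
    unfolding u_def
  proof (rule bessel_dual)
    fix f assume f: "f \<in> V"
    show "(\<Sum>i\<in>X. (cmod (q f (g i)))\<^sup>2) \<le> 1 * Re (q f f)"
      using finite_sum_le_has_sum[OF parseval[OF f] X] by simp
  qed (use g X in auto)
  then have "c * (norm u)\<^sup>2 \<le> (\<Sum>i\<in>X. (cmod (a i))\<^sup>2)"
    using lower[OF u] by simp
  then show ?thesis
    using c_pos by (simp add: u_def field_simps)
qed

text \<open>The synthesis bound makes the series converge. By the polarized Parseval identity its
  limit \<open>f'\<close> has the same products with all of \<open>V\<close> as \<open>f\<close>;
  testing with \<open>f' - f\<close> shows equality.\<close>

lemma parseval_reconstruction:
  assumes closed: "closed V" and g: "\<And>i. i \<in> I \<Longrightarrow> g i \<in> V"
    and parseval: "\<And>f k. f \<in> V \<Longrightarrow> k \<in> V \<Longrightarrow> ((\<lambda>i. q f (g i) * cnj (q k (g i))) has_sum q f k) I"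
    and f: "f \<in> V"
  shows "((\<lambda>i. q f (g i) *\<^sub>C g i) has_sum f) I"
proof -
  have parseval': "((\<lambda>i. (cmod (q f (g i)))\<^sup>2) has_sum Re (q f f)) I" if "f \<in> V" for f
    using has_sum_Re[OF parseval[OF that that]] by (simp flip: complex_norm_square of_real_power)
  have "(\<lambda>i. q f (g i) *\<^sub>C g i) summable_on I"
  proof (rule summable_on_if_norm_sum_le)
    show "(norm (\<Sum>i\<in>X. q f (g i) *\<^sub>C g i))\<^sup>2 \<le> (\<Sum>i\<in>X. (1 / c) * (cmod (q f (g i)))\<^sup>2)"
      if "finite X" "X \<subseteq> I" for X
      using parseval_synthesis_bound[OF g parseval' that, of "\<lambda>i. q f (g i)"]
      unfolding sum_distrib_left by blast
    show "(\<lambda>i. (1 / c) * (cmod (q f (g i)))\<^sup>2) summable_on I"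
      using parseval'[OF f] by (intro summable_on_cmult_right) (auto simp: summable_on_def)
  qed
  then obtain f' where f': "((\<lambda>i. q f (g i) *\<^sub>C g i) has_sum f') I"
    by (auto simp: summable_on_def)
  define P where "P X = (if X \<subseteq> I then \<Sum>i\<in>X. q f (g i) *\<^sub>C g i else 0)" for X
  have "((\<lambda>X. \<Sum>i\<in>X. q f (g i) *\<^sub>C g i) \<longlongrightarrow> f') (finite_subsets_at_top I)"
    using f' by (simp add: has_sum_def)
  then have lim: "(P \<longlongrightarrow> f') (finite_subsets_at_top I)"
    by (rule Lim_transform_eventually)
      (auto simp: P_def intro!: eventually_finite_subsets_at_top_weakI)
  have PV: "P X \<in> V" for X
    unfolding P_def using g by (auto intro!: sum_in_space in_space)
  have f'V: "f' \<in> V"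
    by (rule Lim_in_closed_set[OF closed _ _ lim]) (simp_all add: PV)
  have eq: "q f' k = q f k" if k: "k \<in> V" for k
  proof (rule tendsto_unique)
    show "((\<lambda>X. q (P X) k) \<longlongrightarrow> q f' k) (finite_subsets_at_top I)"
      by (rule form_tendsto_left[OF PV f'V k lim])
    have "((\<lambda>X. \<Sum>i\<in>X. q f (g i) * cnj (q k (g i))) \<longlongrightarrow> q f k) (finite_subsets_at_top I)"
      using parseval[OF f k] by (simp add: has_sum_def)
    moreover have "(\<Sum>i\<in>X. q f (g i) * cnj (q k (g i))) = q (P X) k" if X: "finite X" "X \<subseteq> I" for X
    proof -
      have "q (P X) k = (\<Sum>i\<in>X. q (q f (g i) *\<^sub>C g i) k)"
        using X f k g in_space(3) by (simp add: P_def) (intro sum_left; auto)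
      also have "\<dots> = (\<Sum>i\<in>X. q f (g i) * cnj (q k (g i)))"
        using g k X by (intro sum.cong refl) (metis scale_left commute subsetD)
      finally show ?thesis ..
    qed
    ultimately show "((\<lambda>X. q (P X) k) \<longlongrightarrow> q f k) (finite_subsets_at_top I)"
      by (rule Lim_transform_eventually[OF _ eventually_finite_subsets_at_top_weakI])
  qed simp
  have "c * (norm (f' - f))\<^sup>2 \<le> Re (q (f' - f) (f' - f))"
    using f f'V in_space by (intro lower) auto
  also have "\<dots> = 0"
    using eq[of "f' - f"] f f'V in_space by (simp add: diff_left)
  finally have "f' = f"
    using c_pos by (simp add: mult_le_0_iff)
  with f' show ?thesis
    by simp
qed

end

section \<open>Dual frames and Riesz bases\<close>

lemma product_summable_if_square_summable:
  fixes f g :: "'i \<Rightarrow> complex"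
  assumes "(\<lambda>i. (cmod (f i))\<^sup>2) summable_on J" "(\<lambda>i. (cmod (g i))\<^sup>2) summable_on J"
  shows "(\<lambda>i. f i * cnj (g i)) summable_on J"
proof (rule abs_summable_summable, rule abs_summable_product)
  show "(\<lambda>i. cmod (f i * f i)) summable_on J"
    using assms(1) by (simp add: norm_mult power2_eq_square)
  show "(\<lambda>i. cmod (cnj (g i) * cnj (g i))) summable_on J"
    using assms(2) by (simp add: norm_mult power2_eq_square)
qed

text \<open>In the equivalent inner product \<open>q f k = \<Sum>\<^sub>\<infinity>i. \<Theta> f i * cnj (\<Theta> k i)\<close> the coefficient
  functionals are represented by vectors \<open>g i\<close> forming a Parseval frame: the canonical dual frame.
  It inherits every symmetry of \<open>\<Theta>\<close> by uniqueness of the representing vectors.\<close>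

lemma dual_frame_exists:
  fixes V :: "'h::complex_hilbert set" and \<Theta> :: "'h \<Rightarrow> 'i \<Rightarrow> complex"
  assumes V: "closed V" "complex_vec.subspace V"
    and add: "\<And>f k i. f \<in> V \<Longrightarrow> k \<in> V \<Longrightarrow> i \<in> J \<Longrightarrow> \<Theta> (f + k) i = \<Theta> f i + \<Theta> k i"
    and scale: "\<And>a f i. f \<in> V \<Longrightarrow> i \<in> J \<Longrightarrow> \<Theta> (a *\<^sub>C f) i = a * \<Theta> f i"
    and c: "0 < c" and C: "0 \<le> C"
    and summable: "\<And>f. f \<in> V \<Longrightarrow> (\<lambda>i. (cmod (\<Theta> f i))\<^sup>2) summable_on J"
    and \<Theta>_lower: "\<And>f. f \<in> V \<Longrightarrow> c * (norm f)\<^sup>2 \<le> (\<Sum>\<^sub>\<infinity>i\<in>J. (cmod (\<Theta> f i))\<^sup>2)"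
    and \<Theta>_upper: "\<And>f. f \<in> V \<Longrightarrow> (\<Sum>\<^sub>\<infinity>i\<in>J. (cmod (\<Theta> f i))\<^sup>2) \<le> C * (norm f)\<^sup>2"
  shows "\<exists>g. (\<forall>i\<in>J. g i \<in> V) \<and> (\<forall>f\<in>V. ((\<lambda>i. \<Theta> f i *\<^sub>C g i) has_sum f) J) \<and>
    (\<forall>X a. finite X \<longrightarrow> X \<subseteq> J \<longrightarrow> (norm (\<Sum>i\<in>X. a i *\<^sub>C g i))\<^sup>2 \<le> (1 / c) * (\<Sum>i\<in>X. (cmod (a i))\<^sup>2)) \<and>
    (\<forall>u \<pi>. bij_betw \<pi> J J \<longrightarrow> u ` V = V \<longrightarrow> (\<forall>f\<in>V. \<forall>i\<in>J. \<Theta> (u f) (\<pi> i) = \<Theta> f i) \<longrightarrow>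
      (\<forall>i\<in>J. u (g i) = g (\<pi> i)))"
proof -
  define q where "q f k = (\<Sum>\<^sub>\<infinity>i\<in>J. \<Theta> f i * cnj (\<Theta> k i))" for f k
  have has_q: "((\<lambda>i. \<Theta> f i * cnj (\<Theta> k i)) has_sum q f k) J" if "f \<in> V" "k \<in> V" for f k
    unfolding q_def by (intro has_sum_infsum product_summable_if_square_summable summable that)
  have q_self: "Re (q f f) = (\<Sum>\<^sub>\<infinity>i\<in>J. (cmod (\<Theta> f i))\<^sup>2)" if f: "f \<in> V" for f
  proof -
    have "((\<lambda>i. (cmod (\<Theta> f i))\<^sup>2) has_sum Re (q f f)) J"
      using has_sum_Re[OF has_q[OF f f]] by (simp flip: complex_norm_square of_real_power)
    then show ?thesis
      by (simp add: infsumI)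
  qed
  interpret hermitian_form V q c C
  proof
    show "complex_vec.subspace V" "0 < c" "0 \<le> C"
      by (fact V c C)+
    fix x y z :: 'h and a
    assume x: "x \<in> V" and y: "y \<in> V"
    have xy: "x + y \<in> V" "a *\<^sub>C x \<in> V"
      using V(2) x y by (auto intro: complex_vec.subspace_add complex_vec.subspace_scale)
    show "q (a *\<^sub>C x) y = a * q x y"
      unfolding q_def infsum_cmult_right'[symmetric] by (intro infsum_cong) (simp add: scale[OF x])
    show "q x y = cnj (q y x)"
      unfolding q_def infsum_cnj[symmetric] by (intro infsum_cong) simp
    show "c * (norm x)\<^sup>2 \<le> Re (q x x)" "Re (q x x) \<le> C * (norm x)\<^sup>2"
      using \<Theta>_lower[OF x] \<Theta>_upper[OF x] by (simp_all add: q_self[OF x])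
    assume z: "z \<in> V"
    have "((\<lambda>i. \<Theta> x i * cnj (\<Theta> z i) + \<Theta> y i * cnj (\<Theta> z i)) has_sum q x z + q y z) J"
      by (intro has_sum_add has_q x y z)
    moreover have "\<Theta> x i * cnj (\<Theta> z i) + \<Theta> y i * cnj (\<Theta> z i) = \<Theta> (x + y) i * cnj (\<Theta> z i)" if "i \<in> J" for i
      by (simp add: add[OF x y that] distrib_right)
    ultimately have "((\<lambda>i. \<Theta> (x + y) i * cnj (\<Theta> z i)) has_sum q x z + q y z) J"
      by (simp cong: has_sum_cong)
    then show "q (x + y) z = q x z + q y z"
      unfolding q_def[of "x + y"] by (rule infsumI)
  qed
  \<comment> \<open>One squared coefficient is at most the whole sum, so the functional is bounded
    by \<open>sqrt C\<close>.\<close>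
  have "\<exists>g\<in>V. \<forall>f\<in>V. \<Theta> f i = q f g" if i: "i \<in> J" for i
  proof (rule riesz_representation[OF V(1)])
    fix f assume f: "f \<in> V"
    have "(cmod (\<Theta> f i))\<^sup>2 \<le> C * (norm f)\<^sup>2"
      using finite_sum_le_infsum[OF summable[OF f], of "{i}"] \<Theta>_upper[OF f] i by simp
    also have "\<dots> = (sqrt C * norm f)\<^sup>2"
      using C by (simp add: power_mult_distrib)
    finally show "cmod (\<Theta> f i) \<le> sqrt C * norm f"
      by (rule power2_le_imp_le) (simp add: C)
  qed (simp_all add: add scale i)
  then obtain g where gV: "\<And>i. i \<in> J \<Longrightarrow> g i \<in> V" and g: "\<And>i f. i \<in> J \<Longrightarrow> f \<in> V \<Longrightarrow> \<Theta> f i = q f (g i)"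
    by metis
  have parseval: "((\<lambda>i. q f (g i) * cnj (q k (g i))) has_sum q f k) J" if "f \<in> V" "k \<in> V" for f k
    using has_q[OF that] by (rule has_sum_cong[THEN iffD1, rotated]) (simp add: g that)
  have parseval': "((\<lambda>i. (cmod (q f (g i)))\<^sup>2) has_sum Re (q f f)) J" if "f \<in> V" for f
    using has_sum_Re[OF parseval[OF that that]] by (simp flip: complex_norm_square of_real_power)
  show ?thesis
  proof (intro exI[of _ g] conjI ballI allI impI)
    show "g i \<in> V" if "i \<in> J" for i
      by (rule gV[OF that])
    show "((\<lambda>i. \<Theta> f i *\<^sub>C g i) has_sum f) J" if f: "f \<in> V" for f
    proof -
      have eq: "q f (g i) *\<^sub>C g i = \<Theta> f i *\<^sub>C g i" if i: "i \<in> J" for i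
        using g[OF i f] by simp
      have "((\<lambda>i. q f (g i) *\<^sub>C g i) has_sum f) J"
        by (rule parseval_reconstruction[OF V(1) gV parseval f])
      then show ?thesis
        by (rule has_sum_cong[THEN iffD1, rotated]) (rule eq)
    qed
    show "(norm (\<Sum>i\<in>X. a i *\<^sub>C g i))\<^sup>2 \<le> (1 / c) * (\<Sum>i\<in>X. (cmod (a i))\<^sup>2)" if "finite X" "X \<subseteq> J" for X a
      by (rule parseval_synthesis_bound[OF gV parseval' that])
    fix u \<pi> i
    assume \<pi>: "bij_betw \<pi> J J" and u: "u ` V = V" and equiv: "\<forall>f\<in>V. \<forall>i\<in>J. \<Theta> (u f) (\<pi> i) = \<Theta> f i"
      and i: "i \<in> J"
    have uV: "u f \<in> V" if "f \<in> V" for f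
      using u that by blast
    have \<pi>i: "\<pi> i \<in> J"
      using \<pi> i by (auto simp: bij_betw_def)
    have inv: "q (u f) (u k) = q f k" if "f \<in> V" "k \<in> V" for f k
    proof -
      have "q (u f) (u k) = (\<Sum>\<^sub>\<infinity>i\<in>J. \<Theta> (u f) (\<pi> i) * cnj (\<Theta> (u k) (\<pi> i)))"
        unfolding q_def by (rule infsum_reindex_bij_betw[OF \<pi>, symmetric])
      also have "\<dots> = q f k"
        unfolding q_def by (intro infsum_cong) (simp add: equiv that)
      finally show ?thesis .
    qed
    \<comment> \<open>Both vectors represent the coefficient functional at \<open>\<pi> i\<close>:
      \<open>u\<close> preserves \<open>q\<close>, and its surjectivity on \<open>V\<close> lets
      every \<open>f\<close> be written as \<open>u f'\<close>.\<close>
    have eq: "q f (u (g i)) = q f (g (\<pi> i))" if "f \<in> V" for f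
    proof -
      have "f \<in> u ` V"
        using u that by simp
      then obtain f' where f': "f' \<in> V" "f = u f'"
        by (elim imageE)
      then have "q f (u (g i)) = \<Theta> f' i"
        using inv gV[OF i] g[OF i] by simp
      also have "\<dots> = q f (g (\<pi> i))"
        using f' equiv i g[OF \<pi>i uV[OF f'(1)]] by simp
      finally show ?thesis .
    qed
    define w where "w = u (g i) - g (\<pi> i)"
    have w: "w \<in> V"
      unfolding w_def by (intro in_space uV gV i \<pi>i)
    have "q w w = 0"
      using eq[OF w] diff_right[OF uV[OF gV[OF i]] gV[OF \<pi>i] w] by (simp add: w_def)
    then have "w = 0"
      using lower[OF w] c by (simp add: mult_le_0_iff)
    then show "u (g i) = g (\<pi> i)"
      by (simp add: w_def)
  qed
qed

section \<open>The ambient inner product and Riesz bases\<close>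

interpretation cinner: hermitian_form UNIV cinner 1 1
  by unfold_locales
    (auto simp: complex_vec.subspace_UNIV cinner_add_left cinner_scaleC_left cinner_self intro: cinner_commute)

lemma norm_scaleC: "norm (a *\<^sub>C x) = cmod a * norm (x :: 'h::complex_hilbert)"
proof -
  have "cinner (a *\<^sub>C x) (a *\<^sub>C x) = a * (cnj a * cinner x x)"
    by (simp add: cinner_scaleC_left cinner.scale_right)
  then have "complex_of_real ((norm (a *\<^sub>C x))\<^sup>2) = a * (cnj a * complex_of_real ((norm x)\<^sup>2))"
    unfolding cinner_self .
  also have "\<dots> = complex_of_real ((cmod a * norm x)\<^sup>2)"
    by (simp add: power_mult_distrib complex_norm_square flip: mult.assoc of_real_power)
  finally have "(norm (a *\<^sub>C x))\<^sup>2 = (cmod a * norm x)\<^sup>2"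
    by (simp only: of_real_eq_iff)
  then show ?thesis
    by (rule power2_eq_imp_eq) auto
qed

lemma bounded_linear_scaleC: "bounded_linear (\<lambda>x :: 'h::complex_hilbert. a *\<^sub>C x)"
  by (rule bounded_linear_intro[where K = "cmod a"])
    (auto simp: scaleC_add_right scaleR_eq_scaleC scaleC_scaleC norm_scaleC mult.commute)

lemma orthonormal_norm:
  assumes X: "finite X" and e: "\<And>i j. i \<in> X \<Longrightarrow> j \<in> X \<Longrightarrow> cinner (e i) (e j) = (if i = j then 1 else 0)"
  shows "(norm (\<Sum>i\<in>X. a i *\<^sub>C e i))\<^sup>2 = (\<Sum>i\<in>X. (cmod (a i))\<^sup>2)"
proof -
  define u where "u = (\<Sum>i\<in>X. a i *\<^sub>C e i)"
  have u: "cinner u y = (\<Sum>i\<in>X. a i * cinner (e i) y)" for y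
    unfolding u_def by (simp add: cinner.sum_left cinner_scaleC_left)
  have "cinner (e i) u = cnj (a i)" if "i \<in> X" for i
  proof -
    have "cinner u (e i) = (\<Sum>j\<in>X. if j = i then a j else 0)"
      unfolding u using e that by (intro sum.cong refl) auto
    also have "\<dots> = a i"
      using X that by simp
    finally show ?thesis
      by (metis cinner_commute)
  qed
  then have "cinner u u = (\<Sum>i\<in>X. complex_of_real ((cmod (a i))\<^sup>2))"
    unfolding u[of u] by (intro sum.cong refl) (simp add: complex_norm_square flip: of_real_power)
  then have "complex_of_real ((norm u)\<^sup>2) = complex_of_real (\<Sum>i\<in>X. (cmod (a i))\<^sup>2)"
    by (simp add: cinner_self)
  then show ?thesis
    unfolding of_real_eq_iff by (simp add: u_def)
qed

text \<open>\<open>T\<close> carries finite orthonormal sums to sums of the \<open>v i\<close> and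
  distorts norms by at most \<open>c\<close> and \<open>C\<close>; the constants obtained are the
  squares of these.\<close>

lemma riesz_basis_bounds:
  fixes v :: "'i \<Rightarrow> 'h::complex_hilbert"
  assumes "riesz_basis I v V"
  shows "\<exists>c C. 0 < c \<and> 0 \<le> C \<and> (\<forall>X a. finite X \<longrightarrow> X \<subseteq> I \<longrightarrow>
    c * (\<Sum>i\<in>X. (cmod (a i))\<^sup>2) \<le> (norm (\<Sum>i\<in>X. a i *\<^sub>C v i))\<^sup>2 \<and>
    (norm (\<Sum>i\<in>X. a i *\<^sub>C v i))\<^sup>2 \<le> C * (\<Sum>i\<in>X. (cmod (a i))\<^sup>2))"
proof -
  obtain e T c C where V: "complex_vec.subspace V" and e: "orthonormal_basis I e V"
    and T_add: "\<forall>x\<in>V. \<forall>y\<in>V. T (x + y) = T x + T y"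
    and T_scale: "\<forall>c. \<forall>x\<in>V. T (c *\<^sub>C x) = c *\<^sub>C T x" and c: "0 < c"
    and T_bounds: "\<forall>x\<in>V. c * norm x \<le> norm (T x) \<and> norm (T x) \<le> C * norm x"
    and v: "\<forall>i\<in>I. v i = T (e i)"
    using assms unfolding riesz_basis_def by (elim conjE exE)
  have eV: "e i \<in> V" if "i \<in> I" for i
    using e that closure_subset[of "complex_vec.span (e ` I)"] complex_vec.span_base[of "e i" "e ` I"]
    unfolding orthonormal_basis_def by auto
  have T_sum: "T (\<Sum>i\<in>X. a i *\<^sub>C e i) = (\<Sum>i\<in>X. a i *\<^sub>C T (e i))" if "finite X" "X \<subseteq> I" for X a
    using that
  proof (induction rule: finite_induct)
    case empty
    have "T (0 *\<^sub>C 0) = 0 *\<^sub>C T 0"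
      using T_scale complex_vec.subspace_0[OF V] by blast
    then show ?case
      by simp
  next
    case (insert i X)
    have "a i *\<^sub>C e i \<in> V" "(\<Sum>i\<in>X. a i *\<^sub>C e i) \<in> V"
      using insert.prems eV V
      by (auto intro!: complex_vec.subspace_scale complex_vec.subspace_sum)
    then show ?case
      using insert eV T_add T_scale by simp
  qed
  have "c\<^sup>2 * (\<Sum>i\<in>X. (cmod (a i))\<^sup>2) \<le> (norm (\<Sum>i\<in>X. a i *\<^sub>C v i))\<^sup>2 \<and>
    (norm (\<Sum>i\<in>X. a i *\<^sub>C v i))\<^sup>2 \<le> C\<^sup>2 * (\<Sum>i\<in>X. (cmod (a i))\<^sup>2)" if X: "finite X" "X \<subseteq> I" for X a
  proof -
    define u where "u = (\<Sum>i\<in>X. a i *\<^sub>C e i)"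
    have "u \<in> V"
      unfolding u_def using X eV V by (auto intro!: complex_vec.subspace_scale complex_vec.subspace_sum)
    then have "c * norm u \<le> norm (T u)" "norm (T u) \<le> C * norm u"
      using T_bounds by auto
    then have "(c * norm u)\<^sup>2 \<le> (norm (T u))\<^sup>2" "(norm (T u))\<^sup>2 \<le> (C * norm u)\<^sup>2"
      using c by (auto intro!: power_mono)
    moreover have "(norm u)\<^sup>2 = (\<Sum>i\<in>X. (cmod (a i))\<^sup>2)"
      unfolding u_def using X e by (intro orthonormal_norm) (simp_all add: orthonormal_basis_def subset_iff)
    moreover have "T u = (\<Sum>i\<in>X. a i *\<^sub>C v i)"
      unfolding u_def T_sum[OF X] using X v by (intro sum.cong refl) auto
    ultimately show ?thesis
      by (simp add: power_mult_distrib)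
  qed
  then show ?thesis
    using c by (intro exI[of _ "c\<^sup>2"] exI[of _ "C\<^sup>2"]) auto
qed

section \<open>The sampling functionals\<close>

lemma unitary_representationD:
  assumes "unitary_representation U"
  shows "U t (x + y) = U t x + U t y" "U t (a *\<^sub>C x) = a *\<^sub>C U t x" "cinner (U t x) (U t y) = cinner x y"
    "U (s + t) x = U s (U t x)" "U 0 x = x" "continuous_on UNIV (\<lambda>t. cinner (U t x) y)"
proof -
  have U: "unitary_operator (U t)" "U (s + t) = U s \<circ> U t" "U 0 = id"
    "continuous_on UNIV (\<lambda>t. cinner (U t x) y)"
    using assms unfolding unitary_representation_def by auto
  have lin: "Vector_Spaces.linear scaleC scaleC (U t)"
    using U(1) unfolding unitary_operator_def by simp
  show "U t (x + y) = U t x + U t y" "U t (a *\<^sub>C x) = a *\<^sub>C U t x"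
    using lin by (simp_all add: Vector_Spaces.linear_iff_module_hom module_hom.add module_hom.scale)
  show "cinner (U t x) (U t y) = cinner x y"
    using U(1) unfolding unitary_operator_def by simp
  show "U (s + t) x = U s (U t x)" "U 0 x = x" "continuous_on UNIV (\<lambda>t. cinner (U t x) y)"
    using U by simp_all
qed

lemma norm_eq_if_cinner_eq: "cinner x x = cinner y y \<Longrightarrow> norm x = norm y"
  unfolding cinner_self of_real_eq_iff by (simp add: power2_eq_iff_nonneg)

lemma unitary_representation_norm:
  assumes "unitary_representation U"
  shows "norm (U t x) = norm x"
  by (rule norm_eq_if_cinner_eq) (rule unitary_representationD(3)[OF assms])

lemma unitary_representation_bounded_linear:
  assumes "unitary_representation U"
  shows "bounded_linear (U t)"
  by (rule bounded_linear_intro[where K = 1])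
    (simp_all add: unitary_representationD[OF assms] unitary_representation_norm[OF assms] scaleR_eq_scaleC)

lemma has_sum_finite_times:
  fixes f :: "'m::finite \<Rightarrow> 'i \<Rightarrow> 'a::{topological_comm_monoid_add, t2_space}"
  assumes "\<And>m. (f m has_sum s m) H"
  shows "((\<lambda>(m, t). f m t) has_sum (\<Sum>m\<in>UNIV. s m)) (UNIV \<times> H)"
proof -
  have "((\<lambda>(m, t). f m t) has_sum s m) (Pair m ` H)" for m
    using assms[of m] by (subst has_sum_reindex) (auto simp: inj_on_def o_def)
  then have *: "((\<lambda>(m, t). f m t) has_sum (\<Sum>m\<in>UNIV. s m)) (\<Union>m\<in>UNIV. Pair m ` H)"
    by (intro sum_has_sum) auto
  have union: "(\<Union>m\<in>UNIV. Pair m ` H) = UNIV \<times> H"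
    by auto
  show ?thesis
    using * unfolding union .
qed

locale riesz_system = discrete_dual H \<nu>
  for H :: "'g::topological_ab_group_add set" and \<nu> +
  fixes U :: "'g \<Rightarrow> 'h::complex_hilbert \<Rightarrow> 'h" and \<Phi> :: "'n::finite \<Rightarrow> 'h"
  assumes rep: "unitary_representation U"
    and riesz: "riesz_basis (H \<times> UNIV) (\<lambda>(h, n). U h (\<Phi> n)) (H_Phi H U \<Phi>)"
begin

lemma H_Phi_closed: "closed (H_Phi H U \<Phi>)" "complex_vec.subspace (H_Phi H U \<Phi>)"
  using riesz by (simp_all add: riesz_basis_def)

lemma partial_synthesis_bounds:
  "\<exists>c C. 0 < c \<and> 0 \<le> C \<and> (\<forall>Y x. finite Y \<longrightarrow> Y \<subseteq> H \<longrightarrow>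
    c * (\<Sum>n\<in>UNIV. \<Sum>h\<in>Y. (cmod (x n h))\<^sup>2) \<le> (norm (\<Sum>n\<in>UNIV. \<Sum>h\<in>Y. x n h *\<^sub>C U h (\<Phi> n)))\<^sup>2 \<and>
    (norm (\<Sum>n\<in>UNIV. \<Sum>h\<in>Y. x n h *\<^sub>C U h (\<Phi> n)))\<^sup>2 \<le> C * (\<Sum>n\<in>UNIV. \<Sum>h\<in>Y. (cmod (x n h))\<^sup>2))"
proof -
  obtain c C where c: "0 < c" and C: "0 \<le> C"
    and bounds: "\<forall>X a. finite X \<longrightarrow> X \<subseteq> H \<times> UNIV \<longrightarrow>
      c * (\<Sum>i\<in>X. (cmod (a i))\<^sup>2) \<le> (norm (\<Sum>i\<in>X. a i *\<^sub>C (case i of (h, n) \<Rightarrow> U h (\<Phi> n))))\<^sup>2 \<and>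
      (norm (\<Sum>i\<in>X. a i *\<^sub>C (case i of (h, n) \<Rightarrow> U h (\<Phi> n))))\<^sup>2 \<le> C * (\<Sum>i\<in>X. (cmod (a i))\<^sup>2)"
    using riesz_basis_bounds[OF riesz] by (elim exE conjE)
  have "c * (\<Sum>n\<in>UNIV. \<Sum>h\<in>Y. (cmod (x n h))\<^sup>2) \<le> (norm (\<Sum>n\<in>UNIV. \<Sum>h\<in>Y. x n h *\<^sub>C U h (\<Phi> n)))\<^sup>2 \<and>
    (norm (\<Sum>n\<in>UNIV. \<Sum>h\<in>Y. x n h *\<^sub>C U h (\<Phi> n)))\<^sup>2 \<le> C * (\<Sum>n\<in>UNIV. \<Sum>h\<in>Y. (cmod (x n h))\<^sup>2)"
    if Y: "finite Y" "Y \<subseteq> H" for Y x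
  proof -
    define a where "a i = x (snd i) (fst i)" for i :: "'g \<times> 'n"
    have swap: "(\<Sum>n\<in>UNIV. \<Sum>h\<in>Y. F n h) = (\<Sum>i\<in>Y \<times> UNIV. F (snd i) (fst i))" for F :: "'n \<Rightarrow> 'g \<Rightarrow> 'c::comm_monoid_add"
      by (subst sum.swap) (simp add: sum.cartesian_product case_prod_beta)
    have eq: "(\<Sum>n\<in>UNIV. \<Sum>h\<in>Y. x n h *\<^sub>C U h (\<Phi> n)) =
        (\<Sum>i\<in>Y \<times> UNIV. a i *\<^sub>C (case i of (h, n) \<Rightarrow> U h (\<Phi> n)))"
      "(\<Sum>n\<in>UNIV. \<Sum>h\<in>Y. (cmod (x n h))\<^sup>2) = (\<Sum>i\<in>Y \<times> UNIV. (cmod (a i))\<^sup>2)"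
      by (simp_all add: swap a_def case_prod_beta)
    have "finite (Y \<times> (UNIV :: 'n set))" "Y \<times> UNIV \<subseteq> H \<times> (UNIV :: 'n set)"
      using Y by auto
    then show ?thesis
      using bounds unfolding eq by blast
  qed
  then show ?thesis
    using c C by (intro exI[of _ c] exI[of _ C]) simp
qed

lemma synthesis_summable:
  assumes y: "y \<in> l2 H"
  shows "(\<lambda>h. y h *\<^sub>C U h (\<Phi> n)) summable_on H"
proof -
  obtain c C where C: "0 \<le> C" and bounds: "\<forall>Y x. finite Y \<longrightarrow> Y \<subseteq> H \<longrightarrow>
      c * (\<Sum>n\<in>UNIV. \<Sum>h\<in>Y. (cmod (x n h))\<^sup>2) \<le> (norm (\<Sum>n\<in>UNIV. \<Sum>h\<in>Y. x n h *\<^sub>C U h (\<Phi> n)))\<^sup>2 \<and>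
      (norm (\<Sum>n\<in>UNIV. \<Sum>h\<in>Y. x n h *\<^sub>C U h (\<Phi> n)))\<^sup>2 \<le> C * (\<Sum>n\<in>UNIV. \<Sum>h\<in>Y. (cmod (x n h))\<^sup>2)"
    using partial_synthesis_bounds by (elim exE conjE)
  show ?thesis
  proof (rule summable_on_if_norm_sum_le)
    show "(\<lambda>h. C * (cmod (y h))\<^sup>2) summable_on H"
      using y by (intro summable_on_cmult_right) (simp add: l2_def)
    fix Y assume Y: "finite Y" "Y \<subseteq> H"
    \<comment> \<open>Placing \<open>y\<close> in the single component \<open>n\<close> specializes
      the joint bound to one generator.\<close>
    define x where "x k h = (if k = n then y h else 0)" for k h
    have "(\<Sum>k\<in>UNIV. \<Sum>h\<in>Y. x k h *\<^sub>C U h (\<Phi> k)) = (\<Sum>k\<in>UNIV. if k = n then \<Sum>h\<in>Y. y h *\<^sub>C U h (\<Phi> n) else 0)"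
      by (intro sum.cong refl) (simp add: x_def)
    moreover have "(\<Sum>k\<in>UNIV. \<Sum>h\<in>Y. (cmod (x k h))\<^sup>2) = (\<Sum>k\<in>UNIV. if k = n then \<Sum>h\<in>Y. (cmod (y h))\<^sup>2 else 0)"
      by (intro sum.cong refl) (simp add: x_def)
    moreover have "(norm (\<Sum>k\<in>UNIV. \<Sum>h\<in>Y. x k h *\<^sub>C U h (\<Phi> k)))\<^sup>2 \<le> C * (\<Sum>k\<in>UNIV. \<Sum>h\<in>Y. (cmod (x k h))\<^sup>2)"
      using bounds Y by blast
    ultimately show "(norm (\<Sum>h\<in>Y. y h *\<^sub>C U h (\<Phi> n)))\<^sup>2 \<le> (\<Sum>h\<in>Y. C * (cmod (y h))\<^sup>2)"
      by (simp add: sum_distrib_left)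
  qed
qed

lemma synthesis_bounds:
  "\<exists>c C. 0 < c \<and> 0 \<le> C \<and> (\<forall>x. (\<forall>n. x n \<in> l2 H) \<longrightarrow>
    c * l2_sq H x \<le> (norm (synthesis H U \<Phi> x))\<^sup>2 \<and> (norm (synthesis H U \<Phi> x))\<^sup>2 \<le> C * l2_sq H x)"
proof -
  obtain c C where c: "0 < c" and C: "0 \<le> C" and bounds: "\<forall>Y x. finite Y \<longrightarrow> Y \<subseteq> H \<longrightarrow>
      c * (\<Sum>n\<in>UNIV. \<Sum>h\<in>Y. (cmod (x n h))\<^sup>2) \<le> (norm (\<Sum>n\<in>UNIV. \<Sum>h\<in>Y. x n h *\<^sub>C U h (\<Phi> n)))\<^sup>2 \<and>
      (norm (\<Sum>n\<in>UNIV. \<Sum>h\<in>Y. x n h *\<^sub>C U h (\<Phi> n)))\<^sup>2 \<le> C * (\<Sum>n\<in>UNIV. \<Sum>h\<in>Y. (cmod (x n h))\<^sup>2)"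
    using partial_synthesis_bounds by (elim exE conjE)
  have "c * l2_sq H x \<le> (norm (synthesis H U \<Phi> x))\<^sup>2 \<and> (norm (synthesis H U \<Phi> x))\<^sup>2 \<le> C * l2_sq H x"
    if x: "\<And>n. x n \<in> l2 H" for x
  proof -
    have lim: "((\<lambda>Y. (norm (\<Sum>n\<in>UNIV. \<Sum>h\<in>Y. x n h *\<^sub>C U h (\<Phi> n)))\<^sup>2) \<longlongrightarrow> (norm (synthesis H U \<Phi> x))\<^sup>2)
        (finite_subsets_at_top H)"
      unfolding synthesis_def
      by (intro tendsto_power tendsto_norm tendsto_sum infsum_tendsto synthesis_summable x)
    have lim_sq: "((\<lambda>Y. k * (\<Sum>n\<in>UNIV. \<Sum>h\<in>Y. (cmod (x n h))\<^sup>2)) \<longlongrightarrow> k * l2_sq H x) (finite_subsets_at_top H)" for k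
      by (intro tendsto_mult tendsto_const l2_sq_tendsto x)
    have "c * l2_sq H x \<le> (norm (synthesis H U \<Phi> x))\<^sup>2"
      by (rule tendsto_le[OF _ lim lim_sq]) (use bounds in \<open>auto intro!: eventually_finite_subsets_at_top_weakI\<close>)
    moreover have "(norm (synthesis H U \<Phi> x))\<^sup>2 \<le> C * l2_sq H x"
      by (rule tendsto_le[OF _ lim_sq lim]) (use bounds in \<open>auto intro!: eventually_finite_subsets_at_top_weakI\<close>)
    ultimately show ?thesis
      by simp
  qed
  then show ?thesis
    using c C by (intro exI[of _ c] exI[of _ C]) simp
qed

lemma synthesis_add:
  assumes "\<And>n. x n \<in> l2 H" "\<And>n. y n \<in> l2 H"
  shows "synthesis H U \<Phi> (\<lambda>n h. x n h + y n h) = synthesis H U \<Phi> x + synthesis H U \<Phi> y"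
  unfolding synthesis_def scaleC_add_left
  by (simp add: infsum_add synthesis_summable assms sum.distrib)

lemma synthesis_scale:
  assumes "\<And>n. x n \<in> l2 H"
  shows "synthesis H U \<Phi> (\<lambda>n h. a * x n h) = a *\<^sub>C synthesis H U \<Phi> x"
proof -
  have "(\<Sum>\<^sub>\<infinity>h\<in>H. (a * x n h) *\<^sub>C U h (\<Phi> n)) = a *\<^sub>C (\<Sum>\<^sub>\<infinity>h\<in>H. x n h *\<^sub>C U h (\<Phi> n))" for n
    using infsumI[OF has_sum_bounded_linear[OF bounded_linear_scaleC has_sum_infsum[OF synthesis_summable[OF assms]]]]
    by (simp add: scaleC_scaleC)
  then show ?thesis
    by (simp add: synthesis_def complex_vec.scale_sum_right)
qed

lemma synthesis_shift:
  assumes x: "\<And>n. x n \<in> l2 H" and s: "s \<in> H"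
  shows "U s (synthesis H U \<Phi> x) = synthesis H U \<Phi> (\<lambda>n h. x n (h - s))"
proof -
  interpret U: bounded_linear "U s"
    by (rule unitary_representation_bounded_linear[OF rep])
  have "U s (\<Sum>\<^sub>\<infinity>h\<in>H. x n h *\<^sub>C U h (\<Phi> n)) = (\<Sum>\<^sub>\<infinity>h\<in>H. x n (h - s) *\<^sub>C U h (\<Phi> n))" for n
  proof -
    have "U s (\<Sum>\<^sub>\<infinity>h\<in>H. x n h *\<^sub>C U h (\<Phi> n)) = (\<Sum>\<^sub>\<infinity>h\<in>H. U s (x n h *\<^sub>C U h (\<Phi> n)))"
      by (rule infsumI[symmetric])
        (rule has_sum_bounded_linear[OF U.bounded_linear_axioms has_sum_infsum[OF synthesis_summable[OF x]]])
    also have "\<dots> = (\<Sum>\<^sub>\<infinity>h\<in>H. x n h *\<^sub>C U (s + h) (\<Phi> n))"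
      by (simp add: unitary_representationD[OF rep])
    also have "\<dots> = (\<Sum>\<^sub>\<infinity>h\<in>H. (\<lambda>h. x n h *\<^sub>C U (s + h) (\<Phi> n)) (h - s))"
      by (rule infsum_reindex_bij_betw[OF bij_betw_shift[OF subgroup s], symmetric])
    finally show ?thesis
      by simp
  qed
  then show ?thesis
    by (simp add: synthesis_def U.sum)
qed

lemma H_Phi_image_translation:
  assumes s: "s \<in> H"
  shows "U s ` H_Phi H U \<Phi> = H_Phi H U \<Phi>"
proof -
  have sub: "U r ` H_Phi H U \<Phi> \<subseteq> H_Phi H U \<Phi>" if r: "r \<in> H" for r
  proof
    fix f assume "f \<in> U r ` H_Phi H U \<Phi>"
    then obtain x where x: "\<forall>n. x n \<in> l2 H" "f = U r (synthesis H U \<Phi> x)"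
      unfolding H_Phi_def by auto
    then have "f = synthesis H U \<Phi> (\<lambda>n h. x n (h - r))" "\<forall>n. (\<lambda>h. x n (h - r)) \<in> l2 H"
      using synthesis_shift r l2_shift[OF subgroup r] by simp_all
    then show "f \<in> H_Phi H U \<Phi>"
      unfolding H_Phi_def by blast
  qed
  have "f \<in> U s ` H_Phi H U \<Phi>" if f: "f \<in> H_Phi H U \<Phi>" for f
  proof -
    have "f = U s (U (- s) f)"
      using unitary_representationD(4)[OF rep, of s "- s" f] unitary_representationD(5)[OF rep] by simp
    moreover have "U (- s) f \<in> H_Phi H U \<Phi>"
      using sub[OF subgroupD(3)[OF s]] f by (simp add: image_subset_iff)
    ultimately show ?thesis
      by (rule image_eqI)
  qed
  then show ?thesis
    using sub[OF s] by auto
qed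

text \<open>Combines the convolution bounds with the Riesz bounds, so that the samples control the
  norm of \<open>f\<close> from both sides. Equivariance of the dual frame then reduces it to one
  generator per channel, the vector at \<open>(m, 0)\<close>.\<close>

lemma sampling_dual_frame:
  fixes A :: "('g \<Rightarrow> complex)^'n^'m::finite"
  assumes sampling: "stable_sampling_procedure H \<nu> U \<phi> \<Phi> A Ahat L"
  shows "\<exists>(g :: 'm \<Rightarrow> 'h) B K. 0 \<le> B \<and> 0 \<le> K \<and> (\<forall>m. g m \<in> H_Phi H U \<Phi>) \<and>
    (\<forall>f\<in>H_Phi H U \<Phi>.
      ((\<lambda>i. L (fst i) (voice_transform U \<phi> f) (snd i) *\<^sub>C U (snd i) (g (fst i))) has_sum f) (UNIV \<times> H) \<and>
      (\<lambda>i. (cmod (L (fst i) (voice_transform U \<phi> f) (snd i)))\<^sup>2) summable_on UNIV \<times> H \<and>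
      (\<Sum>\<^sub>\<infinity>i\<in>UNIV \<times> H. (cmod (L (fst i) (voice_transform U \<phi> f) (snd i)))\<^sup>2) \<le> K * (norm f)\<^sup>2) \<and>
    (\<forall>X a. finite X \<longrightarrow> X \<subseteq> UNIV \<times> H \<longrightarrow>
      (norm (\<Sum>i\<in>X. a i *\<^sub>C U (snd i) (g (fst i))))\<^sup>2 \<le> B * (\<Sum>i\<in>X. (cmod (a i))\<^sup>2))"
proof -
  define V where "V = H_Phi H U \<Phi>"
  define J :: "('m \<times> 'g) set" where "J = UNIV \<times> H"
  define \<Theta> where "\<Theta> f i = L (fst i) (voice_transform U \<phi> f) (snd i)" for f i
  have four: "\<And>m n. is_fourier_l2 H \<nu> (A $ m $ n) (\<lambda>\<xi>. Ahat \<xi> $ m $ n)"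
    and Linf: "\<And>m n. in_Linfty \<nu> (\<lambda>\<xi>. Ahat \<xi> $ m $ n)"
    and det: "0 < essinf \<nu> (\<lambda>\<xi>. ereal (Re (det (conj_transpose (Ahat \<xi>) ** Ahat \<xi>))))"
    and A: "\<And>m n. A $ m $ n \<in> l2 H"
    and L: "\<And>x m t. \<forall>n. x n \<in> l2 H \<Longrightarrow> t \<in> H \<Longrightarrow>
      L m (voice_transform U \<phi> (synthesis H U \<Phi> x)) t = matrix_convolution H A x m t"
    using sampling unfolding stable_sampling_procedure_def matrix_convolution_def by auto
  have \<Theta>: "\<Theta> (synthesis H U \<Phi> x) i = matrix_convolution H A x (fst i) (snd i)"
    if "\<forall>n. x n \<in> l2 H" "i \<in> J" for x i
    using L[OF that(1), of "snd i" "fst i"] that(2) by (auto simp: \<Theta>_def J_def)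
  have V_E: "\<exists>x. (\<forall>n. x n \<in> l2 H) \<and> f = synthesis H U \<Phi> x" if "f \<in> V" for f
    using that by (auto simp: V_def H_Phi_def)
  obtain D C1 where D: "0 < D" and C1: "0 \<le> C1" and conv: "\<forall>x. (\<forall>n. x n \<in> l2 H) \<longrightarrow>
      (\<forall>m. matrix_convolution H A x m \<in> l2 H) \<and>
      l2_sq H x \<le> D * l2_sq H (matrix_convolution H A x) \<and>
      l2_sq H (matrix_convolution H A x) \<le> C1 * l2_sq H x"
    using matrix_convolution_bounds[OF four Linf det] by (elim exE conjE)
  obtain c2 C2 where c2: "0 < c2" and C2: "0 \<le> C2" and synth: "\<forall>x. (\<forall>n. x n \<in> l2 H) \<longrightarrow>
      c2 * l2_sq H x \<le> (norm (synthesis H U \<Phi> x))\<^sup>2 \<and> (norm (synthesis H U \<Phi> x))\<^sup>2 \<le> C2 * l2_sq H x"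
    using synthesis_bounds by (elim exE conjE)
  have \<Theta>_sum: "((\<lambda>i. (cmod (\<Theta> (synthesis H U \<Phi> x) i))\<^sup>2) has_sum l2_sq H (matrix_convolution H A x)) J"
    if x: "\<forall>n. x n \<in> l2 H" for x
  proof -
    have "((\<lambda>t. (cmod (matrix_convolution H A x m t))\<^sup>2) has_sum
        (\<Sum>\<^sub>\<infinity>t\<in>H. (cmod (matrix_convolution H A x m t))\<^sup>2)) H" for m
      using conv x by (intro has_sum_infsum) (simp add: l2_def)
    then have "((\<lambda>(m, t). (cmod (matrix_convolution H A x m t))\<^sup>2) has_sum l2_sq H (matrix_convolution H A x)) J"
      unfolding l2_sq_def J_def by (rule has_sum_finite_times)
    then show ?thesis
      by (rule has_sum_cong[THEN iffD1, rotated]) (simp add: \<Theta>[OF x] case_prod_beta)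
  qed
  \<comment> \<open>The squared norm of \<open>f\<close> is at most \<open>C2\<close> times that of
    its coefficients, and those are at most \<open>D\<close> times that of the samples. The
    \<open>1\<close> prevents a zero denominator when \<open>C2\<close> is \<open>0\<close>.\<close>
  define c where "c = 1 / (C2 * D + 1)"
  have c: "0 < c"
    using C2 D by (simp add: c_def add_nonneg_pos)
  have bounds: "(\<lambda>i. (cmod (\<Theta> f i))\<^sup>2) summable_on J" "c * (norm f)\<^sup>2 \<le> (\<Sum>\<^sub>\<infinity>i\<in>J. (cmod (\<Theta> f i))\<^sup>2)"
    "(\<Sum>\<^sub>\<infinity>i\<in>J. (cmod (\<Theta> f i))\<^sup>2) \<le> (C1 / c2) * (norm f)\<^sup>2" if f: "f \<in> V" for f
  proof -
    obtain x where x: "\<forall>n. x n \<in> l2 H" "f = synthesis H U \<Phi> x"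
      using V_E[OF f] by blast
    define N where "N = l2_sq H (matrix_convolution H A x)"
    have N: "((\<lambda>i. (cmod (\<Theta> f i))\<^sup>2) has_sum N) J" "l2_sq H x \<le> D * N" "N \<le> C1 * l2_sq H x"
      "c2 * l2_sq H x \<le> (norm f)\<^sup>2" "(norm f)\<^sup>2 \<le> C2 * l2_sq H x" "0 \<le> N"
      using \<Theta>_sum[OF x(1)] conv synth x l2_sq_nonneg by (simp_all add: N_def)
    show "(\<lambda>i. (cmod (\<Theta> f i))\<^sup>2) summable_on J"
      using N(1) by (auto simp: summable_on_def)
    have "(norm f)\<^sup>2 \<le> C2 * (D * N)"
      using N(5) mult_left_mono[OF N(2) C2] by simp
    also have "\<dots> \<le> (C2 * D + 1) * N"
      using N(6) by (simp add: algebra_simps)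
    finally have "c * (norm f)\<^sup>2 \<le> c * ((C2 * D + 1) * N)"
      using c by (intro mult_left_mono) auto
    also have "\<dots> = N"
      using c by (simp add: c_def)
    finally show "c * (norm f)\<^sup>2 \<le> (\<Sum>\<^sub>\<infinity>i\<in>J. (cmod (\<Theta> f i))\<^sup>2)"
      using infsumI[OF N(1)] by simp
    have "c2 * N \<le> C1 * (c2 * l2_sq H x)"
      using mult_left_mono[OF N(3), of c2] c2 by (simp add: mult_ac)
    also have "\<dots> \<le> C1 * (norm f)\<^sup>2"
      using N(4) C1 by (rule mult_left_mono)
    finally show "(\<Sum>\<^sub>\<infinity>i\<in>J. (cmod (\<Theta> f i))\<^sup>2) \<le> (C1 / c2) * (norm f)\<^sup>2"
      using infsumI[OF N(1)] c2 by (simp add: field_simps)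
  qed
  have \<Theta>_add: "\<Theta> (f + k) i = \<Theta> f i + \<Theta> k i" if f: "f \<in> V" and k: "k \<in> V" and i: "i \<in> J" for f k i
  proof -
    obtain x y where x: "\<forall>n. x n \<in> l2 H" "f = synthesis H U \<Phi> x" and y: "\<forall>n. y n \<in> l2 H" "k = synthesis H U \<Phi> y"
      using V_E[OF f] V_E[OF k] by blast
    have xy: "f + k = synthesis H U \<Phi> (\<lambda>n h. x n h + y n h)" "\<forall>n. (\<lambda>h. x n h + y n h) \<in> l2 H"
      using synthesis_add[of x y] x y by (auto intro: l2_add)
    have "\<Theta> (f + k) i = matrix_convolution H A (\<lambda>n h. x n h + y n h) (fst i) (snd i)"
      unfolding xy(1) by (rule \<Theta>[OF xy(2) i])
    also have "\<dots> = matrix_convolution H A x (fst i) (snd i) + matrix_convolution H A y (fst i) (snd i)"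
      using x(1) y(1) i by (intro matrix_convolution_add A) (auto simp: J_def)
    finally show ?thesis
      unfolding x(2) y(2) \<Theta>[OF x(1) i] \<Theta>[OF y(1) i] .
  qed
  have \<Theta>_scale: "\<Theta> (a *\<^sub>C f) i = a * \<Theta> f i" if f: "f \<in> V" and i: "i \<in> J" for a f i
  proof -
    obtain x where x: "\<forall>n. x n \<in> l2 H" "f = synthesis H U \<Phi> x"
      using V_E[OF f] by blast
    have ax: "a *\<^sub>C f = synthesis H U \<Phi> (\<lambda>n h. a * x n h)" "\<forall>n. (\<lambda>h. a * x n h) \<in> l2 H"
      using synthesis_scale[of x a] x by (auto intro: l2_cmult)
    have "\<Theta> (a *\<^sub>C f) i = matrix_convolution H A (\<lambda>n h. a * x n h) (fst i) (snd i)"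
      unfolding ax(1) by (rule \<Theta>[OF ax(2) i])
    then show ?thesis
      unfolding x(2) \<Theta>[OF x(1) i] matrix_convolution_cmult .
  qed
  have VV: "closed V" "complex_vec.subspace V"
    unfolding V_def by (fact H_Phi_closed)+
  have Cc: "0 \<le> C1 / c2"
    using C1 c2 by simp
  have "\<exists>g. (\<forall>i\<in>J. g i \<in> V) \<and> (\<forall>f\<in>V. ((\<lambda>i. \<Theta> f i *\<^sub>C g i) has_sum f) J) \<and>
    (\<forall>X a. finite X \<longrightarrow> X \<subseteq> J \<longrightarrow> (norm (\<Sum>i\<in>X. a i *\<^sub>C g i))\<^sup>2 \<le> (1 / c) * (\<Sum>i\<in>X. (cmod (a i))\<^sup>2)) \<and>
    (\<forall>u \<pi>. bij_betw \<pi> J J \<longrightarrow> u ` V = V \<longrightarrow> (\<forall>f\<in>V. \<forall>i\<in>J. \<Theta> (u f) (\<pi> i) = \<Theta> f i) \<longrightarrow>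
      (\<forall>i\<in>J. u (g i) = g (\<pi> i)))"
    by (rule dual_frame_exists[OF VV \<Theta>_add \<Theta>_scale c Cc bounds])
  then obtain g where g: "\<forall>i\<in>J. g i \<in> V"
    and rec: "\<forall>f\<in>V. ((\<lambda>i. \<Theta> f i *\<^sub>C g i) has_sum f) J"
    and synth: "\<forall>X a. finite X \<longrightarrow> X \<subseteq> J \<longrightarrow> (norm (\<Sum>i\<in>X. a i *\<^sub>C g i))\<^sup>2 \<le> (1 / c) * (\<Sum>i\<in>X. (cmod (a i))\<^sup>2)"
    and equiv: "\<forall>u \<pi>. bij_betw \<pi> J J \<longrightarrow> u ` V = V \<longrightarrow> (\<forall>f\<in>V. \<forall>i\<in>J. \<Theta> (u f) (\<pi> i) = \<Theta> f i) \<longrightarrow>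
      (\<forall>i\<in>J. u (g i) = g (\<pi> i))"
    by (elim exE conjE)
  \<comment> \<open>Translating \<open>f\<close> by \<open>s\<close> shifts all its samples by
    \<open>s\<close>, so \<open>U s\<close> is a symmetry of \<open>\<Theta>\<close> over the
    permutation adding \<open>s\<close> to the second index.\<close>
  have translate: "U s (g (m, 0)) = g (m, s)" if s: "s \<in> H" for s m
  proof -
    have "U s (g (m, 0)) = g ((\<lambda>i. (fst i, snd i + s)) (m, 0))"
    proof (rule equiv[rule_format, of "\<lambda>i. (fst i, snd i + s)" "U s" "(m, 0)"])
      show "bij_betw (\<lambda>i. (fst i, snd i + s)) J J"
        by (rule bij_betw_byWitness[where f' = "\<lambda>i. (fst i, snd i - s)"])
          (use s in \<open>auto simp: J_def subgroupD\<close>)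
      show "U s ` V = V"
        unfolding V_def by (rule H_Phi_image_translation[OF s])
      show "(m, 0) \<in> J"
        by (simp add: J_def subgroupD)
      fix f i assume f: "f \<in> V" and i: "i \<in> J"
      obtain x where x: "\<forall>n. x n \<in> l2 H" "f = synthesis H U \<Phi> x"
        using V_E[OF f] by blast
      have sx: "U s f = synthesis H U \<Phi> (\<lambda>n h. x n (h - s))" "\<forall>n. (\<lambda>h. x n (h - s)) \<in> l2 H"
        using synthesis_shift[of x s] x s by (auto intro: l2_shift[OF subgroup s])
      have i': "(fst i, snd i + s) \<in> J"
        using i s by (auto simp: J_def subgroupD)
      have "\<Theta> (U s f) (fst i, snd i + s) = matrix_convolution H A x (fst i) (snd i)"
        unfolding sx(1) \<Theta>[OF sx(2) i'] by (simp add: matrix_convolution_shift[OF s])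
      then show "\<Theta> (U s f) (fst i, snd i + s) = \<Theta> f i"
        unfolding x(2) \<Theta>[OF x(1) i] .
    qed
    then show ?thesis
      by simp
  qed
  have g_eq: "U (snd i) (g (fst i, 0)) = g i" if "i \<in> J" for i
    using translate[of "snd i" "fst i"] that by (auto simp: J_def)
  show ?thesis
  proof (rule exI[of _ "\<lambda>m. g (m, 0)"], rule exI[of _ "1 / c"], rule exI[of _ "C1 / c2"],
      intro conjI allI ballI impI)
    show "0 \<le> 1 / c" "0 \<le> C1 / c2"
      using c Cc by simp_all
    show "g (m, 0) \<in> H_Phi H U \<Phi>" for m
      using g by (simp add: J_def V_def subgroupD)
  next
    fix f assume f: "f \<in> H_Phi H U \<Phi>"
    have "((\<lambda>i. \<Theta> f i *\<^sub>C g i) has_sum f) J"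
      using f rec by (simp add: V_def)
    then have "((\<lambda>i. \<Theta> f i *\<^sub>C U (snd i) (g (fst i, 0))) has_sum f) J"
      by (rule has_sum_cong[THEN iffD1, rotated]) (simp only: g_eq)
    then show "((\<lambda>i. L (fst i) (voice_transform U \<phi> f) (snd i) *\<^sub>C U (snd i) (g (fst i, 0))) has_sum f) (UNIV \<times> H)"
      by (simp only: \<Theta>_def J_def)
    show "(\<lambda>i. (cmod (L (fst i) (voice_transform U \<phi> f) (snd i)))\<^sup>2) summable_on UNIV \<times> H"
      "(\<Sum>\<^sub>\<infinity>i\<in>UNIV \<times> H. (cmod (L (fst i) (voice_transform U \<phi> f) (snd i)))\<^sup>2) \<le> C1 / c2 * (norm f)\<^sup>2"
      using bounds(1,3)[of f] f by (simp_all add: V_def \<Theta>_def J_def)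
  next
    fix X :: "('m \<times> 'g) set" and a assume X: "finite X" "X \<subseteq> UNIV \<times> H"
    then have "(\<Sum>i\<in>X. a i *\<^sub>C U (snd i) (g (fst i, 0))) = (\<Sum>i\<in>X. a i *\<^sub>C g i)"
      by (intro sum.cong refl arg_cong2[where f = scaleC] g_eq) (auto simp: J_def)
    then show "(norm (\<Sum>i\<in>X. a i *\<^sub>C U (snd i) (g (fst i, 0))))\<^sup>2 \<le> 1 / c * (\<Sum>i\<in>X. (cmod (a i))\<^sup>2)"
      using synth X by (simp add: J_def)
  qed
qed

end

section \<open>Voice transforms and the sampling expansion\<close>

lemma borel_measurable_haar:
  fixes f :: "'g::topological_space \<Rightarrow> complex"
  assumes haar: "haar_measure euclidean op \<mu>" and f: "continuous_on UNIV f"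
  shows "f \<in> borel_measurable \<mu>"
proof -
  have "sets \<mu> = sigma_sets UNIV {S :: 'g set. open S}"
    using haar unfolding haar_measure_def topspace_euclidean open_openin[symmetric] by (elim conjE)
  also have "\<dots> = sets (borel :: 'g measure)"
    unfolding borel_def by (rule sets_measure_of[symmetric]) simp
  finally have sets: "sets \<mu> = sets (borel :: 'g measure)" .
  show ?thesis
    unfolding measurable_cong_sets[OF sets refl] by (rule borel_measurable_continuous_onI[OF f])
qed

lemma voice_transform_continuous:
  assumes "unitary_representation U"
  shows "continuous_on UNIV (voice_transform U \<phi> f)"
proof -
  have "continuous_on UNIV (\<lambda>t. cnj (cinner (U t \<phi>) f))"
    by (intro continuous_intros unitary_representationD(6)[OF assms])
  then show ?thesis
    unfolding voice_transform_def by (simp flip: cinner_commute)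
qed

lemma voice_transform_linear:
  "voice_transform U \<phi> (x + y) t = voice_transform U \<phi> x t + voice_transform U \<phi> y t"
  "voice_transform U \<phi> (a *\<^sub>C x) t = a * voice_transform U \<phi> x t"
  "voice_transform U \<phi> (x - y) t = voice_transform U \<phi> x t - voice_transform U \<phi> y t"
  "voice_transform U \<phi> (\<Sum>i\<in>X. F i) t = (\<Sum>i\<in>X. voice_transform U \<phi> (F i) t)"
  by (simp_all add: voice_transform_def cinner_add_left cinner_scaleC_left cinner.diff_left cinner.sum_left)

lemma voice_transform_translate:
  fixes U :: "'g::topological_ab_group_add \<Rightarrow> 'h::complex_hilbert \<Rightarrow> 'h"
  assumes "unitary_representation U"
  shows "voice_transform U \<phi> (U t x) s = voice_transform U \<phi> x (s - t)"
proof -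
  have "U s \<phi> = U t (U (s - t) \<phi>)"
    using unitary_representationD(4)[OF assms, of t "s - t" \<phi>] by simp
  then show ?thesis
    by (simp add: voice_transform_def unitary_representationD(3)[OF assms])
qed

text \<open>The bound does not involve \<open>s\<close>: convergence in the Hilbert space implies
  uniform convergence of the voice transforms on the group.\<close>

lemma norm_voice_transform_le:
  assumes "unitary_representation U"
  shows "cmod (voice_transform U \<phi> f s) \<le> norm f * norm \<phi>"
  using cinner.norm_form_le[of f "U s \<phi>"] unitary_representation_norm[OF assms]
  by (simp add: voice_transform_def)

text \<open>The continuous frame inequalities are exactly the equivalence of this pulled-back
  product with the norm. Estimates for functions in \<open>L\<^sup>2(G)\<close> thus become
  estimates for vectors.\<close>

lemma voice_transform_hermitian_form:
  fixes U :: "'g::topological_ab_group_add \<Rightarrow> 'h::complex_hilbert \<Rightarrow> 'h"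
  assumes haar: "haar_measure euclidean op \<mu>" and rep: "unitary_representation U"
    and c: "0 < c1" "c1 \<le> c2"
    and bounds: "\<And>x. ennreal (c1 * (norm x)\<^sup>2) \<le> (\<integral>\<^sup>+ t. ennreal ((cmod (cinner x (U t \<phi>)))\<^sup>2) \<partial>\<mu>)"
      "\<And>x. (\<integral>\<^sup>+ t. ennreal ((cmod (cinner x (U t \<phi>)))\<^sup>2) \<partial>\<mu>) \<le> ennreal (c2 * (norm x)\<^sup>2)"
  shows "hermitian_form UNIV (\<lambda>f k. L2_inner \<mu> (voice_transform U \<phi> f) (voice_transform U \<phi> k)) c1 c2"
proof -
  have meas [measurable]: "voice_transform U \<phi> f \<in> borel_measurable \<mu>" for f
    by (rule borel_measurable_haar[OF haar voice_transform_continuous[OF rep]])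
  have int_sq: "integrable \<mu> (\<lambda>t. (cmod (voice_transform U \<phi> f t))\<^sup>2)" for f
  proof (rule integrableI_bounded)
    have "(\<integral>\<^sup>+ t. ennreal (norm ((cmod (voice_transform U \<phi> f t))\<^sup>2)) \<partial>\<mu>) \<le> ennreal (c2 * (norm f)\<^sup>2)"
      using bounds(2)[of f] by (simp add: voice_transform_def)
    then show "(\<integral>\<^sup>+ t. ennreal (norm ((cmod (voice_transform U \<phi> f t))\<^sup>2)) \<partial>\<mu>) < \<infinity>"
      by (rule order_le_less_trans) simp
  qed simp
  have int: "integrable \<mu> (\<lambda>t. voice_transform U \<phi> f t * cnj (voice_transform U \<phi> k t))" for f k
  proof (rule Bochner_Integration.integrable_bound)
    show "integrable \<mu> (\<lambda>t. (cmod (voice_transform U \<phi> f t))\<^sup>2 + (cmod (voice_transform U \<phi> k t))\<^sup>2)"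
      by (intro Bochner_Integration.integrable_add int_sq)
    have "(\<lambda>t. cnj (voice_transform U \<phi> k t)) \<in> borel_measurable \<mu>"
      by (rule measurable_compose[OF meas borel_measurable_continuous_onI]) (intro continuous_intros)
    then show "(\<lambda>t. voice_transform U \<phi> f t * cnj (voice_transform U \<phi> k t)) \<in> borel_measurable \<mu>"
      by (intro borel_measurable_times meas)
    have "a * b \<le> a\<^sup>2 + b\<^sup>2" for a b :: real
      using sum_squares_bound[of a b] zero_le_power2[of a] zero_le_power2[of b] by linarith
    then show "AE t in \<mu>. norm (voice_transform U \<phi> f t * cnj (voice_transform U \<phi> k t)) \<le>
        norm ((cmod (voice_transform U \<phi> f t))\<^sup>2 + (cmod (voice_transform U \<phi> k t))\<^sup>2)"
      by (simp add: norm_mult)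
  qed
  have self: "Re (L2_inner \<mu> (voice_transform U \<phi> f) (voice_transform U \<phi> f)) =
      (LINT t|\<mu>. (cmod (voice_transform U \<phi> f t))\<^sup>2)" for f
    unfolding L2_inner_def complex_norm_square[symmetric] integral_complex_of_real by simp
  have nn: "(\<integral>\<^sup>+ t. ennreal ((cmod (cinner f (U t \<phi>)))\<^sup>2) \<partial>\<mu>) =
      ennreal (LINT t|\<mu>. (cmod (voice_transform U \<phi> f t))\<^sup>2)" for f
    using nn_integral_eq_integral[OF int_sq, of f] by (simp add: voice_transform_def)
  show ?thesis
  proof
    show "complex_vec.subspace UNIV" "0 < c1" "0 \<le> c2"
      using c by (simp_all add: complex_vec.subspace_UNIV)
    fix x y z :: 'h and a
    show "L2_inner \<mu> (voice_transform U \<phi> (x + y)) (voice_transform U \<phi> z) =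
        L2_inner \<mu> (voice_transform U \<phi> x) (voice_transform U \<phi> z) + L2_inner \<mu> (voice_transform U \<phi> y) (voice_transform U \<phi> z)"
      unfolding L2_inner_def voice_transform_linear distrib_right by (rule Bochner_Integration.integral_add[OF int int])
    show "L2_inner \<mu> (voice_transform U \<phi> (a *\<^sub>C x)) (voice_transform U \<phi> y) =
        a * L2_inner \<mu> (voice_transform U \<phi> x) (voice_transform U \<phi> y)"
      unfolding L2_inner_def voice_transform_linear mult.assoc by simp
    show "L2_inner \<mu> (voice_transform U \<phi> x) (voice_transform U \<phi> y) =
        cnj (L2_inner \<mu> (voice_transform U \<phi> y) (voice_transform U \<phi> x))"
      unfolding L2_inner_def by (subst Bochner_Integration.integral_cnj[symmetric]) (simp add: mult.commute)
    have nonneg: "0 \<le> (LINT t|\<mu>. (cmod (voice_transform U \<phi> x t))\<^sup>2)"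
      by (rule Bochner_Integration.integral_nonneg) simp
    show "c1 * (norm x)\<^sup>2 \<le> Re (L2_inner \<mu> (voice_transform U \<phi> x) (voice_transform U \<phi> x))"
      using bounds(1)[of x] nonneg unfolding self nn by simp
    show "Re (L2_inner \<mu> (voice_transform U \<phi> x) (voice_transform U \<phi> x)) \<le> c2 * (norm x)\<^sup>2"
      using bounds(2)[of x] c unfolding self nn by simp
  qed
qed

theorem theorem1:
  fixes \<mu> :: "'g::{topological_ab_group_add, t2_space} measure"
    and H :: "'g set"
    and \<nu> :: "('g \<Rightarrow> complex) measure"
    and U :: "'g \<Rightarrow> 'h::complex_hilbert \<Rightarrow> 'h"
    and \<phi> :: 'h
    and \<Phi> :: "'n::finite \<Rightarrow> 'h"
    and A :: "('g \<Rightarrow> complex)^'n^'m::finite"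
    and Ahat :: "('g \<Rightarrow> complex) \<Rightarrow> complex^'n^'m"
    and L :: "'m \<Rightarrow> ('g \<Rightarrow> complex) \<Rightarrow> 'g \<Rightarrow> complex"
  assumes G: "locally_compact_space (euclidean :: 'g topology)"
    and Haar: "haar_measure euclidean (+) \<mu>"
    and separable: "\<exists>D :: 'h set. countable D \<and> closure D = UNIV"
    and rep: "unitary_representation U"
    and frame: "continuous_frame \<mu> (\<lambda>t. U t \<phi>)"
    and H: "add_subgroup H" "countable H" "discrete H"
    and dual: "dual_haar_measure H \<nu>"
    and riesz: "riesz_basis (H \<times> UNIV) (\<lambda>(h, n). U h (\<Phi> n)) (H_Phi H U \<Phi>)"
    and sampling: "stable_sampling_procedure H \<nu> U \<phi> \<Phi> A Ahat L"
  shows "\<exists>S :: 'm \<Rightarrow> 'g \<Rightarrow> complex.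
    (\<forall>m. S m \<in> sampling_space H U \<phi> \<Phi>) \<and>
    is_frame (L2_inner \<mu>) (sampling_space H U \<phi> \<Phi>) (UNIV \<times> H) (\<lambda>(m, t) s. S m (s - t)) \<and>
    (\<forall>F \<in> sampling_space H U \<phi> \<Phi>.
       (\<forall>s. (\<lambda>(m, t). cmod (L m F t * S m (s - t))) summable_on (UNIV \<times> H) \<and>
            F s = (\<Sum>m\<in>UNIV. \<Sum>\<^sub>\<infinity>t\<in>H. L m F t * S m (s - t))) \<and>
       uniform_limit UNIV (\<lambda>X s. \<Sum>(m, t)\<in>X. L m F t * S m (s - t)) F
         (finite_subsets_at_top (UNIV \<times> H)) \<and>
       ((\<lambda>X. L2_dist_sq \<mu> (\<lambda>s. \<Sum>(m, t)\<in>X. L m F t * S m (s - t)) F) \<longlongrightarrow> 0)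
         (finite_subsets_at_top (UNIV \<times> H)))"
proof -
  interpret riesz_system H \<nu> U \<Phi>
    by (intro riesz_system.intro discrete_dual.intro riesz_system_axioms.intro H dual rep riesz)
  obtain c1 c2 where c: "0 < c1" "c1 \<le> c2"
    and bounds: "\<forall>x. ennreal (c1 * (norm x)\<^sup>2) \<le> (\<integral>\<^sup>+ t. ennreal ((cmod (cinner x (U t \<phi>)))\<^sup>2) \<partial>\<mu>) \<and>
      (\<integral>\<^sup>+ t. ennreal ((cmod (cinner x (U t \<phi>)))\<^sup>2) \<partial>\<mu>) \<le> ennreal (c2 * (norm x)\<^sup>2)"
    using frame unfolding continuous_frame_def by (elim exE conjE)
  define W where "W = voice_transform U \<phi>"
  interpret q: hermitian_form UNIV "\<lambda>f k. L2_inner \<mu> (W f) (W k)" c1 c2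
    unfolding W_def by (rule voice_transform_hermitian_form[OF Haar rep c]) (use bounds in auto)
  define V where "V = H_Phi H U \<Phi>"
  define J :: "('m \<times> 'g) set" where "J = UNIV \<times> H"
  obtain g :: "'m \<Rightarrow> 'h" and B K :: real where B: "0 \<le> B" and K: "0 \<le> K"
    and g: "\<forall>m. g m \<in> V"
    and expand: "\<forall>f\<in>V. ((\<lambda>i. L (fst i) (W f) (snd i) *\<^sub>C U (snd i) (g (fst i))) has_sum f) J \<and>
      (\<lambda>i. (cmod (L (fst i) (W f) (snd i)))\<^sup>2) summable_on J \<and>
      (\<Sum>\<^sub>\<infinity>i\<in>J. (cmod (L (fst i) (W f) (snd i)))\<^sup>2) \<le> K * (norm f)\<^sup>2"
    and synth: "\<forall>X a. finite X \<longrightarrow> X \<subseteq> J \<longrightarrow>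
      (norm (\<Sum>i\<in>X. a i *\<^sub>C U (snd i) (g (fst i))))\<^sup>2 \<le> B * (\<Sum>i\<in>X. (cmod (a i))\<^sup>2)"
    using sampling_dual_frame[OF sampling, folded V_def W_def J_def] by (elim exE conjE)
  define S where "S m = W (g m)" for m
  have shift: "(\<lambda>s. S m (s - t)) = W (U t (g m))" for m t
    unfolding S_def W_def by (intro ext) (simp add: voice_transform_translate[OF rep])
  have space: "sampling_space H U \<phi> \<Phi> = W ` V"
    by (simp add: sampling_space_def W_def V_def)
  have UgV: "U (snd i) (g (fst i)) \<in> V" if "i \<in> J" for i
  proof -
    have "snd i \<in> H"
      using that by (auto simp: J_def)
    then have "U (snd i) ` V = V"
      unfolding V_def by (rule H_Phi_image_translation)
    then show ?thesis
      using g by (metis image_eqI)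
  qed
  have is_frame: "is_frame (L2_inner \<mu>) (W ` V) J (\<lambda>(m, t) s. S m (s - t))"
    unfolding is_frame_def
  proof (intro conjI)
    show "\<forall>i\<in>J. (case i of (m, t) \<Rightarrow> \<lambda>s. S m (s - t)) \<in> W ` V"
    proof
      fix i assume "i \<in> J"
      then show "(case i of (m, t) \<Rightarrow> \<lambda>s. S m (s - t)) \<in> W ` V"
        unfolding case_prod_beta shift using UgV by (intro imageI)
    qed
    \<comment> \<open>\<open>frame_bounds\<close> gives the lower bound with the factor
      \<open>K / c1\<close>, which may be \<open>0\<close>; the \<open>1\<close> permits the inverse
      and makes \<open>1 / a\<close> at most \<open>1\<close>, hence at most the upper constant
      \<open>c2 * B + 1\<close>.\<close>
    define a where "a = K / c1 + 1"
    have a: "1 \<le> a"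
      using K c by (simp add: a_def)
    show "\<exists>c C. 0 < c \<and> c \<le> C \<and> (\<forall>y\<in>W ` V.
      (\<lambda>i. (cmod (L2_inner \<mu> y (case i of (m, t) \<Rightarrow> \<lambda>s. S m (s - t))))\<^sup>2) summable_on J \<and>
      c * Re (L2_inner \<mu> y y) \<le> (\<Sum>\<^sub>\<infinity>i\<in>J. (cmod (L2_inner \<mu> y (case i of (m, t) \<Rightarrow> \<lambda>s. S m (s - t))))\<^sup>2) \<and>
      (\<Sum>\<^sub>\<infinity>i\<in>J. (cmod (L2_inner \<mu> y (case i of (m, t) \<Rightarrow> \<lambda>s. S m (s - t))))\<^sup>2) \<le> C * Re (L2_inner \<mu> y y))"
    proof (rule exI[of _ "1 / a"], rule exI[of _ "c2 * B + 1"], intro conjI ballI)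
      show "0 < 1 / a"
        using a by simp
      have "0 \<le> c2 * B"
        using c B by simp
      moreover have "1 / a \<le> 1"
        using a by simp
      ultimately show "1 / a \<le> c2 * B + 1"
        by linarith
      fix y assume "y \<in> W ` V"
      then obtain f where f: "f \<in> V" "y = W f"
        by blast
      have fe: "((\<lambda>i. L (fst i) (W f) (snd i) *\<^sub>C U (snd i) (g (fst i))) has_sum f) J"
        "(\<lambda>i. (cmod (L (fst i) (W f) (snd i)))\<^sup>2) summable_on J"
        "(\<Sum>\<^sub>\<infinity>i\<in>J. (cmod (L (fst i) (W f) (snd i)))\<^sup>2) \<le> K * (norm f)\<^sup>2"
        using expand f(1) by simp_all
      \<comment> \<open>The expansion coefficients are the samples, while the frame inequality
        concerns the \<open>L\<^sup>2\<close> products with the translates of \<open>S m\<close>;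
        \<open>frame_bounds\<close> links the two.\<close>
      note fb = q.frame_bounds[OF UNIV_I UNIV_I B K synth[rule_format] fe]
      have eq: "(case i of (m, t) \<Rightarrow> \<lambda>s. S m (s - t)) = W (U (snd i) (g (fst i)))" for i
        by (simp add: case_prod_beta shift)
      show "(\<lambda>i. (cmod (L2_inner \<mu> y (case i of (m, t) \<Rightarrow> \<lambda>s. S m (s - t))))\<^sup>2) summable_on J"
        unfolding eq f(2) by (rule fb(1))
      define R where "R = (\<Sum>\<^sub>\<infinity>i\<in>J. (cmod (L2_inner \<mu> (W f) (W (U (snd i) (g (fst i))))))\<^sup>2)"
      have R: "0 \<le> R"
        unfolding R_def by (intro infsum_nonneg) simp
      have "Re (L2_inner \<mu> (W f) (W f)) \<le> K / c1 * R"
        unfolding R_def by (rule fb(2))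
      also have "\<dots> \<le> a * R"
        using R by (simp add: a_def distrib_right)
      finally have "1 / a * Re (L2_inner \<mu> (W f) (W f)) \<le> R"
        using a by (simp add: field_simps)
      then show "1 / a * Re (L2_inner \<mu> y y) \<le> (\<Sum>\<^sub>\<infinity>i\<in>J. (cmod (L2_inner \<mu> y (case i of (m, t) \<Rightarrow> \<lambda>s. S m (s - t))))\<^sup>2)"
        unfolding eq f(2) R_def .
      have "R \<le> c2 * B * Re (L2_inner \<mu> (W f) (W f))"
        unfolding R_def by (rule fb(3))
      also have "\<dots> \<le> (c2 * B + 1) * Re (L2_inner \<mu> (W f) (W f))"
        using q.self_nonneg[of f] by (simp add: distrib_right)
      finally show "(\<Sum>\<^sub>\<infinity>i\<in>J. (cmod (L2_inner \<mu> y (case i of (m, t) \<Rightarrow> \<lambda>s. S m (s - t))))\<^sup>2) \<le> (c2 * B + 1) * Re (L2_inner \<mu> y y)"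
        unfolding eq f(2) R_def .
    qed
  qed
  have main: "(\<lambda>(m, t). cmod (L m F t * S m (s - t))) summable_on J"
    "F s = (\<Sum>m\<in>UNIV. \<Sum>\<^sub>\<infinity>t\<in>H. L m F t * S m (s - t))"
    "uniform_limit UNIV (\<lambda>X s. \<Sum>(m, t)\<in>X. L m F t * S m (s - t)) F (finite_subsets_at_top J)"
    "((\<lambda>X. L2_dist_sq \<mu> (\<lambda>s. \<Sum>(m, t)\<in>X. L m F t * S m (s - t)) F) \<longlongrightarrow> 0) (finite_subsets_at_top J)"
    if F: "F \<in> W ` V" for F s
  proof -
    obtain f where f: "f \<in> V" "F = W f"
      using F by blast
    \<comment> \<open>The partial sums of the sampling series are the voice transforms of
      \<open>P X\<close>. Pointwise, uniform and \<open>L\<^sup>2\<close> convergence all follow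
      from \<open>P X\<close> tending to \<open>f\<close>.\<close>
    define P where "P X = (\<Sum>i\<in>X. L (fst i) F (snd i) *\<^sub>C U (snd i) (g (fst i)))" for X
    have P: "(\<Sum>(m, t)\<in>X. L m F t * S m (s - t)) = W (P X) s" for X s
      unfolding P_def W_def voice_transform_linear
      by (intro sum.cong refl) (simp add: S_def W_def voice_transform_translate[OF rep] case_prod_beta)
    have lim: "(P \<longlongrightarrow> f) (finite_subsets_at_top J)"
      using expand f(1) unfolding has_sum_def P_def f(2) by simp
    have diff: "((\<lambda>X. norm (P X - f)) \<longlongrightarrow> 0) (finite_subsets_at_top J)"
      using lim by (intro tendsto_norm_zero LIM_zero)
    have pointwise: "((\<lambda>(m, t). L m F t * S m (s - t)) has_sum F s) J"
      unfolding has_sum_def P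
    proof (rule LIM_zero_cancel, rule Lim_null_comparison)
      show "\<forall>\<^sub>F X in finite_subsets_at_top J. norm (W (P X) s - F s) \<le> norm (P X - f) * norm \<phi>"
        using norm_voice_transform_le[OF rep, of \<phi> "P _ - f" s]
        by (simp add: W_def f(2) voice_transform_linear)
      show "((\<lambda>X. norm (P X - f) * norm \<phi>) \<longlongrightarrow> 0) (finite_subsets_at_top J)"
        by (rule tendsto_mult_left_zero[OF diff])
    qed
    then have summable: "(\<lambda>(m, t). L m F t * S m (s - t)) summable_on J"
      by (auto simp: summable_on_def)
    \<comment> \<open>For complex series, convergence along all finite index sets is absolute
      convergence.\<close>
    then show "(\<lambda>(m, t). cmod (L m F t * S m (s - t))) summable_on J"
      using summable_on_iff_abs_summable_on_complex[of "\<lambda>(m, t). L m F t * S m (s - t)" J]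
      by (simp add: case_prod_unfold)
    have "(\<lambda>t. L m F t * S m (s - t)) summable_on H" for m
    proof -
      have "(\<lambda>(m, t). L m F t * S m (s - t)) summable_on (Pair m ` H)"
        by (rule summable_on_subset_banach[OF summable]) (auto simp: J_def)
      then show ?thesis
        by (subst (asm) summable_on_reindex) (auto simp: inj_on_def o_def)
    qed
    then have "((\<lambda>(m, t). L m F t * S m (s - t)) has_sum (\<Sum>m\<in>UNIV. \<Sum>\<^sub>\<infinity>t\<in>H. L m F t * S m (s - t))) J"
      unfolding J_def by (intro has_sum_finite_times has_sum_infsum)
    then show "F s = (\<Sum>m\<in>UNIV. \<Sum>\<^sub>\<infinity>t\<in>H. L m F t * S m (s - t))"
      by (rule has_sum_unique[OF pointwise])
    show "uniform_limit UNIV (\<lambda>X s. \<Sum>(m, t)\<in>X. L m F t * S m (s - t)) F (finite_subsets_at_top J)"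
    proof (rule uniform_limitI)
      fix e :: real assume e: "0 < e"
      have "((\<lambda>X. norm (P X - f) * norm \<phi>) \<longlongrightarrow> 0) (finite_subsets_at_top J)"
        by (rule tendsto_mult_left_zero[OF diff])
      then have "\<forall>\<^sub>F X in finite_subsets_at_top J. norm (P X - f) * norm \<phi> < e"
        using e by (rule order_tendstoD)
      then show "\<forall>\<^sub>F X in finite_subsets_at_top J. \<forall>s\<in>UNIV. dist (\<Sum>(m, t)\<in>X. L m F t * S m (s - t)) (F s) < e"
      proof eventually_elim
        case (elim X)
        have "dist (W (P X) s) (F s) \<le> norm (P X - f) * norm \<phi>" for s
          using norm_voice_transform_le[OF rep, of \<phi> "P X - f" s]
          by (simp add: W_def f(2) voice_transform_linear dist_norm)
        with elim show ?case
          unfolding P by (auto intro: order_le_less_trans)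
      qed
    qed
    show "((\<lambda>X. L2_dist_sq \<mu> (\<lambda>s. \<Sum>(m, t)\<in>X. L m F t * S m (s - t)) F) \<longlongrightarrow> 0) (finite_subsets_at_top J)"
      unfolding P
    proof (rule tendsto_sandwich[OF _ _ tendsto_const])
      have "((\<lambda>X. ennreal (c2 * (norm (P X - f))\<^sup>2)) \<longlongrightarrow> ennreal (c2 * 0\<^sup>2)) (finite_subsets_at_top J)"
        by (intro tendsto_ennrealI tendsto_mult tendsto_const tendsto_power diff)
      then show "((\<lambda>X. ennreal (c2 * (norm (P X - f))\<^sup>2)) \<longlongrightarrow> 0) (finite_subsets_at_top J)"
        by simp
      \<comment> \<open>The upper bound of the continuous frame, applied to the vector
        \<open>P X - f\<close>.\<close>
      have "L2_dist_sq \<mu> (\<lambda>s. W (P X) s) F \<le> ennreal (c2 * (norm (P X - f))\<^sup>2)" for X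
        using bounds unfolding L2_dist_sq_def f(2) W_def voice_transform_linear(3)[symmetric]
        by (simp add: voice_transform_def)
      then show "\<forall>\<^sub>F X in finite_subsets_at_top J. L2_dist_sq \<mu> (\<lambda>s. W (P X) s) F \<le> ennreal (c2 * (norm (P X - f))\<^sup>2)"
        by simp
    qed simp
  qed
  show ?thesis
    unfolding space J_def[symmetric]
    using g is_frame main by (intro exI[of _ S] conjI allI ballI) (simp_all add: S_def)
qed

end
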